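(* Let $R=\mathbb{Q}[q^{\pm1}]$ and write $\{d\}=R/(\varphi_d)$, where $\varphi_d$ is the $d$-th cyclotomic polynomial in $q$. For the Coxeter systems $(W,S)$ of the exceptional finite types $H_3,H_4,F_4,E_6,E_7,E_8$, the local homology groups $H_i=H_i(X_W;R)$, $0\le i\le |S|-1$, are, as $R$-modules, the following. Type $H_3$: $H_0\cong\{2\}$, $H_1=0$, $H_2\cong\{2\}\oplus\{6\}\oplus\{10\}$. Type $H_4$: $H_0\cong\{2\}$, $H_1=H_2=0$, $H_3\cong\{2\}\oplus\{3\}\oplus\{4\}\oplus\{5\}\oplus\{6\}\oplus\{10\}\oplus\{12\}\oplus\{15\}\oplus\{20\}\oplus\{30\}$. Type $F_4$: $H_0\cong\{2\}$, $H_1\cong\{2\}$, $H_2\cong\{2\}\oplus\{3\}\oplus\{6\}$, $H_3\cong\{2\}\oplus\{3\}\oplus\{4\}\oplus\{6\}\oplus\{8\}\oplus\{12\}$. Type $E_6$: $H_0\cong\{2\}$, $H_1=H_2=H_3=0$, $H_4\cong\{6\}\oplus\{8\}$, $H_5\cong\{3\}\oplus\{6\}\oplus\{9\}\oplus\{12\}$. Type $E_7$: $H_0\cong\{2\}$, $H_1=H_2=H_3=0$, $H_4\cong\{6\}$, $H_5\cong\{6\}$, $H_6\cong\{2\}\oplus\{6\}\oplus\{14\}\oplus\{18\}$. Type $E_8$: $H_0\cong\{2\}$, $H_1=H_2=H_3=0$, $H_4\cong\{4\}$, $H_5=0$, $H_6\cong\{8\}\oplus\{12\}$, $H_7\cong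\{2\}\oplus\{3\}\oplus\{4\}\oplus\{5\}\oplus\{6\}\oplus\{8\}\oplus\{10\}\oplus\{12\}\oplus\{15\}\oplus\{20\}\oplus\{24\}\oplus\{30\}$.
   Context: For a Coxeter system $(W,S)$ with $S$ finite, $X_W$ is the quotient of the Salvetti complex of $W$ by the action of $W$; its fundamental group is the Artin group $G_W$, and its cells are indexed by $K_W=\{\sigma\subseteq S\mid \text{the parabolic subgroup } W_\sigma \text{ generated by }\sigma\text{ is finite}\}$ (including $\varnothing$; for $W$ finite, $K_W$ consists of all subsets of $S$). The coefficients are in the local system on $X_W$ given by the action of $G_W$ on $R$ in which every standard generator acts as multiplication by $-q$. Concretely, $H_*(X_W;R)$ is the homology of the complex of free $R$-modules $C_k=\bigoplus_{\sigma\in K_W,\ |\sigma|=k}R\,e_\sigma$ with boundary $$\partial(e_\sigma)=\sum_{\tau\subset\sigma,\ |\tau|=|\sigma|-1}[\sigma:\tau]\,\frac{W_\sigma(q)}{W_\tau(q)}\,e_\tau,$$ where $W_\sigma(q)=\sum_{w\in W_\sigma}q^{\ell(w)}$ is the Poincaré polynomial of $W_\sigma$ and $[\sigma:\tau]=\pm1$ is the usual simplicial incidence number with respect to a fixed total order on $S$. In type $X_n$ one has $|S|=n$. *)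

theory Defs
  imports
    "HOL-Algebra.Algebraic_Closure_Type"
    "HOL-Algebra.Multiplicative_Group"
    "HOL-Algebra.Generated_Groups"
    "HOL-Library.Poly_Mapping"
begin

section \<open>Coxeter systems\<close>

definition word_prod :: "('a, 'b) monoid_scheme \<Rightarrow> 'a list \<Rightarrow> 'a" where
  "word_prod W ws = foldr (\<lambda>x y. x \<otimes>\<^bsub>W\<^esub> y) ws \<one>\<^bsub>W\<^esub>"

text \<open>Elementary deletion of a relator $(st)^{m(s,t)}$, where $m(s,t)$ is the order of $st$ in $W$.
  The library gives elements of infinite order the order $0$; such pairs contribute no relator.
  The case $s = t$ has $m(s,s) = 1$ and contributes the relator $s^2$.\<close>

definition coxeter_step :: "('a, 'b) monoid_scheme \<Rightarrow> 'a set \<Rightarrow> 'a list \<Rightarrow> 'a list \<Rightarrow> bool" where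
  "coxeter_step W S us vs \<longleftrightarrow>
     (\<exists>xs ys. \<exists>s\<in>S. \<exists>t\<in>S. group.ord W (s \<otimes>\<^bsub>W\<^esub> t) \<noteq> 0 \<and>
        us = xs @ concat (replicate (group.ord W (s \<otimes>\<^bsub>W\<^esub> t)) [s, t]) @ ys \<and> vs = xs @ ys)"

text \<open>Bourbaki's definition: $S$ consists of elements of order $2$, generates $W$, and $W$ is
  presented by the generators $S$ and the relations $(st)^{m(s,t)} = 1$. As the relators $s^2$ make
  every generator its own inverse, the presented group consists of the words in $S$ (without formal
  inverses) modulo the equivalence relation generated by relator deletions.\<close>

definition coxeter_system :: "('a, 'b) monoid_scheme \<Rightarrow> 'a set \<Rightarrow> bool" where
  "coxeter_system W S \<longleftrightarrow>
     group W \<and> S \<subseteq> carrier W \<and> (\<forall>s\<in>S. group.ord W s = 2) \<and> generate W S = carrier W \<and>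
     (\<forall>us\<in>lists S. \<forall>vs\<in>lists S.
        word_prod W us = word_prod W vs \<longleftrightarrow> equivclp (coxeter_step W S) us vs)"

definition coxeter_length :: "('a, 'b) monoid_scheme \<Rightarrow> 'a set \<Rightarrow> 'a \<Rightarrow> nat" where
  "coxeter_length W S w = (LEAST n. \<exists>ws\<in>lists S. length ws = n \<and> word_prod W ws = w)"

datatype exceptional_type = H3 | H4 | F4 | E6 | E7 | E8

fun type_rank :: "exceptional_type \<Rightarrow> nat" where
  "type_rank H3 = 3"
| "type_rank H4 = 4"
| "type_rank F4 = 4"
| "type_rank E6 = 6"
| "type_rank E7 = 7"
| "type_rank E8 = 8"

text \<open>Coxeter graphs with Bourbaki's numbering of the vertices from $1$; an entry $((i,j),m)$ with
  $i < j$ is an edge with label $m$.\<close>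

fun coxeter_graph :: "exceptional_type \<Rightarrow> ((nat \<times> nat) \<times> nat) list" where
  "coxeter_graph H3 = [((1,2),5), ((2,3),3)]"
| "coxeter_graph H4 = [((1,2),5), ((2,3),3), ((3,4),3)]"
| "coxeter_graph F4 = [((1,2),3), ((2,3),4), ((3,4),3)]"
| "coxeter_graph E6 = [((1,3),3), ((3,4),3), ((2,4),3), ((4,5),3), ((5,6),3)]"
| "coxeter_graph E7 = [((1,3),3), ((3,4),3), ((2,4),3), ((4,5),3), ((5,6),3), ((6,7),3)]"
| "coxeter_graph E8 = [((1,3),3), ((3,4),3), ((2,4),3), ((4,5),3), ((5,6),3), ((6,7),3), ((7,8),3)]"

definition coxeter_matrix :: "exceptional_type \<Rightarrow> nat \<Rightarrow> nat \<Rightarrow> nat" where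
  "coxeter_matrix T i j =
     (if i = j then 1
      else case map_of (coxeter_graph T) (min i j, max i j) of None \<Rightarrow> 2 | Some m \<Rightarrow> m)"

definition has_type :: "('a, 'b) monoid_scheme \<Rightarrow> 'a set \<Rightarrow> exceptional_type \<Rightarrow> bool" where
  "has_type W S T \<longleftrightarrow>
     (\<exists>s. bij_betw s {1..type_rank T} S \<and>
       (\<forall>i\<in>{1..type_rank T}. \<forall>j\<in>{1..type_rank T}.
          group.ord W (s i \<otimes>\<^bsub>W\<^esub> s j) = coxeter_matrix T i j))"


section \<open>The ring of Laurent polynomials\<close>

text \<open>$\mathbb{Q}[q^{\pm 1}]$ as the group algebra of $\mathbb{Z}$ over $\mathbb{Q}$: the
  multiplication of \<^typ>\<open>int \<Rightarrow>\<^sub>0 rat\<close> is convolution, and $q^i$ is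
  \<^term>\<open>Poly_Mapping.single (i::int) (1::rat)\<close>.\<close>

type_synonym laurent = "int \<Rightarrow>\<^sub>0 rat"

abbreviation laurent_ring :: "laurent ring" where
  "laurent_ring \<equiv> ring_of_type_algebra"

definition laurent_of_poly :: "rat poly \<Rightarrow> laurent" where
  "laurent_of_poly p = (\<Sum>i\<le>Polynomial.degree p. Poly_Mapping.single (int i) (poly.coeff p i))"

text \<open>The cyclotomic polynomials, by $X^n - 1 = \prod_{d \mid n} \varphi_d$ for $n \geq 1$; the
  division is exact.\<close>

function cyclotomic :: "nat \<Rightarrow> rat poly" where
  "cyclotomic n =
     (Polynomial.monom 1 n - 1) div (\<Prod>d\<in>{d\<in>{1..<n}. d dvd n}. cyclotomic d)"
  by auto
termination by (relation "measure id") auto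

declare cyclotomic.simps [simp del]


section \<open>Modules\<close>

text \<open>In module records the inherited fields \<^const>\<open>monoid.mult\<close> and \<^const>\<open>one\<close> play no role.\<close>

definition regular_module :: "('r, 'c) ring_scheme \<Rightarrow> ('r, 'r) module" where
  "regular_module R =
     \<lparr>carrier = carrier R, monoid.mult = undefined, one = undefined,
      zero = \<zero>\<^bsub>R\<^esub>, add = (\<lambda>x y. x \<oplus>\<^bsub>R\<^esub> y), module.smult = (\<lambda>a x. a \<otimes>\<^bsub>R\<^esub> x)\<rparr>"

text \<open>The direct product, which is the direct sum for the finite index sets used below.\<close>

definition direct_sum_module :: "'i set \<Rightarrow> ('i \<Rightarrow> ('r, 'm) module) \<Rightarrow> ('r, 'i \<Rightarrow> 'm) module" where
  "direct_sum_module I M =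
     \<lparr>carrier = (\<Pi>\<^sub>E i\<in>I. carrier (M i)), monoid.mult = undefined, one = undefined,
      zero = (\<lambda>i\<in>I. \<zero>\<^bsub>M i\<^esub>), add = (\<lambda>x y. \<lambda>i\<in>I. x i \<oplus>\<^bsub>M i\<^esub> y i),
      module.smult = (\<lambda>a x. \<lambda>i\<in>I. a \<odot>\<^bsub>M i\<^esub> x i)\<rparr>"

text \<open>For a submodule \<open>N\<close> of \<open>M\<close>; the scalar multiplication is given by $a (N + x) = N + a x$.\<close>

definition quotient_module :: "('r, 'm) module \<Rightarrow> 'm set \<Rightarrow> ('r, 'm set) module" where
  "quotient_module M N =
     \<lparr>carrier = a_rcosets\<^bsub>M\<^esub> N, monoid.mult = undefined, one = undefined,
      zero = N, add = set_add M, module.smult = (\<lambda>a A. \<Union>x\<in>A. N +>\<^bsub>M\<^esub> (a \<odot>\<^bsub>M\<^esub> x))\<rparr>"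

definition module_isomorphic ::
    "('r, 'c) ring_scheme \<Rightarrow> ('r, 'm) module \<Rightarrow> ('r, 'n) module \<Rightarrow> bool" where
  "module_isomorphic R M N \<longleftrightarrow>
     (\<exists>f. bij_betw f (carrier M) (carrier N) \<and>
       (\<forall>x\<in>carrier M. \<forall>y\<in>carrier M. f (x \<oplus>\<^bsub>M\<^esub> y) = f x \<oplus>\<^bsub>N\<^esub> f y) \<and>
       (\<forall>a\<in>carrier R. \<forall>x\<in>carrier M. f (a \<odot>\<^bsub>M\<^esub> x) = a \<odot>\<^bsub>N\<^esub> f x))"

abbreviation laurent_isomorphic ::
    "(laurent, 'm) module \<Rightarrow> (laurent, 'n) module \<Rightarrow> bool" (infix \<open>\<cong>\<^sub>R\<close> 50) where
  "M \<cong>\<^sub>R N \<equiv> module_isomorphic laurent_ring M N"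

text \<open>$\{d\} = R/(\varphi_d)$\<close>

definition cyclotomic_module :: "nat \<Rightarrow> (laurent, laurent set) module" where
  "cyclotomic_module d =
     quotient_module (regular_module laurent_ring)
       (PIdl\<^bsub>laurent_ring\<^esub> (laurent_of_poly (cyclotomic d)))"

text \<open>$\{d_1\} \oplus \dots \oplus \{d_k\}$, which is the zero module for the empty list.\<close>

definition cyclotomic_sum :: "nat list \<Rightarrow> (laurent, nat \<Rightarrow> laurent set) module" where
  "cyclotomic_sum ds = direct_sum_module {..<length ds} (\<lambda>i. cyclotomic_module (ds ! i))"


section \<open>The algebraic complex and its homology\<close>

definition poincare_poly :: "('a, 'b) monoid_scheme \<Rightarrow> 'a set \<Rightarrow> 'a set \<Rightarrow> rat poly" where
  "poincare_poly W S \<sigma> = (\<Sum>w\<in>generate W \<sigma>. Polynomial.monom 1 (coxeter_length W S w))"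

text \<open>The cells of dimension \<open>k\<close>.\<close>

definition cells :: "('a, 'b) monoid_scheme \<Rightarrow> 'a set \<Rightarrow> nat \<Rightarrow> 'a set set" where
  "cells W S k = {\<sigma>. \<sigma> \<subseteq> S \<and> finite (generate W \<sigma>) \<and> card \<sigma> = k}"

text \<open>For $\tau = \sigma \setminus \{s\}$ the sign is $(-1)^j$, where $j$ is the number of elements
  of $\sigma$ preceding $s$ in the total order \<open>r\<close>.\<close>

definition incidence :: "('a \<times> 'a) set \<Rightarrow> 'a set \<Rightarrow> 'a set \<Rightarrow> laurent" where
  "incidence r \<sigma> \<tau> = (-1) ^ card {t\<in>\<tau>. (t, the_elem (\<sigma> - \<tau>)) \<in> r}"

text \<open>$W_\tau(q)$ divides $W_\sigma(q)$ in $\mathbb{Q}[q]$ for $\tau \subseteq \sigma$, so that the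
  polynomial division is exact.\<close>

definition boundary_coeff ::
    "('a, 'b) monoid_scheme \<Rightarrow> 'a set \<Rightarrow> ('a \<times> 'a) set \<Rightarrow> 'a set \<Rightarrow> 'a set \<Rightarrow> laurent" where
  "boundary_coeff W S r \<sigma> \<tau> =
     incidence r \<sigma> \<tau> * laurent_of_poly (poincare_poly W S \<sigma> div poincare_poly W S \<tau>)"

text \<open>A chain $\sum_\sigma c_\sigma e_\sigma$ is represented by the function
  $\sigma \mapsto c_\sigma$ on the cells.\<close>

definition chain_module ::
    "('a, 'b) monoid_scheme \<Rightarrow> 'a set \<Rightarrow> nat \<Rightarrow> (laurent, 'a set \<Rightarrow> laurent) module" where
  "chain_module W S k = direct_sum_module (cells W S k) (\<lambda>_. regular_module laurent_ring)"

text \<open>The differential from degree \<open>Suc k\<close> to degree \<open>k\<close>.\<close>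

definition boundary ::
    "('a, 'b) monoid_scheme \<Rightarrow> 'a set \<Rightarrow> ('a \<times> 'a) set \<Rightarrow> nat
       \<Rightarrow> ('a set \<Rightarrow> laurent) \<Rightarrow> 'a set \<Rightarrow> laurent" where
  "boundary W S r k c =
     (\<lambda>\<tau>\<in>cells W S k. \<Sum>\<sigma>\<in>{\<sigma>\<in>cells W S (Suc k). \<tau> \<subset> \<sigma>}. c \<sigma> * boundary_coeff W S r \<sigma> \<tau>)"

fun cycles ::
    "('a, 'b) monoid_scheme \<Rightarrow> 'a set \<Rightarrow> ('a \<times> 'a) set \<Rightarrow> nat \<Rightarrow> ('a set \<Rightarrow> laurent) set" where
  "cycles W S r 0 = carrier (chain_module W S 0)"
| "cycles W S r (Suc k) =
     {c \<in> carrier (chain_module W S (Suc k)). boundary W S r k c = \<zero>\<^bsub>chain_module W S k\<^esub>}"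

definition boundaries ::
    "('a, 'b) monoid_scheme \<Rightarrow> 'a set \<Rightarrow> ('a \<times> 'a) set \<Rightarrow> nat \<Rightarrow> ('a set \<Rightarrow> laurent) set" where
  "boundaries W S r k = boundary W S r k ` carrier (chain_module W S (Suc k))"

text \<open>The homology of the quotient of the Salvetti complex with coefficients in the local system of
  Laurent polynomials on which the standard generators act as $-q$.\<close>

definition homology ::
    "('a, 'b) monoid_scheme \<Rightarrow> 'a set \<Rightarrow> ('a \<times> 'a) set \<Rightarrow> nat
       \<Rightarrow> (laurent, ('a set \<Rightarrow> laurent) set) module" where
  "homology W S r k =
     quotient_module ((chain_module W S k)\<lparr>carrier := cycles W S r k\<rparr>) (boundaries W S r k)"

end

theory Submission
  imports Defs
begin

text \<open>After rescaling the cell $e_\sigma$ by $W_\sigma(q)$, the differential becomes that of the full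
  simplex on $S$, so the complex is the lattice of those simplicial chains over $R$ whose coefficient at
  $\sigma$ is divisible by $W_\sigma(q) = \prod_d \varphi_d^{v_d(\sigma)}$, where $v_d(\sigma)$ counts the
  degrees of $W_\sigma$ that are divisible by $d$. For each $d$ the problem becomes the persistent homology
  of the simplex filtered by $v_d$: an acyclic matching of its faces along which $v_d$ is constant, up
  to a few pairs where it jumps by $1$, shows that locally at $\varphi_d$ each exceptional pair contributes
  a summand $R/(\varphi_d)$ and nothing else survives. Since the $\varphi_d$ are pairwise comaximal, the
  local statements combine.

  The degrees of $W_\sigma$ are found by adjoining one generator at a time: the quotient
  $W_\sigma(q) / W_{\sigma \setminus \{s\}}(q)$ is the generating function of the orbit of a fundamental weight
  by length of minimal coset representatives.\<close>

section \<open>The weighted simplex\<close>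

text \<open>The empty face counts as a cell, so the full simplex is acyclic over every ring and all
  homology is due to the weights: a cycle always bounds, but perhaps no chain that is divisible
  enough. A pair along which v_d jumps by 1 costs exactly one factor \<phi>_d, so no quotient by a
  higher power occurs. The matching only bounds the local homology from above. That the summand
  really occurs is shown by a dual pair: a cochain \<open>\<xi>\<close>, a cocycle on the faces of
  small weight, which gives a functional on homology with values in R/(\<phi>_d), and a chain
  \<open>y\<close> whose boundary, suitably scaled, is a cycle on which this functional is a unit.
  For each d there is at most one exceptional pair in each degree, so the linear algebra is about a
  single coefficient. No localization is formed: statements at \<phi>_d are multiplied by powers of
  the other cyclotomic polynomials and glued by a partition of unity. The group is given only by its
  presentation, so finiteness and Poincare polynomials of its parabolic subgroups must be proved as
  well. What is left is a finite computation on at most 2^8 faces and is decided by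
  evaluation.\<close>

definition cnt :: "bool list \<Rightarrow> nat" where "cnt bs = count_list bs True"

lemma cnt_simps [simp]: "cnt [] = 0" "cnt (True # bs) = Suc (cnt bs)" "cnt (False # bs) = cnt bs"
  by (simp_all add: cnt_def)

lemma cnt_up: "j < length bs \<Longrightarrow> \<not> bs ! j \<Longrightarrow> cnt (bs[j := True]) = Suc (cnt bs)"
proof (induction bs arbitrary: j)
  case (Cons b bs) then show ?case by (cases j; cases b) auto
qed simp

text \<open>A bit list is a subset of an ordered vertex set, and a chain is its coefficient
  function, so the boundary at \<open>bs\<close> collects the cofaces of \<open>bs\<close>. Passing
  a vertex of \<open>bs\<close> contributes the sign -1. The face without vertices is included, so
  this is the augmented complex.\<close>

fun bd :: "(bool list \<Rightarrow> 'a::comm_ring_1) \<Rightarrow> bool list \<Rightarrow> 'a" where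
  "bd x [] = 0"
| "bd x (b # bs) =
     (if b then - bd (\<lambda>c. x (True # c)) bs
      else x (True # bs) + bd (\<lambda>c. x (False # c)) bs)"

fun cobd :: "(bool list \<Rightarrow> 'a::comm_ring_1) \<Rightarrow> bool list \<Rightarrow> 'a" where
  "cobd x [] = 0"
| "cobd x (b # bs) =
     (if b then x (False # bs) - cobd (\<lambda>c. x (True # c)) bs
      else cobd (\<lambda>c. x (False # c)) bs)"

fun cube :: "nat \<Rightarrow> bool list list" where
  "cube 0 = [[]]"
| "cube (Suc n) = map (Cons False) (cube n) @ map (Cons True) (cube n)"

lemma set_cube: "set (cube n) = {bs. length bs = n}"
proof (induction n)
  case (Suc n)
  have "bs \<in> set (cube (Suc n)) \<longleftrightarrow> length bs = Suc n" for bs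
    using Suc by (cases bs) (auto simp: image_iff)
  then show ?case by blast
qed simp

lemma finite_cube: "finite {bs::bool list. length bs = n}"
  using set_cube[of n] by (metis List.finite_set)

lemma sum_cube_Suc:
  "(\<Sum>bs | length bs = Suc n. f bs) = (\<Sum>bs | length bs = n. f (False # bs)) + (\<Sum>bs | length bs = n. f (True # bs))"
proof -
  have "{bs. length bs = Suc n} = Cons False ` {bs. length bs = n} \<union> Cons True ` {bs. length bs = n}"
    unfolding set_cube[symmetric] by simp
  moreover have "sum f (Cons False ` {bs. length bs = n} \<union> Cons True ` {bs. length bs = n}) =
      sum f (Cons False ` {bs. length bs = n}) + sum f (Cons True ` {bs. length bs = n})"
    by (rule sum.union_disjoint) (auto simp: finite_cube)
  ultimately show ?thesis
    by (simp add: sum.reindex)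
qed

lemma bd_cong: "(\<And>c. length c = length bs \<Longrightarrow> x c = y c) \<Longrightarrow> bd x bs = bd y bs"
proof (induction bs arbitrary: x y)
  case (Cons b bs)
  have "bd (\<lambda>c. x (b # c)) bs = bd (\<lambda>c. y (b # c)) bs" for b
    by (rule Cons.IH) (simp add: Cons.prems)
  then show ?case using Cons.prems by simp
qed simp

lemma bd_add: "bd (\<lambda>c. x c + y c) bs = bd x bs + bd y bs"
  by (induction bs arbitrary: x y) simp_all

lemma bd_scale: "bd (\<lambda>c. a * x c) bs = a * bd x bs"
  by (induction bs arbitrary: x) (simp_all add: algebra_simps)

lemma bd_uminus: "bd (\<lambda>c. - x c) bs = - bd x bs"
  using bd_scale[of "-1" x bs] by simp

lemma bd_diff: "bd (\<lambda>c. x c - y c) bs = bd x bs - bd y bs"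
  using bd_add[of x "\<lambda>c. - y c" bs] bd_uminus[of y bs] by simp

lemma bd_zero: "bd (\<lambda>c. 0) bs = 0"
  using bd_scale[of 0 "\<lambda>c. 0" bs] by simp

lemma bd_sum: "bd (\<lambda>c. \<Sum>i\<in>I. x i c) bs = (\<Sum>i\<in>I. bd (x i) bs)"
  by (induction I rule: infinite_finite_induct) (simp_all add: bd_zero bd_add)

lemma bd_bd: "bd (bd x) bs = 0"
proof (induction bs arbitrary: x)
  case (Cons b bs)
  have "bd (\<lambda>c. bd x (False # c)) bs = bd (\<lambda>c. x (True # c)) bs"
    using Cons by (simp add: bd_add)
  moreover have "bd (\<lambda>c. bd x (True # c)) bs = 0"
    using Cons by (simp add: bd_uminus)
  ultimately show ?case by simp
qed simp

definition sg :: "bool list \<Rightarrow> nat \<Rightarrow> 'a::comm_ring_1" where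
  "sg bs j = (- 1) ^ cnt (take j bs)"

lemma sg_square [simp]: "sg bs j * sg bs j = 1" "sg bs j * (sg bs j * a) = a"
  by (simp_all add: sg_def flip: power_add mult.assoc power_mult_distrib)

lemma bd_altdef:
  "bd x bs = (\<Sum>j | j < length bs \<and> \<not> bs ! j. sg bs j * x (bs[j := True]))"
proof (induction bs arbitrary: x)
  case (Cons b bs)
  have *: "{j. j < length (b # bs) \<and> \<not> (b # bs) ! j} =
      (if b then {} else {0}) \<union> Suc ` {j. j < length bs \<and> \<not> bs ! j}" (is "?A = ?B")
  proof -
    have "j \<in> ?A \<longleftrightarrow> j \<in> ?B" for j by (cases j) auto
    then show ?thesis by blast
  qed
  show ?case
    unfolding * using Cons
    by (cases b) (simp_all add: sum.union_disjoint sum.reindex sg_def sum_negf)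
qed simp

text \<open>\<open>cobd\<close> is the transpose of \<open>bd\<close>. Every divisibility estimate
  below uses this to move a boundary onto the cochain, whose coboundary vanishes on all faces of
  small weight.\<close>

lemma sum_bd_cobd:
  "(\<Sum>bs | length bs = n. f bs * bd x bs) = (\<Sum>bs | length bs = n. cobd f bs * x bs)"
proof (induction n arbitrary: f x)
  case (Suc n)
  have "(\<Sum>bs | length bs = Suc n. f bs * bd x bs) =
     (\<Sum>bs | length bs = n. f (False # bs) * x (True # bs)) +
     (\<Sum>bs | length bs = n. f (False # bs) * bd (\<lambda>c. x (False # c)) bs) -
     (\<Sum>bs | length bs = n. f (True # bs) * bd (\<lambda>c. x (True # c)) bs)"
    by (simp add: sum_cube_Suc algebra_simps sum.distrib sum_negf)
  also have "\<dots> = (\<Sum>bs | length bs = Suc n. cobd f bs * x bs)"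
    by (simp add: sum_cube_Suc Suc algebra_simps sum.distrib sum_subtractf)
  finally show ?case .
qed simp

definition unit_chain :: "bool list \<Rightarrow> bool list \<Rightarrow> 'a::comm_ring_1" where
  "unit_chain r c = (if c = r then 1 else 0)"

lemma bd_unit_chain:
  assumes "length bs = length r"
  shows "bd (unit_chain r) bs = (\<Sum>j | j < length r \<and> r ! j \<and> bs = r[j := False]. sg bs j)"
proof -
  have *: "bs[j := True] = r \<and> \<not> bs ! j \<longleftrightarrow> r ! j \<and> bs = r[j := False]" if "j < length r" for j
    using that assms by (metis (full_types) length_list_update list_update_id list_update_overwrite nth_list_update_eq)
  have "bd (unit_chain r) bs = (\<Sum>j | j < length bs \<and> \<not> bs ! j. if bs[j := True] = r then sg bs j else (0::'a))"
    by (simp add: bd_altdef unit_chain_def if_distrib cong: if_cong)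
  also have "\<dots> = (\<Sum>j\<in>{j \<in> {j. j < length bs \<and> \<not> bs ! j}. bs[j := True] = r}. sg bs j)"
    by (rule sum.inter_filter[symmetric]) simp
  also have "{j \<in> {j. j < length bs \<and> \<not> bs ! j}. bs[j := True] = r} =
      {j. j < length r \<and> r ! j \<and> bs = r[j := False]}"
    using * assms by auto
  finally show ?thesis .
qed

lemma bd_unit_chain_facet:
  assumes "j < length r" "r ! j"
  shows "bd (unit_chain r) (r[j := False]) = sg (r[j := False]) j"
proof -
  have "{i. i < length r \<and> r ! i \<and> r[j := False] = r[i := False]} = {j}"
  proof -
    have "i = j" if "i < length r" "r ! i" "r[j := False] = r[i := False]" for i
    proof (rule ccontr)
      assume "i \<noteq> j"
      moreover from that(3) have "r[j := False] ! i = r[i := False] ! i" by (rule arg_cong)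
      ultimately show False using that(1,2) by simp
    qed
    then have "(i < length r \<and> r ! i \<and> r[j := False] = r[i := False]) = (i = j)" for i
      using assms by metis
    then show ?thesis by (simp only: singleton_conv)
  qed
  then show ?thesis by (simp add: bd_unit_chain)
qed

lemma bd_unit_chain_nonfacet:
  assumes "length bs = length r" "\<And>j. j < length r \<Longrightarrow> r ! j \<Longrightarrow> bs \<noteq> r[j := False]"
  shows "bd (unit_chain r) bs = 0"
  using assms by (auto simp: bd_unit_chain intro!: sum.neutral)

section \<open>Elimination along an acyclic matching\<close>

definition graded :: "nat \<Rightarrow> nat \<Rightarrow> (bool list \<Rightarrow> 'a::zero) \<Rightarrow> bool" where
  "graded n k x \<longleftrightarrow> (\<forall>c. x c \<noteq> 0 \<longrightarrow> length c = n \<and> cnt c = k)"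

lemma graded_add:
  fixes x y :: "bool list \<Rightarrow> 'a::comm_ring_1"
  assumes "graded n k x" "graded n k y"
  shows "graded n k (\<lambda>c. x c + y c)"
  unfolding graded_def
proof (intro allI impI)
  fix c assume "x c + y c \<noteq> 0"
  then have "x c \<noteq> 0 \<or> y c \<noteq> 0" by auto
  then show "length c = n \<and> cnt c = k" using assms unfolding graded_def by blast
qed

lemma graded_diff:
  fixes x y :: "bool list \<Rightarrow> 'a::comm_ring_1"
  assumes "graded n k x" "graded n k y"
  shows "graded n k (\<lambda>c. x c - y c)"
  unfolding graded_def
proof (intro allI impI)
  fix c assume "x c - y c \<noteq> 0"
  then have "x c \<noteq> 0 \<or> y c \<noteq> 0" by auto
  then show "length c = n \<and> cnt c = k" using assms unfolding graded_def by blast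
qed

lemma graded_scale:
  fixes x :: "bool list \<Rightarrow> 'a::comm_ring_1"
  shows "graded n k x \<Longrightarrow> graded n k (\<lambda>c. a c * x c)"
  unfolding graded_def 
proof (intro allI impI)
  fix c assume g: "\<forall>c. x c \<noteq> 0 \<longrightarrow> length c = n \<and> cnt c = k" and "a c * x c \<noteq> 0"
  then have "x c \<noteq> 0" by auto
  then show "length c = n \<and> cnt c = k" using g by blast
qed

lemma graded_bd:
  fixes x :: "bool list \<Rightarrow> 'a::comm_ring_1"
  assumes "graded n (Suc k) x"
  shows "graded n k (bd x)"
  unfolding graded_def
proof (intro allI impI)
  fix c assume "bd x c \<noteq> 0"
  then have "(\<Sum>j | j < length c \<and> \<not> c ! j. sg c j * x (c[j := True])) \<noteq> 0" unfolding bd_altdef .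
  then obtain j where "j \<in> {j. j < length c \<and> \<not> c ! j}" "sg c j * x (c[j := True]) \<noteq> 0"
    by (rule sum.not_neutral_contains_not_neutral)
  then have j: "j < length c" "\<not> c ! j" "x (c[j := True]) \<noteq> 0" by auto
  then have "length c = n" "cnt (c[j := True]) = Suc k" using assms unfolding graded_def by force+
  then show "length c = n \<and> cnt c = k" using j cnt_up[of j c] by simp
qed

lemma graded_unit_chain: "length r = n \<Longrightarrow> cnt r = k \<Longrightarrow> graded n k (unit_chain r)"
  by (simp add: graded_def unit_chain_def)

text \<open>A discrete Morse matching without critical cells: \<open>mt c\<close> is the vertex
  whose flip gives the mate of \<open>c\<close>. \<open>rk\<close> witnesses acyclicity, since going
  from a low cell up to its mate and down to another low cell raises it. \<open>v\<close> is the
  power of \<open>p\<close> by which a coefficient must be divisible.\<close>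

locale matching =
  fixes n :: nat and v :: "bool list \<Rightarrow> nat" and mt :: "bool list \<Rightarrow> nat option"
    and rk :: "bool list \<Rightarrow> nat" and p :: "'a::idom"
  assumes v_mono: "length r = n \<Longrightarrow> j < n \<Longrightarrow> r ! j \<Longrightarrow> v (r[j := False]) \<le> v r"
    and mt: "length c = n \<Longrightarrow> \<exists>j<n. mt c = Some j \<and> mt (c[j := \<not> c ! j]) = Some j"
    and v_mt: "length c = n \<Longrightarrow> mt c = Some j \<Longrightarrow> \<not> c ! j \<Longrightarrow> v (c[j := True]) \<le> Suc (v c)"
    and rk: "length c = n \<Longrightarrow> mt c = Some j \<Longrightarrow> \<not> c ! j \<Longrightarrow> i < n \<Longrightarrow> c ! i \<Longrightarrow>
       mt (c[j := True, i := False]) = Some l \<Longrightarrow> \<not> c[j := True, i := False] ! l \<Longrightarrow>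
       rk c < rk (c[j := True, i := False])"
begin

definition low :: "bool list \<Rightarrow> bool" where
  "low c \<longleftrightarrow> length c = n \<and> \<not> c ! the (mt c)"

definition partner :: "bool list \<Rightarrow> bool list" where
  "partner c = c[the (mt c) := \<not> c ! the (mt c)]"

text \<open>A bar of the persistence barcode of the filtration by \<open>v\<close>: the class is
  born at the weight of the low cell and dies at the weight of its mate.\<close>

definition bar :: "bool list \<Rightarrow> bool" where
  "bar c \<longleftrightarrow> low c \<and> v (partner c) \<noteq> v c"

definition lat :: "(bool list \<Rightarrow> 'a) \<Rightarrow> bool" where
  "lat x \<longleftrightarrow> (\<forall>c. length c = n \<longrightarrow> p ^ v c dvd x c)"

lemma lowD:
  assumes "low c"
  obtains j where "j < n" "mt c = Some j" "length c = n" "\<not> c ! j" "partner c = c[j := True]"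
    "length (partner c) = n" "partner c ! j" "(partner c)[j := False] = c" "mt (partner c) = Some j"
    "cnt (partner c) = Suc (cnt c)"
proof -
  from assms have l: "length c = n" by (simp add: low_def)
  from mt[OF this] obtain j where j: "j < n" "mt c = Some j" "mt (c[j := \<not> c ! j]) = Some j" by blast
  with assms have "\<not> c ! j" by (simp add: low_def)
  moreover from this have "c[j := False] = c" using list_update_id[of c j] by simp
  ultimately show ?thesis using that[of j] j l cnt_up[of j c] by (simp add: partner_def)
qed

lemma facet_rk:
  assumes "low c" "low ((partner c)[i := False])" "i < n" "partner c ! i" "(partner c)[i := False] \<noteq> c"
  shows "rk c < rk ((partner c)[i := False])"
proof -
  from assms(1) obtain j where j: "j < n" "mt c = Some j" "length c = n" "\<not> c ! j" "partner c = c[j := True]"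
      "(partner c)[j := False] = c"
    by (rule lowD)
  from assms(2) obtain l where l: "mt ((partner c)[i := False]) = Some l" "\<not> (partner c)[i := False] ! l"
    by (rule lowD)
  have "i \<noteq> j" using assms(5) j by metis
  then have "c ! i" using assms(4) j by simp
  then show ?thesis using rk[of c j i l] j l assms(3) by simp
qed

lemma upper:
  assumes "length c = n" "\<not> low c"
  obtains b where "low b" "partner b = c"
proof -
  from mt[OF assms(1)] obtain j where j: "j < n" "mt c = Some j" "mt (c[j := \<not> c ! j]) = Some j" by blast
  with assms have c: "c ! j" by (simp add: low_def)
  then have "c[j := True] = c" using list_update_id[of c j] by simp
  with j c assms have "low (c[j := False])" "partner (c[j := False]) = c"
    by (simp_all add: low_def partner_def)
  then show ?thesis using that by blast
qed

lemma lat_bd: "lat x \<Longrightarrow> lat (bd x)"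
  unfolding lat_def
proof (intro allI impI)
  fix c :: "bool list" assume x: "\<forall>c. length c = n \<longrightarrow> p ^ v c dvd x c" and c: "length c = n"
  have "p ^ v c dvd x (c[j := True])" if "j < n" "\<not> c ! j" for j
  proof -
    have "c[j := False] = c" using that list_update_id[of c j] by simp
    then have "v c \<le> v (c[j := True])" using v_mono[of "c[j := True]" j] that c by simp
    then have "p ^ v c dvd p ^ v (c[j := True])" by (rule le_imp_power_dvd)
    also have "\<dots> dvd x (c[j := True])" using x c by simp
    finally show ?thesis .
  qed
  then show "p ^ v c dvd bd x c" unfolding bd_altdef using c by (intro dvd_sum) (auto intro: dvd_mult)
qed

lemma lat_add: "lat x \<Longrightarrow> lat y \<Longrightarrow> lat (\<lambda>c. x c + y c)"
  and lat_diff: "lat x \<Longrightarrow> lat y \<Longrightarrow> lat (\<lambda>c. x c - y c)"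
  by (simp_all add: lat_def)

lemma lat_unit_chain: "p ^ v r dvd a \<Longrightarrow> lat (\<lambda>c. a * unit_chain r c)"
  by (simp add: lat_def unit_chain_def)

text \<open>A multiple of the mate of \<open>b\<close> clears the coefficient at \<open>b\<close>,
  and it lies in the lattice because \<open>x b\<close> is divisible enough. All other low facets of
  that mate have larger rank, so nothing at or below the rank of \<open>b\<close> changes.\<close>

lemma clear_one:
  assumes "low b" "cnt b = k" "graded n k x" "p ^ v (partner b) dvd x b"
  obtains y where "graded n (Suc k) y" "lat y" "x b = bd y b"
    "\<And>c. length c = n \<Longrightarrow> low c \<Longrightarrow> rk c \<le> rk b \<Longrightarrow> c \<noteq> b \<Longrightarrow> bd y c = 0"
    "\<And>c. x b = 0 \<Longrightarrow> bd y c = 0"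
proof -
  from assms(1) obtain j where j: "j < n" "mt b = Some j" "length b = n" "\<not> b ! j" "partner b = b[j := True]"
      "length (partner b) = n" "partner b ! j" "(partner b)[j := False] = b" "cnt (partner b) = Suc (cnt b)"
    by (rule lowD)
  define a where "a = sg b j * x b"
  define y where "y = (\<lambda>c. a * unit_chain (partner b) c)"
  have bdy: "bd y c = a * bd (unit_chain (partner b)) c" for c by (simp add: y_def bd_scale)
  have "bd (unit_chain (partner b)) b = (sg b j :: 'a)"
    using bd_unit_chain_facet[of j "partner b"] j by metis
  then have "x b = bd y b" by (simp add: bdy a_def mult.commute mult.left_commute)
  moreover have "graded n (Suc k) y"
    unfolding y_def by (intro graded_scale graded_unit_chain) (use j assms in auto)
  moreover have "lat y" unfolding y_def by (intro lat_unit_chain) (use assms in \<open>auto simp: a_def\<close>)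
  moreover have "bd y c = 0" if "length c = n" "low c" "rk c \<le> rk b" "c \<noteq> b" for c
  proof -
    have "bd (unit_chain (partner b)) c = (0 :: 'a)"
    proof (rule bd_unit_chain_nonfacet)
      show "length c = length (partner b)" using that j by simp
      fix i assume i: "i < length (partner b)" "partner b ! i"
      show "c \<noteq> (partner b)[i := False]"
      proof
        assume c: "c = (partner b)[i := False]"
        have "rk b < rk ((partner b)[i := False])"
          by (rule facet_rk) (use that(2,4) i j(6) assms(1) in \<open>simp_all add: c\<close>)
        then show False using that(3) by (simp add: c)
      qed
    qed
    then show ?thesis by (simp add: bdy)
  qed
  moreover have "bd y c = 0" if "x b = 0" for c using that by (simp add: bdy a_def)
  ultimately show ?thesis using that by blast
qed

text \<open>Triangular elimination in order of rank. \<open>K\<close> collects low cells where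
  \<open>x\<close> vanishes already and which precede the list in rank, so that the elimination
  leaves them alone.\<close>

lemma clear_list:
  assumes "\<And>b. b \<in> set bs \<Longrightarrow> low b \<and> cnt b = k \<and> v (partner b) = v b" "sorted_wrt (\<lambda>b c. rk b \<le> rk c) bs"
    "graded n k x" "lat x" "\<And>c. c \<in> K \<Longrightarrow> low c \<and> x c = 0" "\<And>b c. c \<in> K \<Longrightarrow> b \<in> set bs \<Longrightarrow> rk c \<le> rk b"
  shows "\<exists>y. graded n (Suc k) y \<and> lat y \<and> (\<forall>c\<in>K \<union> set bs. x c = bd y c)"
  using assms
\<comment> \<open>The last cell of the list has the largest rank, so clearing it does not disturb
  the cells before it.\<close>
proof (induction bs rule: rev_induct)
  case Nil
  have "graded n (Suc k) (\<lambda>c. 0 :: 'a) \<and> lat (\<lambda>c. 0) \<and> (\<forall>c\<in>K \<union> set []. x c = bd (\<lambda>c. 0) c)"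
    using Nil by (simp add: graded_def lat_def bd_zero)
  then show ?case by blast
next
  case (snoc b bs)
  have "\<exists>y. graded n (Suc k) y \<and> lat y \<and> (\<forall>c\<in>K \<union> set bs. x c = bd y c)"
    by (rule snoc.IH) (use snoc.prems in \<open>auto simp: sorted_wrt_append\<close>)
  then obtain y where y: "graded n (Suc k) y" "lat y" "\<forall>c\<in>K \<union> set bs. x c = bd y c" by blast
  let ?x = "\<lambda>c. x c - bd y c"
  have b: "low b" "cnt b = k" "v (partner b) = v b" "length b = n" using snoc.prems by (auto simp: low_def)
  have x: "graded n k ?x" "lat ?x" using y snoc.prems by (auto intro: graded_diff graded_bd lat_diff lat_bd)
  have pd: "p ^ v (partner b) dvd ?x b" using x b by (simp add: lat_def)
  obtain z where z: "graded n (Suc k) z" "lat z" "?x b = bd z b"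
    "\<And>c. length c = n \<Longrightarrow> low c \<Longrightarrow> rk c \<le> rk b \<Longrightarrow> c \<noteq> b \<Longrightarrow> bd z c = 0"
    "\<And>c. ?x b = 0 \<Longrightarrow> bd z c = 0"
    using clear_one[OF b(1,2) x(1) pd] by blast
  have "x c = bd (\<lambda>c. y c + z c) c" if "c \<in> K \<union> set (bs @ [b])" for c
  proof (cases "c = b")
    case True then show ?thesis using z by (simp add: bd_add algebra_simps)
  next
    case False
    then have "c \<in> K \<union> set bs" using that by auto
    then have "low c" "rk c \<le> rk b" using snoc.prems by (auto simp: sorted_wrt_append)
    then have "bd z c = 0" using z(4)[of c] False by (simp add: low_def)
    then show ?thesis using y \<open>c \<in> K \<union> set bs\<close> by (simp add: bd_add)
  qed
  then show ?case using y z by (intro exI[of _ "\<lambda>c. y c + z c"]) (auto intro: graded_add lat_add)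
qed

lemma clear_lows:
  assumes "graded n k x" "lat x" "\<And>c. low c \<Longrightarrow> rk c \<le> t \<Longrightarrow> x c = 0"
  obtains y where "graded n (Suc k) y" "lat y" "\<And>c. low c \<Longrightarrow> rk c \<le> t \<Longrightarrow> x c = bd y c"
    "\<And>c. low c \<Longrightarrow> \<not> bar c \<Longrightarrow> x c = bd y c"
proof -
  define bs where "bs = sort_key rk (filter (\<lambda>b. low b \<and> cnt b = k \<and> \<not> bar b \<and> t < rk b) (cube n))"
  have "\<exists>y. graded n (Suc k) y \<and> lat y \<and> (\<forall>c\<in>{c. low c \<and> rk c \<le> t} \<union> set bs. x c = bd y c)"
  proof (rule clear_list)
    show "sorted_wrt (\<lambda>b c. rk b \<le> rk c) bs"
      unfolding bs_def by (rule sorted_map[THEN iffD1, OF sorted_sort_key])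
    show "graded n k x" "lat x" by fact+
    show "low b \<and> cnt b = k \<and> v (partner b) = v b" if "b \<in> set bs" for b
      using that by (auto simp: bs_def bar_def)
    show "low c \<and> x c = 0" if "c \<in> {c. low c \<and> rk c \<le> t}" for c
      using that assms(3) by blast
    show "rk c \<le> rk b" if "c \<in> {c. low c \<and> rk c \<le> t}" "b \<in> set bs" for b c
      using that by (auto simp: bs_def)
  qed
  then obtain y where y: "graded n (Suc k) y" "lat y"
    "\<And>c. c \<in> {c. low c \<and> rk c \<le> t} \<union> set bs \<Longrightarrow> x c = bd y c" by blast
  have "x c = bd y c" if "low c" "\<not> bar c" for c
  proof (cases "rk c \<le> t \<or> cnt c \<noteq> k")
    case True
    have "x c = 0 \<and> bd y c = 0" if "cnt c \<noteq> k"
      using that assms(1) graded_bd[OF y(1)] unfolding graded_def by blast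
    then show ?thesis using y(3)[of c] True \<open>low c\<close> by auto
  next
    case False
    then have "c \<in> set bs" using that by (auto simp: bs_def set_cube low_def)
    then show ?thesis using y by blast
  qed
  then show ?thesis using that y by blast
qed

text \<open>Induction on the rank of a low cell \<open>b\<close>: a coface of \<open>b\<close> other
  than its mate is either low, or the mate of a low cell of smaller rank, since \<open>b\<close> is
  a low facet of it. So the coefficient of the boundary at \<open>b\<close> is, up to sign, the
  coefficient of \<open>x\<close> at the mate of \<open>b\<close>.\<close>

lemma cycle_zero:
  assumes "graded n k x" "\<And>c. bd x c = 0" "\<And>c. low c \<Longrightarrow> x c = 0"
  shows "x c = 0"
proof -
  have *: "x (partner b) = 0" if "low b" for b
    using that
  proof (induction "rk b" arbitrary: b rule: less_induct)
    case less
    from less.prems obtain j where j: "j < n" "mt b = Some j" "length b = n" "\<not> b ! j" "partner b = b[j := True]"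
      by (rule lowD)
    have "x (b[i := True]) = 0" if i: "i < n" "\<not> b ! i" "i \<noteq> j" for i
    proof (cases "low (b[i := True])")
      case True then show ?thesis using assms by blast
    next
      case False
      then obtain b' where b': "low b'" "partner b' = b[i := True]" using upper[of "b[i := True]"] j by auto
      from b'(1) obtain j' where j': "j' < n" "mt b' = Some j'" "length b' = n" "(partner b')[j' := False] = b'"
        by (rule lowD)
      have bi: "(partner b')[i := False] = b" using b' i j list_update_id[of b i] by simp
      have "b \<noteq> b'"
      proof
        assume "b = b'"
        then have "b ! i = b[i := True, j := False] ! i" using b' j j' by simp
        then show False using i j by simp
      qed
      then have "rk b' < rk b" using facet_rk[of b' i] b' less.prems i j bi by simp
      then have "x (partner b') = 0" using less.hyps b' by blast
      then show ?thesis using b' by simp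
    qed
    then have "bd x b = (\<Sum>i | i < length b \<and> \<not> b ! i. if i = j then sg b j * x (b[j := True]) else 0)"
      unfolding bd_altdef using j by (intro sum.cong) auto
    also have "\<dots> = sg b j * x (partner b)" using j by simp
    finally have "sg b j * (sg b j * x (partner b)) = 0" using assms(2) by simp
    then show ?case by simp
  qed
  show ?thesis
  proof (cases "length c = n")
    case True
    then show ?thesis using upper[of c] * assms(3) by metis
  next
    case False then show ?thesis using assms(1) unfolding graded_def by blast
  qed
qed

text \<open>Elimination can only get stuck at the single bar \<open>b\<close>, where one more factor
  \<open>p\<close> is needed than the lattice provides. The hypothesis on \<open>\<xi>\<close>
  supplies it, because the pairing with \<open>\<xi>\<close> is invariant under lattice boundaries
  modulo \<open>p ^ Suc (v b)\<close>.\<close>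

theorem cycle_is_boundary:
  fixes \<xi> :: "bool list \<Rightarrow> 'a"
  assumes x: "graded n k x" "lat x" "\<And>c. bd x c = 0"
    and xi: "\<And>b. bar b \<Longrightarrow> cnt b = k \<Longrightarrow> b = a \<and> \<xi> b = 1 \<and>
        (\<forall>c. \<xi> c \<noteq> 0 \<longrightarrow> low c) \<and>
        (\<forall>r. length r = n \<longrightarrow> cnt r = Suc k \<longrightarrow> v r \<le> v b \<longrightarrow> cobd \<xi> r = 0) \<and>
        p ^ Suc (v b) dvd (\<Sum>c | length c = n. \<xi> c * x c)"
  obtains y where "graded n (Suc k) y" "lat y" "x = bd y"
proof -
  obtain y where y: "graded n (Suc k) y" "lat y" "\<And>c. low c \<Longrightarrow> \<not> bar c \<Longrightarrow> x c = bd y c"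
  proof -
    let ?bs = "sort_key rk (filter (\<lambda>b. low b \<and> cnt b = k \<and> \<not> bar b) (cube n))"
    have "\<exists>y. graded n (Suc k) y \<and> lat y \<and> (\<forall>c\<in>{} \<union> set ?bs. x c = bd y c)"
    proof (rule clear_list)
      show "sorted_wrt (\<lambda>b c. rk b \<le> rk c) ?bs"
        by (rule sorted_map[THEN iffD1, OF sorted_sort_key])
      show "graded n k x" "lat x" by fact+
    qed (auto simp: bar_def)
    then obtain y where y: "graded n (Suc k) y" "lat y"
      "\<And>c. low c \<Longrightarrow> cnt c = k \<Longrightarrow> \<not> bar c \<Longrightarrow> x c = bd y c" by (auto simp: set_cube low_def)
    moreover have "x c = bd y c" if "cnt c \<noteq> k" for c
      using that x(1) graded_bd[OF y(1)] unfolding graded_def by metis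
    ultimately show ?thesis using that by blast
  qed
  let ?x = "\<lambda>c. x c - bd y c"
  have gx: "graded n k ?x" "lat ?x" "\<And>c. bd ?x c = 0"
    using x y by (auto intro: graded_diff graded_bd lat_diff lat_bd simp: bd_diff bd_bd)
  \<comment> \<open>Agreement on the low cells is enough: the difference is then a cycle that
    vanishes on all of them, hence zero.\<close>
  have final: thesis if "graded n (Suc k) z" "lat z" "\<And>c. low c \<Longrightarrow> ?x c = bd z c" for z
  proof -
    let ?y = "\<lambda>c. y c + z c"
    have "x c - bd ?y c = 0" for c
      by (rule cycle_zero[where k = k])
         (use x y that in \<open>auto intro!: graded_diff graded_bd graded_add simp: bd_diff bd_bd bd_add algebra_simps\<close>)
    then have "x = bd ?y" by (intro ext) simp
    then show thesis using that(1,2) y \<open>\<And>y. \<lbrakk>graded n (Suc k) y; lat y; x = bd y\<rbrakk> \<Longrightarrow> thesis\<close>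
      by (metis graded_add lat_add)
  qed
  show thesis
  proof (cases "\<exists>b. bar b \<and> cnt b = k")
    case False
    have "?x c = bd (\<lambda>c. 0) c" if "low c" for c
    proof (cases "cnt c = k")
      case True then show ?thesis using False y(3)[of c] that by (auto simp: bd_zero)
    next
      case F: False
      then have "?x c = 0" using gx(1) unfolding graded_def by blast
      then show ?thesis by (simp add: bd_zero)
    qed
    moreover have "graded n (Suc k) (\<lambda>c. 0::'a)" "lat (\<lambda>c. 0)" by (simp_all add: graded_def lat_def)
    ultimately show ?thesis using final by blast
  next
    case True
    then obtain b where b: "bar b" "cnt b = k" by blast
    note xib = xi[OF b]
    have lowb: "low b" "length b = n" using b by (auto simp: bar_def low_def)
    have vb: "v (partner b) = Suc (v b)"
    proof -
      from lowb(1) obtain j where j: "j < n" "mt b = Some j" "\<not> b ! j" "partner b = b[j := True]"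
        "partner b ! j" "(partner b)[j := False] = b" "length (partner b) = n" by (rule lowD)
      have "v b \<le> v (partner b)" using v_mono[of "partner b" j] j by metis
      moreover have "v (partner b) \<le> Suc (v b)" using v_mt[of b j] j lowb by simp
      ultimately show ?thesis using b by (simp add: bar_def)
    qed
    \<comment> \<open>\<open>\<xi>\<close> is supported on low cells, and \<open>?x\<close> is
      already cleared on all of these except \<open>b\<close>; so the pairing reads off the
      coefficient at \<open>b\<close>.\<close>
    have "\<xi> c * ?x c = (if c = b then ?x b else 0)" for c
    proof (cases "c = b \<or> \<xi> c = 0 \<or> cnt c \<noteq> k")
      case True
      moreover have "?x c = 0" if "cnt c \<noteq> k" using that gx(1) unfolding graded_def by blast
      ultimately show ?thesis using xib b by auto
    next
      case False
      then have "low c" "\<not> bar c" using xib xi by blast+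
      then show ?thesis using y(3)[of c] False by simp
    qed
    then have "(\<Sum>c | length c = n. \<xi> c * ?x c) = ?x b"
      using lowb by (simp add: finite_cube)
    \<comment> \<open>Replacing \<open>x\<close> by \<open>?x\<close> changes the pairing by the sum
      of \<open>cobd \<xi> r * y r\<close>. The faces with \<open>v r <= v b\<close> contribute
      nothing, and on heavier faces \<open>y\<close> has the extra factor \<open>p\<close>.\<close>
    moreover have "p ^ Suc (v b) dvd (\<Sum>c | length c = n. \<xi> c * ?x c)"
    proof -
      have "p ^ Suc (v b) dvd cobd \<xi> r * y r" if "length r = n" for r
      proof (cases "cnt r = Suc k \<and> v b < v r")
        case True
        then have "p ^ Suc (v b) dvd p ^ v r" by (intro le_imp_power_dvd) simp
        also have "p ^ v r dvd y r" using y(2) that unfolding lat_def by blast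
        finally show ?thesis by (rule dvd_mult)
      next
        case False
        then have "cnt r \<noteq> Suc k \<or> v r \<le> v b" by auto
        then have "cobd \<xi> r = 0 \<or> y r = 0" using xib y(1) that unfolding graded_def by blast
        then show ?thesis by auto
      qed
      then have xx: "p ^ Suc (v b) dvd (\<Sum>c | length c = n. \<xi> c * bd y c)"
        unfolding sum_bd_cobd by (intro dvd_sum) auto
      have "p ^ Suc (v b) dvd (\<Sum>c | length c = n. \<xi> c * x c)" using xib by blast
      from dvd_diff[OF this xx] show ?thesis
        unfolding right_diff_distrib sum_subtractf .
    qed
    ultimately have "p ^ v (partner b) dvd ?x b" by (simp add: vb)
    then obtain z where z: "graded n (Suc k) z" "lat z" "?x b = bd z b"
      "\<And>c. length c = n \<Longrightarrow> low c \<Longrightarrow> rk c \<le> rk b \<Longrightarrow> c \<noteq> b \<Longrightarrow> bd z c = 0"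
      "\<And>c. ?x b = 0 \<Longrightarrow> bd z c = 0"
      using clear_one[OF lowb(1) b(2) gx(1)] by blast
    have xz: "?x c = bd z c" if "low c" "rk c \<le> rk b" for c
    proof (cases "c = b")
      case False
      have "?x c = 0"
      proof (cases "cnt c = k")
        case True
        then have "\<not> bar c" using xi[of c] xib False by blast
        then show ?thesis using y(3)[of c] that by simp
      next
        case F: False then show ?thesis using gx(1) unfolding graded_def by blast
      qed
      then show ?thesis using z(4)[of c] that False by (simp add: low_def)
    qed (use z in simp)
    let ?x2 = "\<lambda>c. ?x c - bd z c"
    have g2: "graded n k ?x2" "lat ?x2"
      using gx z by (auto intro: graded_diff graded_bd lat_diff lat_bd)
    \<comment> \<open>Clearing \<open>b\<close> may have spoiled low cells of larger rank. They are
      cleared once more, with everything up to the rank of \<open>b\<close> protected.\<close>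
    obtain u where u: "graded n (Suc k) u" "lat u" "\<And>c. low c \<Longrightarrow> rk c \<le> rk b \<Longrightarrow> ?x2 c = bd u c"
      "\<And>c. low c \<Longrightarrow> \<not> bar c \<Longrightarrow> ?x2 c = bd u c"
    proof (rule clear_lows[OF g2, of "rk b"])
      show "?x2 c = 0" if "low c" "rk c \<le> rk b" for c using xz[OF that] by simp
    qed (rule that)
    have "?x c = bd (\<lambda>c. z c + u c) c" if "low c" for c
    proof -
      have "?x2 c = bd u c"
      proof (cases "bar c \<and> cnt c = k")
        case True
        then have "c = b" using xi[of c] xib by blast
        then show ?thesis using u(3) that by simp
      next
        case False
        then consider "\<not> bar c" | "cnt c \<noteq> k" by blast
        then show ?thesis
        proof cases
          case 2
          then have "?x2 c = 0" "bd u c = 0" using g2(1) graded_bd[OF u(1)] unfolding graded_def by blast+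
          then show ?thesis by simp
        qed (use u(4)[of c] that in blast)
      qed
      then show ?thesis by (simp add: bd_add algebra_simps)
    qed
    moreover have "graded n (Suc k) (\<lambda>c. z c + u c)" "lat (\<lambda>c. z c + u c)"
      using z u by (auto intro: graded_add lat_add)
    ultimately show ?thesis using final by blast
  qed
qed

end

section \<open>Comaximal elements\<close>

definition comaximal :: "'a::comm_ring_1 \<Rightarrow> 'a \<Rightarrow> bool" where
  "comaximal a b \<longleftrightarrow> (\<exists>u v. u * a + v * b = 1)"


lemma comaximal_commute: "comaximal a b \<Longrightarrow> comaximal b a"
  unfolding comaximal_def by (metis add.commute)

lemma comaximal_mult:
  assumes "comaximal a b" "comaximal a c"
  shows "comaximal a (b * c)"
proof -
  from assms obtain u v u' v' where uv: "u * a + v * b = 1" "u' * a + v' * c = 1"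
    by (auto simp: comaximal_def)
  have "(u * a + v * b) * (u' * a + v' * c) = 1" by (simp only: uv mult_1)
  then have "(u * u' * a + u * v' * c + v * b * u') * a + (v * v') * (b * c) = 1"
    by (simp add: algebra_simps)
  then show ?thesis unfolding comaximal_def by blast
qed

lemma comaximal_1: "comaximal a 1"
  unfolding comaximal_def by (intro exI[of _ 0] exI[of _ 1]) simp

lemma comaximal_prod:
  "(\<And>i. i \<in> A \<Longrightarrow> comaximal a (f i)) \<Longrightarrow> comaximal a (\<Prod>i\<in>A. f i)"
  by (induction A rule: infinite_finite_induct) (simp_all add: comaximal_1 comaximal_mult)

lemma comaximal_power: "comaximal a b \<Longrightarrow> comaximal a (b ^ k)"
  by (induction k) (simp_all add: comaximal_1 comaximal_mult)

text \<open>The Chinese remainder theorem as an identity of elements. It is the device that glues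
  solutions found at each cyclotomic polynomial separately.\<close>

lemma partition_of_unity:
  fixes q :: "'b \<Rightarrow> 'a::comm_ring_1"
  assumes "finite A" "A \<noteq> {}" "\<And>a b. a \<in> A \<Longrightarrow> b \<in> A \<Longrightarrow> a \<noteq> b \<Longrightarrow> comaximal (q a) (q b)"
  obtains f where "(\<Sum>a\<in>A. f a * (\<Prod>b\<in>A - {a}. q b)) = 1"
proof -
  have "\<exists>f. (\<Sum>a\<in>A. f a * (\<Prod>b\<in>A - {a}. q b)) = 1"
    using assms
  proof (induction A rule: finite_ne_induct)
    case (singleton x)
    then show ?case by (intro exI[of _ "\<lambda>_. 1"]) simp
  next
    case (insert x A)
    then obtain f where f: "(\<Sum>a\<in>A. f a * (\<Prod>b\<in>A - {a}. q b)) = 1" by auto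
    have "comaximal (q x) (\<Prod>b\<in>A. q b)" using insert by (intro comaximal_prod) auto
    then obtain u v where uv: "u * q x + v * (\<Prod>b\<in>A. q b) = 1" by (auto simp: comaximal_def)
    \<comment> \<open>The old partition is multiplied by \<open>u * q x\<close>, which provides the
      missing factor \<open>q x\<close>; the remainder \<open>v * (\<Prod>b\<in>A. q b)\<close> is
      the term of the new index.\<close>
    define g where "g = (\<lambda>a. if a = x then v else u * f a)"
    have "(\<Sum>a\<in>A. g a * (\<Prod>b\<in>insert x A - {a}. q b)) = (\<Sum>a\<in>A. u * q x * (f a * (\<Prod>b\<in>A - {a}. q b)))"
    proof (rule sum.cong)
      fix a assume a: "a \<in> A"
      then have "insert x A - {a} = insert x (A - {a})" "a \<noteq> x" using insert by auto
      then show "g a * (\<Prod>b\<in>insert x A - {a}. q b) = u * q x * (f a * (\<Prod>b\<in>A - {a}. q b))"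
        using insert by (simp add: g_def algebra_simps)
    qed simp
    also have "\<dots> = u * q x" unfolding sum_distrib_left[symmetric] f by simp
    moreover have "insert x A - {x} = A" using insert by auto
    ultimately have "(\<Sum>a\<in>insert x A. g a * (\<Prod>b\<in>insert x A - {a}. q b)) = v * (\<Prod>b\<in>A. q b) + u * q x"
      using insert by (simp add: g_def)
    then show ?case using uv by (metis add.commute)
  qed
  then show ?thesis using that by blast
qed

section \<open>Homology of the weighted simplex\<close>

text \<open>In the basis \<open>w c * e\<close> the differential becomes the simplicial one, so a chain \<open>x\<close> of the
  weighted complex corresponds to the simplicial chain \<open>w * x\<close>.\<close>

locale weighted_simplex =
  fixes n :: nat and D :: "nat set" and \<phi> :: "nat \<Rightarrow> 'a::idom" and v :: "nat \<Rightarrow> bool list \<Rightarrow> nat"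
    and w :: "bool list \<Rightarrow> 'a" and mt :: "nat \<Rightarrow> bool list \<Rightarrow> nat option"
    and rk :: "nat \<Rightarrow> bool list \<Rightarrow> nat"
    and k :: nat and E :: "nat set" and a :: "nat \<Rightarrow> bool list" and \<xi> :: "nat \<Rightarrow> bool list \<Rightarrow> 'a"
    and y :: "nat \<Rightarrow> bool list \<Rightarrow> 'a"
  assumes D: "finite D" "D \<noteq> {}"
    and \<phi>_nonzero: "d \<in> D \<Longrightarrow> \<phi> d \<noteq> 0"
    and \<phi>_comaximal: "d \<in> D \<Longrightarrow> e \<in> D \<Longrightarrow> d \<noteq> e \<Longrightarrow> comaximal (\<phi> d) (\<phi> e)"
    and w: "length c = n \<Longrightarrow> \<exists>u. u dvd 1 \<and> w c = u * (\<Prod>d\<in>D. \<phi> d ^ v d c)"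
    and matching: "d \<in> D \<Longrightarrow> matching n (v d) (mt d) (rk d)"
    and E: "E \<subseteq> D"
    and bar: "d \<in> D \<Longrightarrow> matching.bar n (v d) (mt d) b \<Longrightarrow> cnt b = k \<Longrightarrow> d \<in> E \<and> b = a d"
    and a: "d \<in> E \<Longrightarrow> \<xi> d (a d) = 1 \<and> length (a d) = n"
    and \<xi>: "d \<in> E \<Longrightarrow> \<xi> d c \<noteq> 0 \<Longrightarrow> matching.low n (mt d) c \<and> v d c = v d (a d)"
    and \<xi>_cocycle: "d \<in> E \<Longrightarrow> length r = n \<Longrightarrow> cnt r = Suc k \<Longrightarrow> v d r \<le> v d (a d) \<Longrightarrow> cobd (\<xi> d) r = 0"
    and y: "d \<in> E \<Longrightarrow> graded n (Suc k) (y d)"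
    and v_bd_y: "d \<in> E \<Longrightarrow> bd (y d) c \<noteq> 0 \<Longrightarrow> v d c \<le> v d (a d)"
    and \<xi>_y: "d \<in> E \<Longrightarrow> (\<Sum>c | length c = n. \<xi> d c * bd (y d) c) dvd 1"
begin

text \<open>An exponent strictly larger than every valuation. The strictness gives the spare factor
  by which the functionals at other \<phi>_e vanish on the generator at \<phi>_d.\<close>

definition bound :: nat where
  "bound = Suc (\<Sum>d\<in>D. \<Sum>c | length c = n. v d c)"

lemma v_bound: "d \<in> D \<Longrightarrow> length c = n \<Longrightarrow> v d c < bound"
proof -
  assume d: "d \<in> D" "length c = n"
  have "v d c \<le> (\<Sum>c | length c = n. v d c)" using d finite_cube by (intro member_le_sum) auto
  also have "\<dots> \<le> (\<Sum>d\<in>D. \<Sum>c | length c = n. v d c)" using d D by (intro member_le_sum) auto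
  finally show ?thesis by (simp add: bound_def)
qed

text \<open>Stands in for localization at \<open>\<phi> d\<close>: after multiplication by it,
  divisibility by the full weight reduces to divisibility by a power of \<open>\<phi> d\<close>,
  while it is itself invertible modulo \<open>\<phi> d\<close>.\<close>

definition cofactor :: "nat \<Rightarrow> 'a" where
  "cofactor d = (\<Prod>e\<in>D - {d}. \<phi> e ^ bound)"

lemma w_dvd: "d \<in> D \<Longrightarrow> length c = n \<Longrightarrow> w c dvd cofactor d * \<phi> d ^ v d c"
proof -
  assume d: "d \<in> D" "length c = n"
  obtain u where u: "u dvd 1" "w c = u * (\<Prod>d\<in>D. \<phi> d ^ v d c)" using w[OF d(2)] by blast
  have "(\<Prod>e\<in>D - {d}. \<phi> e ^ v e c) dvd cofactor d"
    unfolding cofactor_def using d v_bound by (intro prod_dvd_prod) (auto intro!: le_imp_power_dvd less_imp_le)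
  moreover have "(\<Prod>d\<in>D. \<phi> d ^ v d c) = \<phi> d ^ v d c * (\<Prod>e\<in>D - {d}. \<phi> e ^ v e c)"
    using d D by (intro prod.remove)
  ultimately have "(\<Prod>d\<in>D. \<phi> d ^ v d c) dvd cofactor d * \<phi> d ^ v d c"
    by (simp add: mult.commute mult_dvd_mono)
  then show ?thesis using u by (metis mult_dvd_mono mult_1)
qed

lemma dvd_w: "d \<in> D \<Longrightarrow> length c = n \<Longrightarrow> \<phi> d ^ v d c dvd w c"
proof -
  assume d: "d \<in> D" "length c = n"
  obtain u where u: "w c = u * (\<Prod>d\<in>D. \<phi> d ^ v d c)" using w[OF d(2)] by blast
  have "\<phi> d ^ v d c dvd (\<Prod>d\<in>D. \<phi> d ^ v d c)" using d D by (intro dvd_prodI)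
  then show ?thesis unfolding u by (rule dvd_mult)
qed

lemma w_nonzero: "length c = n \<Longrightarrow> w c \<noteq> 0"
proof -
  assume c: "length c = n"
  obtain u where u: "u dvd 1" "w c = u * (\<Prod>d\<in>D. \<phi> d ^ v d c)" using w[OF c] by blast
  have "u \<noteq> 0" using u(1) by auto
  moreover have "(\<Prod>d\<in>D. \<phi> d ^ v d c) \<noteq> 0" using D \<phi>_nonzero by simp
  ultimately show ?thesis by (simp add: u(2))
qed

definition pairing :: "nat \<Rightarrow> (bool list \<Rightarrow> 'a) \<Rightarrow> 'a" where
  "pairing d x = (\<Sum>c | length c = n. \<xi> d c * x c)"

text \<open>The coordinate of a homology class in R/(\<phi>_d). The division is possible because
  \<open>\<xi> d\<close> lives on cells with the same valuation as the bar cell \<open>a d\<close>;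
  the quotient is unique, the ring being a domain.\<close>

definition functional :: "nat \<Rightarrow> (bool list \<Rightarrow> 'a) \<Rightarrow> 'a" where
  "functional d x = (SOME t. \<phi> d ^ v d (a d) * t = pairing d (\<lambda>c. w c * x c))"

lemma functional: "d \<in> E \<Longrightarrow> \<phi> d ^ v d (a d) * functional d x = pairing d (\<lambda>c. w c * x c)"
proof -
  assume d: "d \<in> E"
  have "\<phi> d ^ v d (a d) dvd \<xi> d c * (w c * x c)" if c: "length c = n" for c
  proof (cases "\<xi> d c = 0")
    case False
    then have "v d c = v d (a d)" using \<xi>[OF d] by blast
    then have "\<phi> d ^ v d (a d) dvd w c" using dvd_w[of d c] d E c by auto
    then show ?thesis by (intro dvd_mult dvd_mult2)
  qed simp
  then have "\<phi> d ^ v d (a d) dvd pairing d (\<lambda>c. w c * x c)"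
    unfolding pairing_def by (intro dvd_sum) auto
  then have "\<exists>t. \<phi> d ^ v d (a d) * t = pairing d (\<lambda>c. w c * x c)" by (metis dvdE)
  then show ?thesis unfolding functional_def by (rule someI_ex)
qed

lemma functional_cancel: "d \<in> E \<Longrightarrow> \<phi> d ^ v d (a d) * s = \<phi> d ^ v d (a d) * t \<Longrightarrow> s = t"
  using \<phi>_nonzero[of d] E by auto

lemma functional_add: "d \<in> E \<Longrightarrow> functional d (\<lambda>c. x c + x' c) = functional d x + functional d x'"
  by (rule functional_cancel, assumption)
     (simp add: functional pairing_def distrib_left sum.distrib)

lemma functional_scale: "d \<in> E \<Longrightarrow> functional d (\<lambda>c. t * x c) = t * functional d x"
proof (rule functional_cancel, assumption)
  assume d: "d \<in> E"
  have "pairing d (\<lambda>c. w c * (t * x c)) = t * pairing d (\<lambda>c. w c * x c)"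
    by (simp add: pairing_def sum_distrib_left mult_ac)
  then show "\<phi> d ^ v d (a d) * functional d (\<lambda>c. t * x c) = \<phi> d ^ v d (a d) * (t * functional d x)"
    using d by (simp add: functional mult.left_commute)
qed

lemma functional_zero: "d \<in> E \<Longrightarrow> functional d (\<lambda>c. 0) = 0"
  using functional_scale[of d 0 "\<lambda>c. 0"] by simp

lemma functional_sum:
  "d \<in> E \<Longrightarrow> functional d (\<lambda>c. \<Sum>i\<in>I. x i c) = (\<Sum>i\<in>I. functional d (x i))"
  by (induction I rule: infinite_finite_induct) (simp_all add: functional_zero functional_add)

text \<open>After transposition only faces heavier than \<open>a d\<close> survive, and their
  weights contain one more factor \<open>\<phi> d\<close> than is divided out.\<close>

theorem functional_boundary:
  assumes "d \<in> E" "graded n (Suc k) u" "\<And>c. length c = n \<Longrightarrow> w c * x c = bd (\<lambda>c. w c * u c) c"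
  shows "\<phi> d dvd functional d x"
proof -
  have "\<phi> d ^ Suc (v d (a d)) dvd cobd (\<xi> d) r * (w r * u r)" if r: "length r = n" for r
  proof (cases "cnt r = Suc k \<and> v d (a d) < v d r")
    case True
    then have "\<phi> d ^ Suc (v d (a d)) dvd \<phi> d ^ v d r" by (intro le_imp_power_dvd) simp
    also have "\<dots> dvd w r" using dvd_w[of d r] assms(1) E r by auto
    finally show ?thesis by (intro dvd_mult dvd_mult2)
  next
    case False
    then have "cnt r \<noteq> Suc k \<or> v d r \<le> v d (a d)" by auto
    then have "cobd (\<xi> d) r = 0 \<or> u r = 0"
      using \<xi>_cocycle[OF assms(1) r] assms(2) unfolding graded_def by blast
    then show ?thesis by auto
  qed
  then have "\<phi> d ^ Suc (v d (a d)) dvd (\<Sum>c | length c = n. \<xi> d c * bd (\<lambda>c. w c * u c) c)"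
    unfolding sum_bd_cobd by (intro dvd_sum) auto
  also have "\<dots> = pairing d (\<lambda>c. w c * x c)"
    unfolding pairing_def by (intro sum.cong) (simp_all add: assms(3))
  also have "\<dots> = \<phi> d ^ v d (a d) * functional d x" using functional[OF assms(1)] by simp
  finally have "\<phi> d ^ v d (a d) * \<phi> d dvd \<phi> d ^ v d (a d) * functional d x"
    by (simp only: power_Suc2)
  then show ?thesis using \<phi>_nonzero[of d] assms(1) E by auto
qed

text \<open>For each \<open>d\<close> the elimination gives a filling \<open>z d\<close> that is
  divisible enough at \<open>\<phi> d\<close> only; for \<open>d\<close> outside \<open>E\<close>
  there is no bar in this degree to worry about. The multiple by \<open>cofactor d\<close> is
  divisible by the full weight, and a partition of unity built from the cofactors sums these
  multiples to a filling of the original cycle.\<close>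

theorem functional_kernel:
  assumes "graded n k x" "\<And>c. bd (\<lambda>c. w c * x c) c = 0" "\<And>d. d \<in> E \<Longrightarrow> \<phi> d dvd functional d x"
  obtains u where "graded n (Suc k) u" "\<And>c. w c * x c = bd (\<lambda>c. w c * u c) c"
proof -
  have "\<exists>z. graded n (Suc k) z \<and> (\<forall>c. length c = n \<longrightarrow> \<phi> d ^ v d c dvd z c) \<and> (\<lambda>c. w c * x c) = bd z"
    if d: "d \<in> D" for d
  proof -
    interpret matching n "v d" "mt d" "rk d" "\<phi> d" using d by (rule matching)
    show ?thesis
    proof (rule cycle_is_boundary)
      show "graded n k (\<lambda>c. w c * x c)" using assms(1) by (rule graded_scale)
      show "lat (\<lambda>c. w c * x c)" using dvd_w[OF d] by (simp add: lat_def)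
      show "bd (\<lambda>c. w c * x c) c = 0" for c by (rule assms(2))
    next
      fix b assume b: "bar b" "cnt b = k"
      then have dE: "d \<in> E" "b = a d" using weighted_simplex.bar[OF weighted_simplex_axioms d] by auto
      have "\<phi> d ^ Suc (v d b) dvd (\<Sum>c | length c = n. \<xi> d c * (w c * x c))"
      proof -
        have "\<phi> d ^ v d (a d) * \<phi> d dvd \<phi> d ^ v d (a d) * functional d x"
          using assms(3)[OF dE(1)] by (rule mult_dvd_mono[OF dvd_refl])
        then show ?thesis unfolding functional[OF dE(1)] by (simp only: pairing_def power_Suc2 dE(2))
      qed
      then show "b = a d \<and> \<xi> d b = 1 \<and> (\<forall>c. \<xi> d c \<noteq> 0 \<longrightarrow> low c) \<and>
        (\<forall>r. length r = n \<longrightarrow> cnt r = Suc k \<longrightarrow> v d r \<le> v d b \<longrightarrow> cobd (\<xi> d) r = 0) \<and>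
        \<phi> d ^ Suc (v d b) dvd (\<Sum>c | length c = n. \<xi> d c * (w c * x c))"
        using a[OF dE(1)] \<xi>[OF dE(1)] \<xi>_cocycle[OF dE(1)] dE(2) by blast
    next
      fix z assume "graded n (Suc k) z" "lat z" "(\<lambda>c. w c * x c) = bd z"
      then show ?thesis unfolding lat_def by blast
    qed
  qed
  then obtain z where z: "\<And>d. d \<in> D \<Longrightarrow> graded n (Suc k) (z d)"
    "\<And>d c. d \<in> D \<Longrightarrow> length c = n \<Longrightarrow> \<phi> d ^ v d c dvd z d c" "\<And>d. d \<in> D \<Longrightarrow> (\<lambda>c. w c * x c) = bd (z d)"
    by metis
  have "\<exists>t. cofactor d * z d c = w c * t" if "d \<in> D" "length c = n" for d c
  proof -
    have "w c dvd cofactor d * \<phi> d ^ v d c" using that by (rule w_dvd)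
    also have "\<dots> dvd cofactor d * z d c" using z(2)[OF that] by (rule mult_dvd_mono[OF dvd_refl])
    finally show ?thesis by (rule dvdE) blast
  qed
  then obtain t where t: "\<And>d c. d \<in> D \<Longrightarrow> length c = n \<Longrightarrow> cofactor d * z d c = w c * t d c" by metis
  have "comaximal (\<phi> d ^ bound) (\<phi> e ^ bound)" if "d \<in> D" "e \<in> D" "d \<noteq> e" for d e
    by (rule comaximal_power[OF comaximal_commute[OF comaximal_power[OF comaximal_commute[OF \<phi>_comaximal[OF that]]]]])
  then obtain f where "(\<Sum>d\<in>D. f d * (\<Prod>b\<in>D - {d}. \<phi> b ^ bound)) = 1"
    using partition_of_unity[OF D, of "\<lambda>d. \<phi> d ^ bound"] by blast
  then have f: "(\<Sum>d\<in>D. f d * cofactor d) = 1" by (simp only: cofactor_def)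
  \<comment> \<open>The chosen quotients \<open>t\<close> are arbitrary on lists of the wrong
    length, hence the explicit cut-off.\<close>
  define u where "u = (\<lambda>c. if length c = n \<and> cnt c = Suc k then \<Sum>d\<in>D. f d * t d c else 0)"
  have u: "w c * u c = (\<Sum>d\<in>D. (f d * cofactor d) * z d c)" if c: "length c = n" for c
  proof -
    have eq: "(f d * cofactor d) * z d c = w c * (f d * t d c)" if "d \<in> D" for d
      using t[OF that c] by (simp only: mult.assoc mult.left_commute)
    have s: "(\<Sum>d\<in>D. (f d * cofactor d) * z d c) = w c * (\<Sum>d\<in>D. f d * t d c)"
      unfolding sum_distrib_left by (rule sum.cong[OF refl eq])
    have "(\<Sum>d\<in>D. (f d * cofactor d) * z d c) = 0" if "cnt c \<noteq> Suc k"
      using z(1) that unfolding graded_def by (intro sum.neutral) auto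
    then show ?thesis using s c by (auto simp: u_def)
  qed
  have "w c * x c = bd (\<lambda>c. w c * u c) c" for c
  proof (cases "length c = n")
    case True
    have "bd (\<lambda>c. w c * u c) c = bd (\<lambda>c. \<Sum>d\<in>D. (f d * cofactor d) * z d c) c"
      by (rule bd_cong) (simp add: u True)
    also have "\<dots> = (\<Sum>d\<in>D. (f d * cofactor d) * bd (z d) c)" by (simp only: bd_sum bd_scale)
    also have "\<dots> = (\<Sum>d\<in>D. (f d * cofactor d) * (w c * x c))"
    proof (rule sum.cong)
      fix d assume "d \<in> D"
      from fun_cong[OF z(3)[OF this], of c]
      show "(f d * cofactor d) * bd (z d) c = (f d * cofactor d) * (w c * x c)" by simp
    qed simp
    also have "\<dots> = w c * x c" unfolding sum_distrib_right[symmetric] f by simp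
    finally show ?thesis by simp
  next
    case False
    have "graded n k (bd (\<lambda>c. w c * u c))"
      by (intro graded_bd graded_scale) (auto simp: graded_def u_def split: if_splits)
    then have "bd (\<lambda>c. w c * u c) c = 0" "x c = 0" using False assms(1) unfolding graded_def by blast+
    then show ?thesis by simp
  qed
  moreover have "graded n (Suc k) u" by (auto simp: graded_def u_def split: if_splits)
  ultimately show ?thesis using that by blast
qed

text \<open>The chains \<open>gen d\<close>, obtained from the boundaries of \<open>y d\<close> by
  scaling and dividing by the weights, form a dual basis up to units: the functional of
  \<open>d\<close> takes on \<open>gen d\<close> a value invertible modulo \<open>\<phi> d\<close>,
  and all others vanish on it modulo their own polynomials. Any residues can therefore be prescribed
  at once.\<close>

theorem functional_surjective:
  obtains x where "graded n k x" "\<And>c. bd (\<lambda>c. w c * x c) c = 0" "\<And>d. d \<in> E \<Longrightarrow> \<phi> d dvd functional d x - t d"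
proof -
  have "\<exists>x. graded n k x \<and> (\<forall>c. length c = n \<longrightarrow> w c * x c = (cofactor d * \<phi> d ^ v d (a d)) * bd (y d) c)"
    if d: "d \<in> E" for d
  proof -
    have dvd: "w c dvd (cofactor d * \<phi> d ^ v d (a d)) * bd (y d) c" if c: "length c = n" for c
    proof (cases "bd (y d) c = 0")
      case False
      have "w c dvd cofactor d * \<phi> d ^ v d c" using d E c by (intro w_dvd) auto
      also have "\<dots> dvd cofactor d * \<phi> d ^ v d (a d)"
        using v_bd_y[OF d False] by (intro mult_dvd_mono le_imp_power_dvd dvd_refl)
      finally show ?thesis by (rule dvd_mult2)
    qed simp
    have "\<exists>t. length c = n \<longrightarrow> (cofactor d * \<phi> d ^ v d (a d)) * bd (y d) c = w c * t" for c
      using dvd[of c] unfolding dvd_def by blast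
    then obtain q where q: "\<And>c. length c = n \<Longrightarrow> (cofactor d * \<phi> d ^ v d (a d)) * bd (y d) c = w c * q c"
      by metis
    define x where "x = (\<lambda>c. if length c = n then q c else 0)"
    have "graded n k x"
      unfolding graded_def
    proof (intro allI impI)
      fix c assume "x c \<noteq> 0"
      then have c: "length c = n" "q c \<noteq> 0" by (auto simp: x_def split: if_splits)
      then have "w c * q c \<noteq> 0" using w_nonzero by simp
      then have "bd (y d) c \<noteq> 0" unfolding q[OF c(1), symmetric] by auto
      then show "length c = n \<and> cnt c = k" using graded_bd[OF y[OF d]] unfolding graded_def by blast
    qed
    moreover have "w c * x c = (cofactor d * \<phi> d ^ v d (a d)) * bd (y d) c" if "length c = n" for c
      using q[OF that] that by (simp add: x_def)
    ultimately show ?thesis by blast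
  qed
  then obtain gen where gen: "\<And>d. d \<in> E \<Longrightarrow> graded n k (gen d)"
    "\<And>d c. d \<in> E \<Longrightarrow> length c = n \<Longrightarrow> w c * gen d c = (cofactor d * \<phi> d ^ v d (a d)) * bd (y d) c" by metis
  have pairing_gen: "pairing e (\<lambda>c. w c * gen d c) = (cofactor d * \<phi> d ^ v d (a d)) * pairing e (bd (y d))"
    if "d \<in> E" for d e
  proof -
    have "pairing e (\<lambda>c. w c * gen d c) = pairing e (\<lambda>c. (cofactor d * \<phi> d ^ v d (a d)) * bd (y d) c)"
      unfolding pairing_def using gen(2)[OF that] by (intro sum.cong) auto
    then show ?thesis by (simp add: pairing_def sum_distrib_left mult_ac)
  qed
  have own: "functional d (gen d) = cofactor d * pairing d (bd (y d))" if d: "d \<in> E" for d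
    by (rule functional_cancel[OF d]) (simp add: functional d pairing_gen mult_ac)
  \<comment> \<open>The cofactor of \<open>d\<close> contains \<open>\<phi> e ^ bound\<close>, which
    beats the valuation of \<open>a e\<close> by at least one.\<close>
  have other: "\<phi> e dvd functional e (gen d)" if d: "d \<in> E" and e: "e \<in> E" "e \<noteq> d" for d e
  proof -
    have "Suc (v e (a e)) \<le> bound" using v_bound[of e "a e"] a[OF e(1)] e E by auto
    then have "\<phi> e ^ Suc (v e (a e)) dvd \<phi> e ^ bound" by (rule le_imp_power_dvd)
    also have "\<dots> dvd cofactor d" unfolding cofactor_def using D e E by (intro dvd_prodI) auto
    finally have "\<phi> e ^ Suc (v e (a e)) dvd pairing e (\<lambda>c. w c * gen d c)"
      unfolding pairing_gen[OF d] by (intro dvd_mult2)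
    then have "\<phi> e ^ v e (a e) * \<phi> e dvd \<phi> e ^ v e (a e) * functional e (gen d)"
      by (simp only: functional[OF e(1)] power_Suc2)
    then show ?thesis using \<phi>_nonzero[of e] e E by auto
  qed
  have "\<exists>s. \<phi> d dvd s * (cofactor d * pairing d (bd (y d))) - 1" if d: "d \<in> E" for d
  proof -
    have "comaximal (\<phi> d) (cofactor d)"
      unfolding cofactor_def using \<phi>_comaximal d E by (intro comaximal_prod comaximal_power) auto
    moreover obtain z where z: "pairing d (bd (y d)) * z = 1" using \<xi>_y[OF d] unfolding pairing_def by (metis dvdE)
    have "comaximal (\<phi> d) (pairing d (bd (y d)))"
      unfolding comaximal_def by (intro exI[of _ 0] exI[of _ z]) (simp only: mult_zero_left add_0_left mult.commute[of z] z)
    ultimately have "comaximal (\<phi> d) (cofactor d * pairing d (bd (y d)))" by (intro comaximal_mult)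
    then obtain p s where "p * \<phi> d + s * (cofactor d * pairing d (bd (y d))) = 1" by (auto simp: comaximal_def)
    then have "s * (cofactor d * pairing d (bd (y d))) - 1 = \<phi> d * (- p)" by (simp add: algebra_simps)
    then show ?thesis by (metis dvd_triv_left)
  qed
  then obtain s where s: "\<And>d. d \<in> E \<Longrightarrow> \<phi> d dvd s d * (cofactor d * pairing d (bd (y d))) - 1" by metis
  have finE: "finite E" using D E finite_subset by blast
  \<comment> \<open>\<open>s d\<close> inverts the value of the functional on \<open>gen d\<close>
    modulo \<open>\<phi> d\<close>, and \<open>t d\<close> is the residue aimed at.\<close>
  define x where "x = (\<lambda>c. \<Sum>d\<in>E. (t d * s d) * gen d c)"
  show ?thesis
  proof
    show "graded n k x"
      unfolding graded_def
    proof (intro allI impI)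
      fix c assume "x c \<noteq> 0"
      then obtain d where "d \<in> E" "(t d * s d) * gen d c \<noteq> 0"
        unfolding x_def by (rule sum.not_neutral_contains_not_neutral)
      then have "d \<in> E" "gen d c \<noteq> 0" by auto
      then show "length c = n \<and> cnt c = k" using gen(1) unfolding graded_def by blast
    qed
    then have gx: "graded n k x" .
    show "bd (\<lambda>c. w c * x c) c = 0" for c
    proof (cases "length c = n")
      case True
      have "bd (\<lambda>c. w c * x c) c = bd (\<lambda>c. \<Sum>d\<in>E. (t d * s d * (cofactor d * \<phi> d ^ v d (a d))) * bd (y d) c) c"
      proof (rule bd_cong)
        fix c' :: "bool list" assume "length c' = length c"
        then have c': "length c' = n" using True by simp
        have "w c' * x c' = (\<Sum>d\<in>E. (t d * s d) * (w c' * gen d c'))"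
          by (simp add: x_def sum_distrib_left mult_ac)
        also have "\<dots> = (\<Sum>d\<in>E. (t d * s d * (cofactor d * \<phi> d ^ v d (a d))) * bd (y d) c')"
          by (rule sum.cong) (simp_all add: gen(2) c' mult_ac)
        finally show "w c' * x c' = \<dots>" .
      qed
      then show ?thesis by (simp only: bd_sum bd_scale bd_bd mult_zero_right sum.neutral_const)
    next
      case False
      have "bd (\<lambda>c. w c * x c) c = (\<Sum>j | j < length c \<and> \<not> c ! j. sg c j * (w (c[j := True]) * x (c[j := True])))"
        by (rule bd_altdef)
      also have "\<dots> = 0" using gx False unfolding graded_def by (intro sum.neutral) auto
      finally show ?thesis .
    qed
    show "\<phi> e dvd functional e x - t e" if e: "e \<in> E" for e
    proof -
      have "functional e x = (\<Sum>d\<in>E. (t d * s d) * functional e (gen d))"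
        unfolding x_def by (simp only: functional_sum[OF e] functional_scale[OF e])
      also have "\<dots> = (t e * s e) * functional e (gen e) + (\<Sum>d\<in>E - {e}. (t d * s d) * functional e (gen d))"
        using finE e by (rule sum.remove)
      finally have "functional e x - t e = t e * (s e * (cofactor e * pairing e (bd (y e))) - 1) +
          (\<Sum>d\<in>E - {e}. (t d * s d) * functional e (gen d))"
        by (simp add: own[OF e] algebra_simps)
      moreover have "\<phi> e dvd (\<Sum>d\<in>E - {e}. (t d * s d) * functional e (gen d))"
        using other e by (intro dvd_sum dvd_mult) auto
      ultimately show ?thesis using s[OF e] by (simp add: dvd_add)
    qed
  qed
qed

end

section \<open>Reflection groups acting on weights\<close>

text \<open>A vector is given by its pairings with the simple roots, so that the reflection in the simple
  root \<open>i\<close> subtracts the multiple \<open>x i\<close> of the \<open>i\<close>-th row of the Cartan matrix.\<close>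

definition simple_reflection :: "(nat \<Rightarrow> nat \<Rightarrow> real) \<Rightarrow> nat \<Rightarrow> (nat \<Rightarrow> real) \<Rightarrow> nat \<Rightarrow> real" where
  "simple_reflection c i x = (\<lambda>j. x j - c i j * x i)"

definition act :: "(nat \<Rightarrow> nat \<Rightarrow> real) \<Rightarrow> nat list \<Rightarrow> (nat \<Rightarrow> real) \<Rightarrow> nat \<Rightarrow> real" where
  "act c us = foldr (simple_reflection c) us"

fun alt :: "nat \<Rightarrow> nat \<Rightarrow> nat \<Rightarrow> nat list" where
  "alt i j 0 = []"
| "alt i j (Suc k) = i # alt j i k"

lemma length_alt [simp]: "length (alt i j k) = k"
  by (induction i j k rule: alt.induct) auto

lemma set_alt: "set (alt i j k) \<subseteq> {i, j}"
  by (induction i j k rule: alt.induct) auto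

lemma alt_add: "\<exists>us. set us \<subseteq> {i, j} \<and> length us = l \<and> alt i j (k + l) = alt i j k @ us"
proof (induction i j k rule: alt.induct)
  case (1 i j)
  then show ?case using set_alt[of i j l] by (intro exI[of _ "alt i j l"]) simp
next
  case (2 i j k)
  then obtain us where "set us \<subseteq> {j, i}" "length us = l" "alt j i (k + l) = alt j i k @ us" by blast
  then show ?case by (intro exI[of _ us]) auto
qed

lemma alternating_eq_alt:
  assumes "set p \<subseteq> {i, j}" "\<And>a r b. p \<noteq> a @ [r, r] @ b" "p = [] \<or> hd p = i"
  shows "p = alt i j (length p)"
  using assms
proof (induction p arbitrary: i j)
  case (Cons r p)
  have "p = [] \<or> hd p = j"
  proof (cases p)
    case (Cons r' p')
    then have "r' \<noteq> r" using Cons.prems(2)[of "[]" r p'] by auto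
    then show ?thesis using Cons Cons.prems by auto
  qed simp
  moreover have "p \<noteq> a @ [s, s] @ b" for a s b using Cons.prems(2)[of "r # a" s b] by auto
  moreover have "set p \<subseteq> {j, i}" using Cons.prems by auto
  ultimately have "p = alt j i (length p)" by (intro Cons.IH)
  then show ?case using Cons.prems by simp
qed simp

lemma act_simps [simp]: "act c [] x = x" "act c (i # us) x = simple_reflection c i (act c us x)"
  by (simp_all add: act_def)

lemma act_append: "act c (us @ vs) x = act c us (act c vs x)"
  by (simp add: act_def)

lemma act_diff: "act c us (\<lambda>l. x l - y l) = (\<lambda>l. act c us x l - act c us y l)"
proof (induction us)
  case (Cons i us)
  then show ?case by (simp add: simple_reflection_def algebra_simps)
qed simp

text \<open>\<open>c i j * c j i\<close> is $4\cos^2(\pi/m)$.\<close>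

definition dihedral_entry :: "nat \<Rightarrow> real \<Rightarrow> real \<Rightarrow> bool" where
  "dihedral_entry m a b \<longleftrightarrow> a \<le> 0 \<and> b \<le> 0 \<and>
     (m = 2 \<and> a = 0 \<and> b = 0 \<or> m = 3 \<and> a * b = 1 \<or> m = 4 \<and> a * b = 2 \<or>
      m = 5 \<and> (a * b)\<^sup>2 = 3 * (a * b) - 1 \<and> a * b \<ge> 2)"

text \<open>The sign rule in a dihedral group: a word of length \<open>k < m\<close> that starts
  with \<open>i\<close> can still be prolonged by \<open>j\<close> on the left, so its image of a
  dominant vector is nonnegative on the simple root \<open>j\<close>. The coefficients are
  Chebyshev-like polynomials in \<open>K\<close>, checked for each of the five lengths.\<close>

lemma alt_nonneg:
  assumes "dihedral_entry m (c i j) (c j i)" "c i i = 2" "c j j = 2" "k < m" "x i \<ge> 0" "x j \<ge> 0"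
  shows "act c (alt i j k) x j \<ge> 0"
proof -
  define a b where "a = - c i j" and "b = - c j i"
  define K where "K = a * b"
  have ab: "a \<ge> 0" "b \<ge> 0" "c i j = - a" "c j i = - b" using assms by (auto simp: dihedral_entry_def a_def b_def)
  have m: "m = 2 \<or> m = 3 \<and> K = 1 \<or> m = 4 \<and> K = 2 \<or> m = 5 \<and> K\<^sup>2 = 3 * K - 1 \<and> K \<ge> 2"
    using assms(1) by (auto simp: dihedral_entry_def K_def a_def b_def)
  have "k < 5" using m assms(4) by auto
  then consider "k = 0" | "k = 1" | "k = 2" | "k = 3" | "k = 4" by linarith
  then show ?thesis
  proof cases
    case 3
    have "act c (alt i j k) x j = a * x i + (K - 1) * x j"
      using 3 ab assms(2,3) by (simp add: numeral_eq_Suc simple_reflection_def K_def algebra_simps)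
    moreover have "K \<ge> 1" using m 3 assms(4) by auto
    ultimately show ?thesis using ab assms by simp
  next
    case 4
    have "act c (alt i j k) x j = a * (K - 2) * x i + (K - 1) * x j"
      using 4 ab assms(2,3) by (simp add: numeral_eq_Suc simple_reflection_def K_def algebra_simps)
    moreover have "K \<ge> 2" using m 4 assms(4) by auto
    ultimately show ?thesis using ab assms by simp
  next
    case 5
    have "act c (alt i j k) x j = a * (K - 2) * x i + (K\<^sup>2 - 3 * K + 1) * x j"
      using 5 ab assms(2,3) by (simp add: numeral_eq_Suc simple_reflection_def K_def algebra_simps power2_eq_square)
    moreover have "K \<ge> 2" "K\<^sup>2 - 3 * K + 1 = 0" using m 5 assms(4) by auto
    ultimately show ?thesis using ab assms by simp
  qed (use ab assms in \<open>simp_all add: simple_reflection_def\<close>)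
qed

lemma simple_reflection_involution: "c i i = 2 \<Longrightarrow> simple_reflection c i (simple_reflection c i x) = x"
  by (simp add: simple_reflection_def fun_eq_iff)

lemma act_rev:
  assumes "\<And>i. i \<in> set us \<Longrightarrow> c i i = 2"
  shows "act c us (act c (rev us) x) = x"
  using assms
  by (induction us arbitrary: x) (simp_all add: act_append simple_reflection_involution)

lemma braid_act:
  assumes "dihedral_entry m (c i j) (c j i)" "c i i = 2" "c j j = 2"
  shows "act c (alt i j m) x = act c (alt j i m) x"
proof -
  define a b where "a = c i j" and "b = c j i"
  have ab: "m = 2 \<and> a = 0 \<and> b = 0 \<or> m = 3 \<and> a * b = 1 \<or> m = 4 \<and> a * b = 2 \<or>
      m = 5 \<and> (a * b)\<^sup>2 = 3 * (a * b) - 1"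
    using assms(1) by (auto simp: dihedral_entry_def a_def b_def)
  have 3: "act c (alt i j 3) x l = act c (alt j i 3) x l" if "a * b = 1" for l
  proof -
    have *: "a * (b * t) = t" for t
      by (metis mult.assoc mult_1 that)
    show ?thesis
      using assms(2,3) by (simp add: numeral_eq_Suc simple_reflection_def algebra_simps flip: a_def b_def) (simp only: *)
  qed
  have 4: "act c (alt i j 4) x l = act c (alt j i 4) x l" if "a * b = 2" for l
  proof -
    have *: "a * (b * t) = 2 * t" for t
      by (metis mult.assoc that)
    show ?thesis
      using assms(2,3) by (simp add: numeral_eq_Suc simple_reflection_def algebra_simps flip: a_def b_def) (simp only: *)
  qed
  have 5: "act c (alt i j 5) x l = act c (alt j i 5) x l" if "(a * b)\<^sup>2 = 3 * (a * b) - 1" for l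
  proof -
    have "act c (alt i j 5) x l =
        act c (alt j i 5) x l - ((a * b)\<^sup>2 - 3 * (a * b) + 1) * (c i l * x i - c j l * x j)"
      using assms(2,3)
      by (simp add: numeral_eq_Suc simple_reflection_def power2_eq_square algebra_simps flip: a_def b_def)
    then show ?thesis using that by simp
  qed
  have 2: "act c (alt i j 2) x l = act c (alt j i 2) x l" if "a = 0" "b = 0" for l
    using assms(2,3) that by (simp add: numeral_eq_Suc simple_reflection_def flip: a_def b_def)
  have "act c (alt i j m) x l = act c (alt j i m) x l" for l
    using ab 2 3 4 5 by blast
  then show ?thesis by blast
qed

lemma relator_act:
  assumes "dihedral_entry m (c i j) (c j i)" "c i i = 2" "c j j = 2"
  shows "act c (concat (replicate m [i, j])) x = x"
proof -
  have i: "simple_reflection c i (simple_reflection c i y) = y" "simple_reflection c j (simple_reflection c j y) = y" for y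
    using assms by (simp_all add: simple_reflection_involution)
  have b: "act c (alt j i m) y = act c (alt i j m) y" for y
    using braid_act[of m c i j] assms by simp
  have "m = 2 \<or> m = 3 \<or> m = 4 \<or> m = 5" using assms(1) by (auto simp: dihedral_entry_def)
  then show ?thesis
    using b by (elim disjE) (simp_all add: numeral_eq_Suc i)
qed

section \<open>Coxeter groups\<close>

text \<open>Exactly what is taken from the presentation: braid relations hold in \<open>W\<close>,
  and equal elements act equally on vectors and have the same length parity. The theory of lengths
  and cosets below is derived from this; the exchange condition is not presupposed.\<close>

locale reflection_system =
  fixes W :: "('a, 'b) monoid_scheme" (structure) and n :: nat and s :: "nat \<Rightarrow> 'a"
    and m :: "nat \<Rightarrow> nat \<Rightarrow> nat" and c :: "nat \<Rightarrow> nat \<Rightarrow> real"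
  assumes W: "group W"
    and s_carrier: "i < n \<Longrightarrow> s i \<in> carrier W"
    and s_square: "i < n \<Longrightarrow> s i \<otimes> s i = \<one>"
    and m: "i < n \<Longrightarrow> j < n \<Longrightarrow> i \<noteq> j \<Longrightarrow> dihedral_entry (m i j) (c i j) (c j i)"
    and c_diag: "i < n \<Longrightarrow> c i i = 2"
    and braid: "i < n \<Longrightarrow> j < n \<Longrightarrow> i \<noteq> j \<Longrightarrow>
       word_prod W (map s (alt i j (m i j))) = word_prod W (map s (alt j i (m i j)))"
    and relations: "set us \<subseteq> {..<n} \<Longrightarrow> set vs \<subseteq> {..<n} \<Longrightarrow>
       word_prod W (map s us) = word_prod W (map s vs) \<Longrightarrow>
       act c us = act c vs \<and> even (length us + length vs)"
begin

interpretation group W by (rule W)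

definition wp :: "nat list \<Rightarrow> 'a" where "wp us = word_prod W (map s us)"

definition G :: "nat set \<Rightarrow> 'a set" where "G I = wp ` {us. set us \<subseteq> I}"

definition len :: "nat set \<Rightarrow> 'a \<Rightarrow> nat" where
  "len I w = (LEAST k. \<exists>us. set us \<subseteq> I \<and> length us = k \<and> wp us = w)"

definition A :: "'a \<Rightarrow> (nat \<Rightarrow> real) \<Rightarrow> nat \<Rightarrow> real" where
  "A w = act c (SOME us. set us \<subseteq> {..<n} \<and> wp us = w)"

definition dominant :: "nat set \<Rightarrow> (nat \<Rightarrow> real) \<Rightarrow> bool" where
  "dominant I x \<longleftrightarrow> (\<forall>i\<in>I. x i \<ge> 0)"

lemma wp_simps [simp]: "wp [] = \<one>" "wp (i # us) = s i \<otimes> wp us"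
  by (simp_all add: wp_def word_prod_def)

lemma wp_carrier [simp]: "set us \<subseteq> {..<n} \<Longrightarrow> wp us \<in> carrier W"
  by (induction us) (auto simp: s_carrier)

lemma wp_append: "set us \<subseteq> {..<n} \<Longrightarrow> set vs \<subseteq> {..<n} \<Longrightarrow> wp (us @ vs) = wp us \<otimes> wp vs"
  by (induction us) (auto simp: s_carrier m_assoc)

lemma s_cancel: "i < n \<Longrightarrow> w \<in> carrier W \<Longrightarrow> s i \<otimes> (s i \<otimes> w) = w"
  using m_assoc[of "s i" "s i" w] by (simp add: s_carrier s_square)

lemma wp_rev: "set us \<subseteq> {..<n} \<Longrightarrow> wp us \<otimes> wp (rev us) = \<one>"
proof (induction us)
  case (Cons i us)
  then have i: "i < n" "set us \<subseteq> {..<n}" by auto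
  have "wp (i # us) \<otimes> wp (rev (i # us)) = s i \<otimes> (wp us \<otimes> wp (rev us)) \<otimes> s i"
    using i by (simp add: wp_append s_carrier m_assoc)
  then show ?case using Cons i by (simp add: s_square s_carrier)
qed simp

lemma G_mono: "I \<subseteq> J \<Longrightarrow> G I \<subseteq> G J"
  by (auto simp: G_def)

lemma G_carrier: "I \<subseteq> {..<n} \<Longrightarrow> w \<in> G I \<Longrightarrow> w \<in> carrier W"
  by (auto simp: G_def)

lemma G_one: "\<one> \<in> G I"
  unfolding G_def by (intro image_eqI[of _ _ "[]"]) simp_all

lemma G_mult: "I \<subseteq> {..<n} \<Longrightarrow> w \<in> G I \<Longrightarrow> w' \<in> G I \<Longrightarrow> w \<otimes> w' \<in> G I"
proof -
  assume I: "I \<subseteq> {..<n}" and "w \<in> G I" "w' \<in> G I"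
  then obtain us vs where "set us \<subseteq> I" "wp us = w" "set vs \<subseteq> I" "wp vs = w'" by (auto simp: G_def)
  then show ?thesis using I wp_append[of us vs] unfolding G_def
    by (intro image_eqI[of _ _ "us @ vs"]) auto
qed

lemma G_s: "i \<in> I \<Longrightarrow> i < n \<Longrightarrow> s i \<in> G I"
  unfolding G_def by (intro image_eqI[of _ _ "[i]"]) (simp_all add: s_carrier)

lemma G_s_mult: "I \<subseteq> {..<n} \<Longrightarrow> i \<in> I \<Longrightarrow> w \<in> G I \<Longrightarrow> s i \<otimes> w \<in> G I"
  by (rule G_mult) (auto intro: G_s)

lemma G_inv: "I \<subseteq> {..<n} \<Longrightarrow> w \<in> G I \<Longrightarrow> inv w \<in> G I"
proof -
  assume I: "I \<subseteq> {..<n}" and "w \<in> G I"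
  then obtain us where us: "set us \<subseteq> I" "wp us = w" by (auto simp: G_def)
  then have "set us \<subseteq> {..<n}" using I by blast
  then have "inv w = wp (rev us)"
    using wp_rev[of us] wp_rev[of "rev us"] wp_carrier[of us] wp_carrier[of "rev us"] us
    by (intro inv_equality) simp_all
  then show ?thesis using us unfolding G_def by auto
qed

lemma len_ex:
  assumes "w \<in> G I"
  obtains us where "set us \<subseteq> I" "length us = len I w" "wp us = w"
proof -
  from assms have "\<exists>k us. set us \<subseteq> I \<and> length us = k \<and> wp us = w" by (auto simp: G_def)
  from LeastI_ex[OF this] show ?thesis using that unfolding len_def by blast
qed

lemma len_le: "set us \<subseteq> I \<Longrightarrow> wp us = w \<Longrightarrow> len I w \<le> length us"
  unfolding len_def by (intro Least_le) blast

lemma len_one [simp]: "len I \<one> = 0"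
  using len_le[of "[]" I \<one>] by simp

lemma len_wp_mult:
  assumes "I \<subseteq> {..<n}" "set us \<subseteq> I" "w \<in> G I"
  shows "len I (wp us \<otimes> w) \<le> length us + len I w"
proof -
  obtain vs where vs: "set vs \<subseteq> I" "length vs = len I w" "wp vs = w" using assms(3) by (rule len_ex)
  have "wp (us @ vs) = wp us \<otimes> w" using assms vs by (subst wp_append) auto
  then show ?thesis using len_le[of "us @ vs" I] assms vs by simp
qed

lemma parity: "set us \<subseteq> {..<n} \<Longrightarrow> set vs \<subseteq> {..<n} \<Longrightarrow> wp us = wp vs \<Longrightarrow> even (length us + length vs)"
  using relations[of us vs] by (simp add: wp_def)

text \<open>Subadditivity bounds the change by one in both directions; parity excludes
  equality.\<close>

lemma len_s:
  assumes "I \<subseteq> {..<n}" "i \<in> I" "w \<in> G I"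
  shows "len I (s i \<otimes> w) = Suc (len I w) \<or> len I w = Suc (len I (s i \<otimes> w))"
proof -
  have i: "i < n" using assms by auto
  have sw: "s i \<otimes> w \<in> G I" using assms by (rule G_s_mult)
  have 1: "len I (s i \<otimes> w) \<le> Suc (len I w)"
    using len_wp_mult[of I "[i]" w] assms i by (simp add: s_carrier)
  have 2: "len I w \<le> Suc (len I (s i \<otimes> w))"
    using len_wp_mult[of I "[i]" "s i \<otimes> w"] assms sw i G_carrier[of I w]
    by (simp add: s_carrier s_cancel)
  obtain us where us: "set us \<subseteq> I" "length us = len I w" "wp us = w" using assms(3) by (rule len_ex)
  obtain vs where vs: "set vs \<subseteq> I" "length vs = len I (s i \<otimes> w)" "wp vs = s i \<otimes> w" using sw by (rule len_ex)
  have "even (length (i # us) + length vs)" using us vs assms by (intro parity) auto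
  then have "len I (s i \<otimes> w) \<noteq> len I w" using us vs by auto
  then show ?thesis using 1 2 by linarith
qed

lemma len_descent:
  assumes "I \<subseteq> {..<n}" "w \<in> G I" "w \<noteq> \<one>"
  obtains i where "i \<in> I" "len I w = Suc (len I (s i \<otimes> w))"
proof -
  obtain us where us: "set us \<subseteq> I" "length us = len I w" "wp us = w" using assms(2) by (rule len_ex)
  with assms obtain i vs where vs: "us = i # vs" by (cases us) auto
  have i: "i \<in> I" "i < n" "set vs \<subseteq> {..<n}" using us vs assms by auto
  then have "s i \<otimes> w = wp vs" using us vs by (auto simp: s_cancel)
  then have "len I (s i \<otimes> w) \<le> length vs" using us vs by (intro len_le) auto
  then have "len I w \<noteq> len I (s i \<otimes> w) \<and> len I (s i \<otimes> w) < len I w" using us vs by simp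
  then show ?thesis using len_s[OF assms(1) i(1) assms(2)] that[OF i(1)] by linarith
qed

lemma A_wp: "set us \<subseteq> {..<n} \<Longrightarrow> A (wp us) = act c us"
proof -
  assume us: "set us \<subseteq> {..<n}"
  then have "set (SOME vs. set vs \<subseteq> {..<n} \<and> wp vs = wp us) \<subseteq> {..<n} \<and>
      wp (SOME vs. set vs \<subseteq> {..<n} \<and> wp vs = wp us) = wp us"
    by (intro someI_ex[of "\<lambda>vs. set vs \<subseteq> {..<n} \<and> wp vs = wp us"]) blast
  then show ?thesis using us relations unfolding A_def wp_def by blast
qed

lemma A_one [simp]: "A \<one> x = x"
  using A_wp[of "[]"] by simp

lemma A_mult:
  assumes "w \<in> G {..<n}" "w' \<in> G {..<n}"
  shows "A (w \<otimes> w') x = A w (A w' x)"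
proof -
  from assms obtain us vs where us: "set us \<subseteq> {..<n}" "wp us = w" "set vs \<subseteq> {..<n}" "wp vs = w'"
    by (auto simp: G_def)
  have "A (wp (us @ vs)) x = A (wp us) (A (wp vs) x)"
    using us by (subst (1 2 3) A_wp) (auto simp: act_append)
  then show ?thesis using us by (simp add: wp_append)
qed

lemma A_s_mult: "i < n \<Longrightarrow> w \<in> G {..<n} \<Longrightarrow> A (s i \<otimes> w) x = simple_reflection c i (A w x)"
  using A_mult[of "s i" w x] A_wp[of "[i]"] by (simp add: G_s s_carrier)

text \<open>The length function detects the sign of the pairing of \<open>w x\<close> with a simple root: split off
  the maximal dihedral part \<open>p\<close> of \<open>w = p v\<close>; the claim holds for \<open>v\<close> by induction, and \<open>p\<close> is an
  alternating word that is too short to change the sign.\<close>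

lemma pairing_nonneg:
  assumes "I \<subseteq> {..<n}" "w \<in> G I" "i \<in> I" "dominant I x" "len I w \<le> len I (s i \<otimes> w)"
  shows "A w x i \<ge> 0"
  using assms(2,3,5)
proof (induction "len I w" arbitrary: w i rule: less_induct)
  case less
  note I = assms(1)
  have GN: "u \<in> G {..<n}" if "u \<in> G I" for u using that G_mono[OF I] by blast
  show ?case
  proof (cases "w = \<one>")
    case True then show ?thesis using assms less.prems by (simp add: dominant_def)
  next
    case False
    obtain j where j: "j \<in> I" "len I w = Suc (len I (s j \<otimes> w))"
      using len_descent[OF I less.prems(1) False] by blast
    have ij: "i \<noteq> j" "i < n" "j < n" using j less.prems I by auto
    have wc: "w \<in> carrier W" using G_carrier I less.prems by blast
    \<comment> \<open>Length-additive factorizations of \<open>w\<close> with left factor a word in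
      \<open>i\<close> and \<open>j\<close>; one with shortest right factor \<open>v\<close> is
      taken. The descent \<open>j\<close> gives a first such factorization, so \<open>v\<close> is
      shorter than \<open>w\<close> and the induction hypothesis applies to it.\<close>
    define P where "P = (\<lambda>(p, v). set p \<subseteq> {j, i} \<and> v \<in> G I \<and> w = wp p \<otimes> v \<and> len I w = length p + len I v)"
    have P1: "P ([j], s j \<otimes> w)"
      unfolding P_def using j less.prems I ij wc by (auto simp: s_carrier s_cancel G_s_mult)
    then obtain q where q: "P q" "\<And>q'. P q' \<Longrightarrow> len I (snd q) \<le> len I (snd q')"
      using ex_has_least_nat[of P "([j], s j \<otimes> w)" "\<lambda>q. len I (snd q)"] by blast
    obtain p v where pv: "q = (p, v)" by (cases q)
    have p: "set p \<subseteq> {j, i}" "v \<in> G I" "w = wp p \<otimes> v" "len I w = length p + len I v"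
      using q(1) by (auto simp: P_def pv)
    have pn: "set p \<subseteq> {..<n}" "set p \<subseteq> I" using p ij j less.prems by auto
    have vc: "v \<in> carrier W" using p G_carrier I by blast
    have lv: "len I v < len I w" using q(2)[OF P1] j by (simp add: pv)
    \<comment> \<open>If \<open>r\<close> shortened \<open>v\<close>, it could be moved into the
      dihedral part, against the choice of \<open>v\<close>.\<close>
    have up: "len I v \<le> len I (s r \<otimes> v)" if r: "r \<in> {j, i}" for r
    proof (rule ccontr)
      assume neg: "\<not> len I v \<le> len I (s r \<otimes> v)"
      have rI: "r \<in> I" "r < n" using r j ij less.prems by auto
      then have lr: "len I v = Suc (len I (s r \<otimes> v))" using len_s[OF I rI(1) p(2)] neg by linarith
      have "wp (p @ [r]) \<otimes> (s r \<otimes> v) = w"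
        using pn rI vc p by (simp add: wp_append s_carrier m_assoc s_cancel)
      then have "P (p @ [r], s r \<otimes> v)"
        using p r lr rI I by (auto simp: P_def G_s_mult)
      then have "len I v \<le> len I (s r \<otimes> v)" using q(2) by (fastforce simp: pv)
      then show False using lr by simp
    qed
    have y: "A v x r \<ge> 0" if "r \<in> {j, i}" for r
      using less.hyps[OF lv p(2) _ up[OF that]] that j less.prems by auto
    have minimal: "length p \<le> length p'" if "set p' \<subseteq> {j, i}" "wp p' = wp p" for p'
    proof -
      have "len I w \<le> length p' + len I v"
        using len_wp_mult[OF I, of p' v] that p ij j less.prems by auto
      then show ?thesis using p by simp
    qed
    \<comment> \<open>An equally short word for the dihedral part that starts with \<open>i\<close>
      would make \<open>i\<close> a left descent of \<open>w\<close>, contrary to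
      hypothesis.\<close>
    have not_i: "p' = [] \<or> hd p' \<noteq> i" if p': "set p' \<subseteq> {j, i}" "wp p' = wp p" "length p' = length p" for p'
    proof (rule ccontr)
      assume "\<not> ?thesis"
      then obtain t where t: "p' = i # t" by (cases p') auto
      have tn: "set t \<subseteq> {..<n}" "set t \<subseteq> I" using p' t ij j less.prems by auto
      have "s i \<otimes> w = wp t \<otimes> v"
        using p(3) p'(2) t tn ij vc by (auto simp: s_carrier s_cancel m_assoc simp flip: p'(2))
      then have "len I (s i \<otimes> w) \<le> length t + len I v" using len_wp_mult[OF I tn(2) p(2)] by simp
      then show False using less.prems p t p'(3) by simp
    qed
    have no_repeat: "p \<noteq> a @ [r, r] @ b" for a r b
    proof
      assume pe: "p = a @ [r, r] @ b"
      then have rn: "r < n" "set a \<subseteq> {..<n}" "set b \<subseteq> {..<n}" using pn by auto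
      then have "wp (a @ b) = wp p" using pe by (simp add: wp_append s_carrier s_cancel)
      moreover have "set (a @ b) \<subseteq> {j, i}" using pe p by auto
      ultimately show False using minimal[of "a @ b"] pe by simp
    qed
    have "p = [] \<or> hd p = j"
      using not_i[of p] p(1) by (cases p) auto
    then have palt: "p = alt j i (length p)"
      using alternating_eq_alt[OF p(1) no_repeat] by blast
    have de: "dihedral_entry (m j i) (c j i) (c i j)" using m[of j i] ij by simp
    then have mpos: "m j i > 0" by (auto simp: dihedral_entry_def)
    \<comment> \<open>Otherwise the braid relation rewrites the initial segment of \<open>p\<close>
      into one that starts with \<open>i\<close>.\<close>
    have "length p < m j i"
    proof (rule ccontr)
      assume "\<not> ?thesis"
      then obtain l where l: "length p = m j i + l" by (metis le_Suc_ex not_less)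
      obtain us where us: "set us \<subseteq> {j, i}" "length us = l" "alt j i (m j i + l) = alt j i (m j i) @ us"
        using alt_add by blast
      have sa: "set (alt a b k) \<subseteq> {..<n}" if "a < n" "b < n" for a b k
        using set_alt[of a b k] that by auto
      have un: "set us \<subseteq> {..<n}" using us ij by auto
      have "wp (alt i j (m j i)) = wp (alt j i (m j i))" using braid[of j i] ij by (simp add: wp_def)
      then have "wp (alt i j (m j i) @ us) = wp (alt j i (m j i) @ us)"
        using ij un sa by (simp add: wp_append)
      also have "alt j i (m j i) @ us = p" using palt us l by simp
      finally have "alt i j (m j i) @ us = [] \<or> hd (alt i j (m j i) @ us) \<noteq> i"
        using us l set_alt[of i j "m j i"] by (intro not_i) auto
      moreover have "alt i j (m j i) = i # alt j i (m j i - 1)" using mpos by (cases "m j i") simp_all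
      ultimately show False by simp
    qed
    then have "act c (alt j i (length p)) (A v x) i \<ge> 0"
      using de ij y c_diag by (intro alt_nonneg[of "m j i"]) auto
    moreover have "A w x = act c p (A v x)"
      using A_mult[of "wp p" v x] A_wp[of p] p pn GN by (auto simp: G_def)
    ultimately show ?thesis using palt by simp
  qed
qed

text \<open>The coordinate at \<open>i\<close> changes sign under the reflection in
  \<open>i\<close>, so the nonnegative case is applied to \<open>s i \<otimes> w\<close>.\<close>

lemma pairing_nonpos:
  assumes "I \<subseteq> {..<n}" "w \<in> G I" "i \<in> I" "dominant I x" "len I (s i \<otimes> w) \<le> len I w"
  shows "A w x i \<le> 0"
proof -
  have i: "i < n" "w \<in> carrier W" "w \<in> G {..<n}" using assms G_carrier G_mono[OF assms(1)] by auto
  have "A (s i \<otimes> w) x i \<ge> 0"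
    by (rule pairing_nonneg[of I]) (use assms i in \<open>auto simp: G_s_mult s_cancel\<close>)
  then show ?thesis using i c_diag[of i] by (simp add: A_s_mult simple_reflection_def)
qed

text \<open>Both lengths detect the sign of the same coordinate. If a descent \<open>i\<close> for
  the length in \<open>I\<close> were none for the full length, the coordinate of
  \<open>A w x\<close> at \<open>i\<close> would vanish for all dominant \<open>x\<close>, hence for
  differences of dominant vectors, that is for all \<open>x\<close>; but \<open>A w\<close> is
  invertible.\<close>

lemma len_parabolic:
  assumes "I \<subseteq> {..<n}" "w \<in> G I"
  shows "len {..<n} w = len I w"
  using assms(2)
proof (induction "len I w" arbitrary: w rule: less_induct)
  case less
  show ?case
  proof (cases "w = \<one>")
    case False
    obtain i where i: "i \<in> I" "len I w = Suc (len I (s i \<otimes> w))"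
      using len_descent[OF assms(1) less.prems False] by blast
    have wN: "w \<in> G {..<n}" "i < n" using less.prems G_mono[OF assms(1)] i assms by auto
    have IH: "len {..<n} (s i \<otimes> w) = len I (s i \<otimes> w)"
      using i less.prems assms by (intro less.hyps G_s_mult) auto
    have le: "len {..<n} w \<le> len I w"
    proof -
      obtain us where us: "set us \<subseteq> I" "length us = len I w" "wp us = w" using less.prems by (rule len_ex)
      then show ?thesis using len_le[of us "{..<n}" w] assms(1) by auto
    qed
    have "len {..<n} (s i \<otimes> w) < len {..<n} w"
    proof (rule ccontr)
      assume "\<not> ?thesis"
      then have ge: "len {..<n} w \<le> len {..<n} (s i \<otimes> w)" by simp
      have zero: "A w x i = 0" if x: "dominant {..<n} x" for x
      proof (rule antisym)
        have "dominant I x" using x assms(1) by (auto simp: dominant_def)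
        then show "A w x i \<le> 0" using pairing_nonpos[OF assms(1) less.prems i(1)] i(2) by simp
        show "0 \<le> A w x i" using pairing_nonneg[OF order_refl wN(1) _ x ge] wN(2) by simp
      qed
      obtain us where us: "set us \<subseteq> {..<n}" "wp us = w" using wN by (auto simp: G_def)
      \<comment> \<open>A preimage under \<open>A w\<close> of the vector with all coordinates 1,
        then split into positive and negative parts, both dominant.\<close>
      define e :: "nat \<Rightarrow> real" where "e = act c (rev us) (\<lambda>_. 1)"
      have "act c us (\<lambda>l. max (e l) 0 - max (- e l) 0) i = 0"
        using zero[of "\<lambda>l. max (e l) 0"] zero[of "\<lambda>l. max (- e l) 0"] us A_wp[of us]
        by (simp add: dominant_def act_diff)
      moreover have "(\<lambda>l. max (e l) 0 - max (- e l) 0) = e" by (auto simp: max_def)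
      moreover have "act c us e = (\<lambda>_. 1)" unfolding e_def using us c_diag by (intro act_rev) auto
      ultimately show False by simp
    qed
    then show ?thesis using IH i le by linarith
  qed simp
qed

text \<open>At a left descent \<open>i\<close> of a stabilizing \<open>w\<close> the coordinate of
  \<open>x\<close> is both nonnegative and nonpositive. Hence \<open>s i\<close> fixes
  \<open>x\<close> as well and can be split off.\<close>

lemma stabilizer:
  assumes "I \<subseteq> {..<n}" "w \<in> G I" "dominant I x" "A w x = x"
  shows "w \<in> G {i \<in> I. x i = 0}"
  using assms(2,4)
proof (induction "len I w" arbitrary: w rule: less_induct)
  case less
  show ?case
  proof (cases "w = \<one>")
    case False
    obtain i where i: "i \<in> I" "len I w = Suc (len I (s i \<otimes> w))"
      using len_descent[OF assms(1) less.prems(1) False] by blast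
    have wN: "w \<in> G {..<n}" "i < n" using less.prems G_mono[OF assms(1)] i assms by auto
    have "A w x i \<le> 0" by (rule pairing_nonpos[OF assms(1) less.prems(1) i(1) assms(3)]) (use i in simp)
    then have xi: "x i = 0" using less.prems i assms(3) by (auto simp: dominant_def intro: antisym)
    have "A (s i \<otimes> w) x = x" using wN less.prems xi by (simp add: A_s_mult simple_reflection_def)
    then have "s i \<otimes> w \<in> G {i \<in> I. x i = 0}"
      using i less.prems assms by (intro less.hyps G_s_mult) auto
    then have "s i \<otimes> (s i \<otimes> w) \<in> G {i \<in> I. x i = 0}" by (rule G_s_mult[rotated 2]) (use i xi assms in auto)
    then show ?thesis using wN G_carrier[of "{..<n}" w] by (simp add: s_cancel)
  qed (simp add: G_one)
qed

end

text \<open>The orbit of a dominant vector, sorted by the length of minimal coset representatives.\<close>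

fun orbit_level :: "(nat \<Rightarrow> nat \<Rightarrow> real) \<Rightarrow> nat set \<Rightarrow> (nat \<Rightarrow> real) \<Rightarrow> nat \<Rightarrow> (nat \<Rightarrow> real) set" where
  "orbit_level c I x 0 = {x}"
| "orbit_level c I x (Suc k) = {simple_reflection c i y | i y. i \<in> I \<and> y \<in> orbit_level c I x k \<and> y i > 0}"

context reflection_system
begin

interpretation group W by (rule W)

context
  fixes I x J
  assumes I: "I \<subseteq> {..<n}" and x: "dominant I x" and J: "J = {i \<in> I. x i = 0}"
begin

lemma GI: "w \<in> G I \<Longrightarrow> w \<in> G {..<n}" "w \<in> G J \<Longrightarrow> w \<in> G I" "w \<in> G I \<Longrightarrow> w \<in> carrier W"
  using G_mono[OF I] G_mono[of J I] G_carrier[OF I] J by auto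

lemma A_stab: "w \<in> G J \<Longrightarrow> A w x = x"
proof -
  assume "w \<in> G J"
  then obtain us where us: "set us \<subseteq> J" "wp us = w" by (auto simp: G_def)
  then have "act c us x = x" by (induction us arbitrary: w) (auto simp: J simple_reflection_def)
  moreover have "set us \<subseteq> {..<n}" using us I J by blast
  ultimately show ?thesis using us A_wp[of us] by simp
qed

lemma orbit_cover: "w \<in> G I \<Longrightarrow> \<exists>k. A w x \<in> orbit_level c I x k"
proof (induction "len I w" arbitrary: w rule: less_induct)
  case less
  show ?case
  proof (cases "w = \<one>")
    case True then show ?thesis by (intro exI[of _ 0]) simp
  next
    case False
    obtain i where i: "i \<in> I" "len I w = Suc (len I (s i \<otimes> w))"
      using len_descent[OF I less.prems False] by blast
    let ?w = "s i \<otimes> w"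
    have w: "?w \<in> G I" "i < n" using i less.prems I by (auto intro: G_s_mult)
    have ww: "s i \<otimes> ?w = w" using w less.prems by (simp add: s_cancel GI)
    obtain k where k: "A ?w x \<in> orbit_level c I x k" using less.hyps[of ?w] i w by auto
    have ge: "A ?w x i \<ge> 0" by (rule pairing_nonneg[OF I w(1) i(1) x]) (use i ww in simp)
    have Aw: "A w x = simple_reflection c i (A ?w x)" using A_s_mult[of i ?w x] w ww by (simp add: GI)
    show ?thesis
    proof (cases "A ?w x i = 0")
      case True
      then show ?thesis using k Aw by (auto simp: simple_reflection_def)
    next
      case False
      then have "A ?w x i > 0" using ge by simp
      then have "A w x \<in> orbit_level c I x (Suc k)" using k i(1) unfolding orbit_level.simps Aw by blast
      then show ?thesis by blast
    qed
  qed
qed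

text \<open>The level is the length of the minimal coset representative. All elements of the coset
  of \<open>u\<close> send \<open>x\<close> to the same \<open>z\<close>, so \<open>z i > 0\<close>
  shows that \<open>s i\<close> lengthens all of them simultaneously.\<close>

lemma orbit_rep:
  "y \<in> orbit_level c I x k \<Longrightarrow>
     \<exists>u\<in>G I. A u x = y \<and> (\<forall>v\<in>G J. len I (u \<otimes> v) = k + len I v)"
proof (induction k arbitrary: y)
  case 0
  then show ?case by (intro bexI[of _ \<one>]) (auto simp: G_one GI)
next
  case (Suc k)
  then obtain i z where z: "i \<in> I" "z \<in> orbit_level c I x k" "z i > 0" "y = simple_reflection c i z" by auto
  then obtain u where u: "u \<in> G I" "A u x = z" "\<And>v. v \<in> G J \<Longrightarrow> len I (u \<otimes> v) = k + len I v"
    using Suc.IH by blast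
  have i: "i < n" using z I by auto
  have "len I (s i \<otimes> u \<otimes> v) = Suc k + len I v" if v: "v \<in> G J" for v
  proof -
    have uv: "u \<otimes> v \<in> G I" using u v I by (intro G_mult) (auto intro: GI)
    have "A (u \<otimes> v) x = z" using u v by (simp add: A_mult GI A_stab)
    then have "\<not> len I (s i \<otimes> (u \<otimes> v)) \<le> len I (u \<otimes> v)"
      using pairing_nonpos[OF I uv z(1) x] z(3) by auto
    then have "len I (s i \<otimes> (u \<otimes> v)) = Suc (len I (u \<otimes> v))"
      using len_s[OF I z(1) uv] by linarith
    then show ?thesis using u v i by (simp add: m_assoc s_carrier GI)
  qed
  moreover have "A (s i \<otimes> u) x = y" using u z i by (simp add: A_s_mult GI)
  moreover have "s i \<otimes> u \<in> G I" using u z I by (intro G_s_mult)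
  ultimately show ?case by blast
qed

lemma orbit_fibre:
  assumes "u \<in> G I"
  shows "{w \<in> G I. A w x = A u x} = (\<lambda>v. u \<otimes> v) ` G J"
proof (intro equalityI subsetI)
  fix w assume "w \<in> {w \<in> G I. A w x = A u x}"
  then have w: "w \<in> G I" "A w x = A u x" by auto
  have iu: "inv u \<in> G I" using assms I by (intro G_inv)
  have "A (inv u \<otimes> w) x = A (inv u) (A u x)" using iu w by (simp add: A_mult GI)
  also have "\<dots> = A (inv u \<otimes> u) x" by (rule A_mult[symmetric]) (use iu assms in \<open>simp_all add: GI\<close>)
  also have "\<dots> = x" using assms by (simp add: GI)
  finally have "inv u \<otimes> w \<in> G J"
    unfolding J using iu w I x by (intro stabilizer G_mult)
  moreover have "u \<otimes> (inv u \<otimes> w) = w" using assms w by (simp add: GI m_assoc[symmetric])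
  ultimately show "w \<in> (\<lambda>v. u \<otimes> v) ` G J" by force
next
  fix w assume "w \<in> (\<lambda>v. u \<otimes> v) ` G J"
  then show "w \<in> {w \<in> G I. A w x = A u x}"
    using assms I by (auto simp: A_mult GI A_stab intro: G_mult)
qed

lemma orbit_disjoint: "y \<in> orbit_level c I x k \<Longrightarrow> y \<in> orbit_level c I x l \<Longrightarrow> k = l"
proof -
  have "k \<le> l" if yk: "y \<in> orbit_level c I x k" and yl: "y \<in> orbit_level c I x l" for k l
  proof -
    obtain u where u: "u \<in> G I" "A u x = y" "\<And>v. v \<in> G J \<Longrightarrow> len I (u \<otimes> v) = k + len I v"
      using orbit_rep[OF yk] by blast
    obtain u' where u': "u' \<in> G I" "A u' x = y" "\<And>v. v \<in> G J \<Longrightarrow> len I (u' \<otimes> v) = l + len I v"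
      using orbit_rep[OF yl] by blast
    have "u' \<in> (\<lambda>v. u \<otimes> v) ` G J" using orbit_fibre[OF u(1)] u u' by auto
    then have "k \<le> len I u'" using u(3) by auto
    also have "len I u' = l" using u'(3)[OF G_one] u' by (simp add: GI)
    finally show ?thesis .
  qed
  then show "y \<in> orbit_level c I x k \<Longrightarrow> y \<in> orbit_level c I x l \<Longrightarrow> k = l"
    by (meson antisym)
qed

text \<open>Every element of the larger parabolic is uniquely a minimal representative times an
  element of the stabilizer, with lengths adding up. Once a level is empty all later ones are, so
  the orbit is finite.\<close>

theorem poincare_step:
  assumes "orbit_level c I x N = {}" "finite (G J)"
  shows "finite (G I)"
    and "(\<Sum>w\<in>G I. Polynomial.monom (1::rat) (len {..<n} w)) =
      (\<Sum>k<N. Polynomial.monom (of_nat (card (orbit_level c I x k))) k) *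
      (\<Sum>w\<in>G J. Polynomial.monom 1 (len {..<n} w))"
proof -
  have finI: "finite I" using I finite_subset by blast
  have fin: "finite (orbit_level c I x k)" for k
  proof (induction k)
    case (Suc k)
    have "orbit_level c I x (Suc k) \<subseteq> (\<lambda>(i, y). simple_reflection c i y) ` (I \<times> orbit_level c I x k)" by auto
    then show ?case using Suc finI finite_subset by (metis finite_cartesian_product finite_imageI)
  qed simp
  have empty: "orbit_level c I x (N + k) = {}" for k
    by (induction k) (use assms in auto)
  define T where "T = (\<Union>k\<in>{..<N}. orbit_level c I x k)"
  have AT: "A w x \<in> T" if "w \<in> G I" for w
  proof -
    from orbit_cover[OF that] obtain k where k: "A w x \<in> orbit_level c I x k" by blast
    have "k < N"
    proof (rule ccontr)
      assume "\<not> k < N"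
      then have "orbit_level c I x k = {}" using empty[of "k - N"] by simp
      then show False using k by simp
    qed
    then show ?thesis using k by (auto simp: T_def)
  qed
  have fibre: "finite {w \<in> G I. A w x = y} \<and>
      (\<Sum>w\<in>{w \<in> G I. A w x = y}. Polynomial.monom (1::rat) (len {..<n} w)) =
      Polynomial.monom 1 k * (\<Sum>w\<in>G J. Polynomial.monom 1 (len {..<n} w))"
    if y: "y \<in> orbit_level c I x k" for y k
  proof -
    obtain u where u: "u \<in> G I" "A u x = y" "\<And>v. v \<in> G J \<Longrightarrow> len I (u \<otimes> v) = k + len I v"
      using orbit_rep[OF y] by blast
    have f: "{w \<in> G I. A w x = y} = (\<lambda>v. u \<otimes> v) ` G J" using orbit_fibre u by auto
    have inj: "inj_on (\<lambda>v. u \<otimes> v) (G J)" using u by (auto intro!: inj_onI simp: GI)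
    have "len {..<n} (u \<otimes> v) = k + len {..<n} v" if "v \<in> G J" for v
      using u(3)[OF that] that u I by (simp add: len_parabolic[OF I] GI G_mult)
    then show ?thesis
      using assms(2) inj by (simp add: f sum.reindex sum_distrib_left mult_monom)
  qed
  have "G I \<subseteq> (\<Union>y\<in>T. {w \<in> G I. A w x = y})" using AT by blast
  moreover have finT: "finite T" using fin by (simp add: T_def)
  moreover have "finite {w \<in> G I. A w x = y}" if "y \<in> T" for y
    using that fibre by (auto simp: T_def)
  ultimately show finG: "finite (G I)" by (meson finite_UN_I finite_subset)
  have "(\<Sum>w\<in>G I. Polynomial.monom (1::rat) (len {..<n} w)) =
      (\<Sum>y\<in>T. \<Sum>w\<in>{w \<in> G I. A w x = y}. Polynomial.monom 1 (len {..<n} w))"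
    using finG finT AT by (intro sum.group[symmetric]) auto
  also have "\<dots> = (\<Sum>k<N. \<Sum>y\<in>orbit_level c I x k. \<Sum>w\<in>{w \<in> G I. A w x = y}. Polynomial.monom 1 (len {..<n} w))"
    unfolding T_def using fin orbit_disjoint by (intro sum.UNION_disjoint) auto
  also have "\<dots> = (\<Sum>k<N. \<Sum>y\<in>orbit_level c I x k.
      Polynomial.monom 1 k * (\<Sum>w\<in>G J. Polynomial.monom 1 (len {..<n} w)))"
    using fibre by (intro sum.cong) auto
  also have "\<dots> = (\<Sum>k<N. Polynomial.monom (of_nat (card (orbit_level c I x k))) k) *
      (\<Sum>w\<in>G J. Polynomial.monom 1 (len {..<n} w))"
    by (simp add: sum_distrib_right of_nat_monom mult_monom flip: mult.assoc)
  finally show "(\<Sum>w\<in>G I. Polynomial.monom (1::rat) (len {..<n} w)) = \<dots>" .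
qed

end

end

section \<open>Exact arithmetic in the golden field\<close>

text \<open>The pair \<open>(a, b)\<close> stands for $a + b\varphi$ with $\varphi^2 = \varphi + 1$; types $H_3$ and $H_4$
  need the irrational Cartan entry $-2\cos(\pi/5) = -\varphi$.\<close>

type_synonym gold = "int \<times> int"

definition golden :: real where "golden = (1 + sqrt 5) / 2"

fun gval :: "gold \<Rightarrow> real" where "gval (a, b) = of_int a + of_int b * golden"

fun gmul :: "gold \<Rightarrow> gold \<Rightarrow> gold" where
  "gmul (a, b) (c, d) = (a * c + b * d, a * d + b * c + b * d)"

fun gsub :: "gold \<Rightarrow> gold \<Rightarrow> gold" where
  "gsub (a, b) (c, d) = (a - c, b - d)"

fun gpos :: "gold \<Rightarrow> bool" where
  "gpos (a, b) =
     (if b = 0 then a > 0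
      else if b > 0 then a \<ge> 0 \<or> a * a + a * b - b * b < 0
      else a > 0 \<and> a * a + a * b - b * b > 0)"

lemma golden: "golden * golden = golden + 1" "golden > 3 / 2"
proof -
  show "golden * golden = golden + 1" by (simp add: golden_def field_simps)
  have "sqrt 5 > 2" by (rule real_less_rsqrt) simp
  then show "golden > 3 / 2" by (simp add: golden_def)
qed

lemma gval_gmul: "gval (gmul x y) = gval x * gval y"
proof -
  obtain a b c d where xy: "x = (a, b)" "y = (c, d)" by (cases x; cases y)
  have "gval x * gval y =
      of_int (a * c) + of_int (a * d + b * c) * golden + of_int (b * d) * (golden * golden)"
    by (simp add: xy algebra_simps)
  then show ?thesis unfolding golden by (simp add: xy algebra_simps)
qed

lemma gval_gsub: "gval (gsub x y) = gval x - gval y"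
  by (cases x; cases y) (simp add: algebra_simps)

lemma gval_norm:
  "(of_int a + of_int b * golden) * (of_int a + of_int b * (1 - golden)) = of_int (a * a + a * b - b * b)"
proof -
  have "(of_int a + of_int b * golden) * (of_int a + of_int b * (1 - golden)) =
      of_int (a * a) + of_int (a * b) + of_int (b * b) * (golden - golden * golden)"
    by (simp add: algebra_simps)
  then show ?thesis unfolding golden by simp
qed

text \<open>When \<open>a\<close> and \<open>b\<close> have opposite signs, the sign of the
  conjugate is known and that of the value follows from the integer norm
  \<open>a * a + a * b - b * b\<close>.\<close>

lemma gpos_iff: "gpos x \<longleftrightarrow> gval x > 0"
proof -
  obtain a b where x: "x = (a, b)" by (cases x)
  define v v' where "v = of_int a + of_int b * golden" and "v' = of_int a + of_int b * (1 - golden)"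
  have N: "v * v' = of_int (a * a + a * b - b * b)" by (simp only: v_def v'_def gval_norm)
  have g: "golden > 0" "1 - golden < 0" using golden by auto
  consider "b = 0" | "b > 0" "a \<ge> 0" | "b > 0" "a < 0" | "b < 0" "a > 0" | "b < 0" "a \<le> 0" by linarith
  then have "gpos (a, b) \<longleftrightarrow> v > 0"
  proof cases
    case 1 then show ?thesis by (simp add: v_def)
  next
    case 2
    then have "v > 0" using g by (simp add: v_def add_nonneg_pos)
    then show ?thesis using 2 by simp
  next
    case 3
    then have "v' < 0" using g by (simp add: v'_def add_neg_neg mult_pos_neg)
    then have "v > 0 \<longleftrightarrow> v * v' < 0" by (simp add: mult_less_0_iff)
    then show ?thesis unfolding N using 3 by (simp only: of_int_less_0_iff gpos.simps) auto
  next
    case 4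
    then have "v' > 0" using g by (simp add: v'_def add_pos_pos mult_neg_neg)
    then have "v > 0 \<longleftrightarrow> v * v' > 0" by (simp add: zero_less_mult_iff)
    then show ?thesis unfolding N using 4 by (simp only: of_int_0_less_iff gpos.simps) auto
  next
    case 5
    then have "v < 0" using g by (simp add: v_def add_nonpos_neg mult_neg_pos)
    then show ?thesis using 5 by simp
  qed
  then show ?thesis by (simp add: x v_def)
qed

text \<open>Irrationality of the square root of 5: vanishing of the norm gives
  \<open>(2 * a + b)\<^sup>2 = 5 * b\<^sup>2\<close>, where for nonzero \<open>b\<close> the
  multiplicity of 5 is even on the left and odd on the right.\<close>

lemma gval_eq_0:
  assumes "gval x = 0"
  shows "x = (0, 0)"
proof -
  obtain a b where x: "x = (a, b)" by (cases x)
  have "real_of_int (a * a + a * b - b * b) = 0" using gval_norm[of a b] assms x by simp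
  then have "a * a + a * b - b * b = 0" by linarith
  then have "(2 * a + b)\<^sup>2 = 5 * b\<^sup>2" by (simp add: power2_eq_square algebra_simps)
  then have eq: "nat \<bar>2 * a + b\<bar> ^ 2 = 5 * nat \<bar>b\<bar> ^ 2"
    by (metis (no_types, opaque_lifting) abs_ge_zero nat_mult_distrib nat_numeral nat_power_eq power2_abs zero_le_numeral)
  have p: "prime_elem (5::nat)" by (rule prime_imp_prime_elem) simp
  have "b = 0"
  proof (rule ccontr)
    assume "b \<noteq> 0"
    define u t where "u = nat \<bar>2 * a + b\<bar>" and "t = nat \<bar>b\<bar>"
    have ut: "u ^ 2 = 5 * t ^ 2" "t \<noteq> 0" "u \<noteq> 0" using eq \<open>b \<noteq> 0\<close> by (auto simp: u_def t_def intro: ccontr)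
    have "multiplicity 5 (u ^ 2) = 2 * multiplicity 5 u"
      by (rule prime_elem_multiplicity_power_distrib[OF p ut(3)])
    moreover have "multiplicity 5 (5 * t ^ 2) = Suc (2 * multiplicity 5 t)"
      using p ut by (simp add: prime_elem_multiplicity_mult_distrib prime_elem_multiplicity_power_distrib)
    ultimately have "2 * multiplicity 5 u = Suc (2 * multiplicity 5 t)" using ut by simp
    then show False by presburger
  qed
  then show ?thesis using assms x by simp
qed

lemma gval_inject: "gval x = gval y \<longleftrightarrow> x = y"
proof
  assume "gval x = gval y"
  then have "gsub x y = (0, 0)" by (intro gval_eq_0) (simp add: gval_gsub)
  then show "x = y" by (cases x; cases y) simp
qed simp

section \<open>The exceptional Coxeter groups\<close>

text \<open>Only the product of opposite entries is prescribed. For \<open>m = 4\<close> the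
  asymmetric choice -2, -1 avoids the square root of 2; for \<open>m = 5\<close> the entry is minus
  the golden ratio on both sides.\<close>

definition cartan_entry :: "nat \<Rightarrow> nat \<Rightarrow> nat \<Rightarrow> gold" where
  "cartan_entry m i j =
     (if i = j then (2, 0) else if m = 2 then (0, 0) else if m = 3 then (-1, 0)
      else if m = 4 then (if i < j then (-2, 0) else (-1, 0)) else (0, -1))"

definition cartan_row :: "exceptional_type \<Rightarrow> nat \<Rightarrow> gold list" where
  "cartan_row T i = map (\<lambda>j. cartan_entry (coxeter_matrix T (Suc i) (Suc j)) i j) [0..<type_rank T]"

definition cartan :: "exceptional_type \<Rightarrow> nat \<Rightarrow> nat \<Rightarrow> real" where
  "cartan T i j = (if i < type_rank T \<and> j < type_rank T then gval (cartan_row T i ! j) else 0)"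

lemma coxeter_matrix_sym: "coxeter_matrix T i j = coxeter_matrix T j i"
  by (simp add: coxeter_matrix_def min.commute max.commute)

lemma coxeter_matrix_range: "i \<noteq> j \<Longrightarrow> coxeter_matrix T i j \<in> {2, 3, 4, 5}"
proof -
  assume "i \<noteq> j"
  moreover have "m \<in> {3, 4, 5}" if "map_of (coxeter_graph T) e = Some m" for m e
    using map_of_SomeD[OF that] by (cases T) auto
  ultimately show ?thesis by (auto simp: coxeter_matrix_def split: option.splits)
qed

lemma cartan_dihedral:
  assumes "i < type_rank T" "j < type_rank T" "i \<noteq> j"
  shows "dihedral_entry (coxeter_matrix T (Suc i) (Suc j)) (cartan T i j) (cartan T j i)"
proof -
  have c: "cartan T i j = gval (cartan_entry (coxeter_matrix T (Suc i) (Suc j)) i j)"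
    "cartan T j i = gval (cartan_entry (coxeter_matrix T (Suc i) (Suc j)) j i)"
    using assms coxeter_matrix_sym[of T "Suc j" "Suc i"] by (simp_all add: cartan_def cartan_row_def)
  have g: "(golden * golden)\<^sup>2 = 3 * (golden * golden) - 1" "golden * golden \<ge> 2" "golden \<ge> 0"
    using golden by (simp_all add: power2_eq_square algebra_simps)
  have "coxeter_matrix T (Suc i) (Suc j) \<in> {2, 3, 4, 5}"
    using coxeter_matrix_range assms(3) by (metis nat.inject)
  then show ?thesis
    using assms(3) g by (auto simp: c dihedral_entry_def cartan_entry_def)
qed

lemma cartan_diag: "i < type_rank T \<Longrightarrow> cartan T i i = 2"
  by (simp add: cartan_def cartan_row_def cartan_entry_def)

text \<open>The relator is one alternating word followed by the reverse of the other, and for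
  involutions reversal is inversion.\<close>

lemma (in group) braid_relation:
  assumes "\<And>k. k \<in> {i, j} \<Longrightarrow> s k \<in> carrier G \<and> s k \<otimes> s k = \<one>" "(s i \<otimes> s j) [^] m = \<one>" "m \<in> {2, 3, 4, 5::nat}"
  shows "word_prod G (map s (alt i j m)) = word_prod G (map s (alt j i m))"
proof -
  have s: "s i \<in> carrier G" "s j \<in> carrier G" "s i \<otimes> s i = \<one>" "s j \<otimes> s j = \<one>" using assms(1) by auto
  have cancel: "s i \<otimes> (s i \<otimes> x) = x" "s j \<otimes> (s j \<otimes> x) = x" if "x \<in> carrier G" for x
    using s that by (simp_all flip: m_assoc)
  have carrier: "word_prod G (map s us) \<in> carrier G" if "set us \<subseteq> {i, j}" for us
    using that by (induction us) (auto simp: word_prod_def s)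
  have append: "word_prod G (map s (us @ vs)) = word_prod G (map s us) \<otimes> word_prod G (map s vs)"
    if "set us \<subseteq> {i, j}" "set vs \<subseteq> {i, j}" for us vs
    using that carrier by (induction us) (auto simp: word_prod_def s m_assoc)
  have rev: "word_prod G (map s (rev us)) \<otimes> word_prod G (map s us) = \<one>" if "set us \<subseteq> {i, j}" for us
    using that
  proof (induction us)
    case (Cons k us)
    then have "word_prod G (map s (rev (k # us))) \<otimes> word_prod G (map s (k # us)) =
        word_prod G (map s (rev us)) \<otimes> (s k \<otimes> (s k \<otimes> word_prod G (map s us)))"
      using append[of "rev us" "[k]"] carrier[of us] carrier[of "rev us"] s
      by (auto simp: word_prod_def m_assoc)
    also have "\<dots> = \<one>" using Cons cancel carrier[of us] by auto
    finally show ?case .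
  qed (simp add: word_prod_def)
  have pow: "word_prod G (map s (concat (replicate k [i, j]))) = (s i \<otimes> s j) [^] k" for k
  proof (induction k)
    case (Suc k)
    have "(s i \<otimes> s j) [^] Suc k = (s i \<otimes> s j) \<otimes> (s i \<otimes> s j) [^] k"
      using s by (simp only: nat_pow_Suc2[of "s i \<otimes> s j"] m_closed)
    then show ?case using Suc s by (simp add: word_prod_def m_assoc)
  qed (simp add: word_prod_def)
  have "concat (replicate m [i, j]) = alt i j m @ rev (alt j i m)"
    using assms(3) by (auto simp: numeral_eq_Suc)
  moreover have sub: "set (alt i j m) \<subseteq> {i, j}" "set (alt j i m) \<subseteq> {i, j}"
    using set_alt[of i j m] set_alt[of j i m] by auto
  ultimately have "word_prod G (map s (alt i j m)) \<otimes> word_prod G (map s (rev (alt j i m))) = \<one>"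
    using pow[of m] append[of "alt i j m" "rev (alt j i m)"] sub assms(2) by simp
  moreover have "word_prod G (map s (rev (alt j i m))) \<otimes> word_prod G (map s (alt j i m)) = \<one>"
    by (rule rev[OF sub(2)])
  moreover have "word_prod G (map s (alt i j m)) \<in> carrier G" "word_prod G (map s (alt j i m)) \<in> carrier G"
    "word_prod G (map s (rev (alt j i m))) \<in> carrier G"
    using carrier sub by auto
  ultimately show ?thesis by (metis m_assoc l_one r_one)
qed

text \<open>Vertices are numbered from 0 to match list positions, Bourbaki's from 1; hence the
  successors in the Coxeter matrix.\<close>

locale exceptional =
  fixes W :: "('a, 'b) monoid_scheme" (structure) and S :: "'a set" and T :: exceptional_type
    and s :: "nat \<Rightarrow> 'a"
  assumes cox: "coxeter_system W S"
    and bij: "bij_betw s {..<type_rank T} S"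
    and ord: "\<And>i j. i < type_rank T \<Longrightarrow> j < type_rank T \<Longrightarrow>
       group.ord W (s i \<otimes> s j) = coxeter_matrix T (Suc i) (Suc j)"
begin

abbreviation (input) n where "n \<equiv> type_rank T"

interpretation group W using cox by (simp add: coxeter_system_def)

lemma s_S: "i < n \<Longrightarrow> s i \<in> S"
  using bij by (auto simp: bij_betw_def)

lemma s_in_carrier: "i < n \<Longrightarrow> s i \<in> carrier W"
  using s_S cox by (auto simp: coxeter_system_def)

lemma s_involution: "i < n \<Longrightarrow> s i \<otimes> s i = \<one>"
proof -
  assume i: "i < n"
  then have "group.ord W (s i) = 2" using s_S cox by (auto simp: coxeter_system_def)
  then have "s i [^] (2::nat) = \<one>" using pow_ord_eq_1[OF s_in_carrier[OF i]] by simp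
  then show ?thesis using s_in_carrier[OF i] by (simp add: numeral_eq_Suc)
qed

text \<open>The presentation speaks of words in elements of \<open>S\<close>, so the action is
  pulled back to these. Relators act trivially and have even length, which makes action and parity
  invariants of the equivalence.\<close>

definition act_word :: "'a list \<Rightarrow> (nat \<Rightarrow> real) \<Rightarrow> nat \<Rightarrow> real" where
  "act_word ws = act (cartan T) (map (inv_into {..<n} s) ws)"

lemma act_word_relator:
  assumes "a \<in> S" "b \<in> S"
  shows "act_word (concat (replicate (group.ord W (a \<otimes> b)) [a, b])) x = x"
proof -
  from assms bij obtain i j where i: "i < n" "a = s i" "j < n" "b = s j"
    by (auto simp: bij_betw_def)
  then have inv: "inv_into {..<n} s a = i" "inv_into {..<n} s b = j"
    using bij by (auto simp: bij_betw_def inv_into_f_f)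
  have map_eq: "map (inv_into {..<n} s) (concat (replicate k [a, b])) = concat (replicate k [i, j])" for k
    by (induction k) (simp_all add: inv)
  show ?thesis
  proof (cases "i = j")
    case True
    then have "group.ord W (a \<otimes> b) = 1" using i ord[of i j] by (simp add: coxeter_matrix_def)
    then show ?thesis unfolding act_word_def map_eq using True i
      by (simp add: simple_reflection_involution cartan_diag)
  next
    case False
    then show ?thesis unfolding act_word_def map_eq using i ord[of i j]
      by (simp add: relator_act cartan_dihedral cartan_diag)
  qed
qed

lemma act_word_step:
  assumes "coxeter_step W S us vs"
  shows "act_word us = act_word vs \<and> even (length us + length vs)"
proof -
  from assms obtain xs ys a b where e: "a \<in> S" "b \<in> S"
    "us = xs @ concat (replicate (group.ord W (a \<otimes> b)) [a, b]) @ ys" "vs = xs @ ys"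
    by (auto simp: coxeter_step_def)
  have "act_word us x = act_word vs x" for x
    using act_word_relator[OF e(1,2)] by (simp add: e act_word_def act_append)
  moreover have "length (concat (replicate k [a, b])) = 2 * k" for k by (induction k) auto
  then have "even (length us + length vs)" by (simp add: e)
  ultimately show ?thesis by blast
qed

lemma act_word_equiv:
  assumes "equivclp (coxeter_step W S) us vs"
  shows "act_word us = act_word vs \<and> even (length us + length vs)"
  using assms
proof (induction rule: equivclp_induct)
  case (step y z)
  then have "act_word y = act_word z \<and> even (length y + length z)"
    using act_word_step[of y z] act_word_step[of z y] by (metis add.commute)
  then show ?case using step by auto
qed simp

lemma map_inv: "set us \<subseteq> {..<n} \<Longrightarrow> map (inv_into {..<n} s) (map s us) = us"
  using bij by (induction us) (auto simp: bij_betw_def inv_into_f_f)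

sublocale reflection_system W n s "\<lambda>i j. coxeter_matrix T (Suc i) (Suc j)" "cartan T"
proof (rule reflection_system.intro)
  show "group W" by (rule group_axioms)
  fix i j assume ij: "i < n" "j < n" "i \<noteq> j"
  show "word_prod W (map s (alt i j (coxeter_matrix T (Suc i) (Suc j)))) =
      word_prod W (map s (alt j i (coxeter_matrix T (Suc i) (Suc j))))"
  proof (rule braid_relation)
    show "(s i \<otimes> s j) [^] coxeter_matrix T (Suc i) (Suc j) = \<one>"
      using pow_ord_eq_1[of "s i \<otimes> s j"] ij by (simp add: ord s_in_carrier)
    show "coxeter_matrix T (Suc i) (Suc j) \<in> {2, 3, 4, 5}"
      by (rule coxeter_matrix_range) (use ij in simp)
    show "s k \<in> carrier W \<and> s k \<otimes> s k = \<one>" if "k \<in> {i, j}" for k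
      using that ij by (auto simp: s_in_carrier s_involution)
  qed
next
  fix us vs assume uv: "set us \<subseteq> {..<n}" "set vs \<subseteq> {..<n}"
    "word_prod W (map s us) = word_prod W (map s vs)"
  then have "map s us \<in> lists S" "map s vs \<in> lists S" by (auto intro!: s_S)
  then have "equivclp (coxeter_step W S) (map s us) (map s vs)"
    using cox uv by (auto simp: coxeter_system_def)
  then have "act_word (map s us) = act_word (map s vs) \<and> even (length (map s us) + length (map s vs))"
    by (rule act_word_equiv)
  then show "act (cartan T) us = act (cartan T) vs \<and> even (length us + length vs)"
    using uv(1,2) unfolding act_word_def map_inv[OF uv(1)] map_inv[OF uv(2)] by simp
qed (use s_in_carrier s_involution cartan_dihedral cartan_diag in auto)

lemma generate_eq: "I \<subseteq> {..<n} \<Longrightarrow> generate W (s ` I) = G I"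
proof (intro equalityI subsetI)
  assume I: "I \<subseteq> {..<n}"
  fix w assume "w \<in> generate W (s ` I)"
  then show "w \<in> G I"
  proof induction
    case (incl h) then show ?case using G_s I by auto
  next
    case (inv h) then show ?case using G_inv[OF I] G_s I by auto
  qed (use G_one G_mult[OF I] in auto)
next
  assume I: "I \<subseteq> {..<n}"
  fix w assume "w \<in> G I"
  then obtain us where us: "set us \<subseteq> I" "wp us = w" by (auto simp: G_def)
  have "wp us \<in> generate W (s ` I)"
    using us(1) by (induction us) (auto intro: generate.intros)
  then show "w \<in> generate W (s ` I)" using us by simp
qed

lemma coxeter_length_eq: "coxeter_length W S w = len {..<n} w"
proof -
  have S: "S = s ` {..<n}" using bij by (simp add: bij_betw_def)
  have "lists S = map s ` {us. set us \<subseteq> {..<n}}"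
    unfolding S lists_image unfolding lists_eq_set ..
  then have "(\<exists>ws\<in>lists S. length ws = k \<and> word_prod W ws = w) \<longleftrightarrow>
     (\<exists>us. set us \<subseteq> {..<n} \<and> length us = k \<and> wp us = w)" for k
    by (auto simp: wp_def)
  then show ?thesis by (simp add: coxeter_length_def len_def)
qed

lemma poincare_poly_eq:
  "I \<subseteq> {..<n} \<Longrightarrow> poincare_poly W S (s ` I) = (\<Sum>w\<in>G I. Polynomial.monom 1 (len {..<n} w))"
  by (simp add: poincare_poly_def generate_eq coxeter_length_eq)

end

lemma has_typeE:
  assumes "coxeter_system W S" "has_type W S T"
  obtains s where "exceptional W S T s"
proof -
  obtain s where s: "bij_betw s {1..type_rank T} S"
    "\<And>i j. i \<in> {1..type_rank T} \<Longrightarrow> j \<in> {1..type_rank T} \<Longrightarrow>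
       group.ord W (s i \<otimes>\<^bsub>W\<^esub> s j) = coxeter_matrix T i j"
    using assms(2) by (auto simp: has_type_def)
  have "bij_betw Suc {..<type_rank T} {1..type_rank T}"
    by (rule bij_betw_byWitness[where f' = "\<lambda>i. i - 1"]) auto
  from bij_betw_trans[OF this s(1)] have "bij_betw (\<lambda>i. s (Suc i)) {..<type_rank T} S"
    unfolding comp_def .
  then have "exceptional W S T (\<lambda>i. s (Suc i))"
    using s(2) assms(1) by (auto simp: exceptional_def)
  then show ?thesis by (rule that)
qed

section \<open>Poincare polynomials\<close>

datatype 'a tree = Leaf 'a | Node "'a tree" "'a tree"

fun look :: "'a tree \<Rightarrow> bool list \<Rightarrow> 'a" where
  "look (Leaf a) bs = a"
| "look (Node l r) [] = look l []"
| "look (Node l r) (b # bs) = look (if b then r else l) bs"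

fun prune :: "'a tree \<Rightarrow> 'a tree" where
  "prune (Leaf a) = Leaf a"
| "prune (Node (Leaf a) r) = Leaf a"
| "prune (Node l r) = Node (prune l) (prune r)"

text \<open>Entry \<open>bs\<close> lists the degrees of the parabolic subgroup generated by the simple reflections
  selected by \<open>bs\<close>.\<close>

definition degree_tree_E8 :: "nat list tree" where
  "degree_tree_E8 =
    Node (Node (Node (Node (Node (Node (Node (Node (Leaf []) (Leaf [2])) (Node (Leaf [2]) (Leaf [2, 3]))) (Node
    (Node (Leaf [2]) (Leaf [2, 2])) (Node (Leaf [2, 3]) (Leaf [2, 3, 4])))) (Node (Node (Node (Leaf [2]) (Leaf [2,
    2])) (Node (Leaf [2, 2]) (Leaf [2, 2, 3]))) (Node (Node (Leaf [2, 3]) (Leaf [2, 2, 3])) (Node (Leaf [2, 3, 4])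
    (Leaf [2, 3, 4, 5]))))) (Node (Node (Node (Node (Leaf [2]) (Leaf [2, 2])) (Node (Leaf [2, 2]) (Leaf [2, 2,
    3]))) (Node (Node (Leaf [2, 2]) (Leaf [2, 2, 2])) (Node (Leaf [2, 2, 3]) (Leaf [2, 2, 3, 4])))) (Node (Node
    (Node (Leaf [2, 3]) (Leaf [2, 2, 3])) (Node (Leaf [2, 2, 3]) (Leaf [2, 2, 3, 3]))) (Node (Node (Leaf [2, 3,
    4]) (Leaf [2, 2, 3, 4])) (Node (Leaf [2, 3, 4, 5]) (Leaf [2, 3, 4, 5, 6])))))) (Node (Node (Node (Node (Node
    (Leaf [2]) (Leaf [2, 2])) (Node (Leaf [2, 2]) (Leaf [2, 2, 3]))) (Node (Node (Leaf [2, 2]) (Leaf [2, 2, 2]))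
    (Node (Leaf [2, 2, 3]) (Leaf [2, 2, 3, 4])))) (Node (Node (Node (Leaf [2, 2]) (Leaf [2, 2, 2])) (Node (Leaf
    [2, 2, 2]) (Leaf [2, 2, 2, 3]))) (Node (Node (Leaf [2, 2, 3]) (Leaf [2, 2, 2, 3])) (Node (Leaf [2, 2, 3, 4])
    (Leaf [2, 2, 3, 4, 5]))))) (Node (Node (Node (Node (Leaf [2, 3]) (Leaf [2, 2, 3])) (Node (Leaf [2, 2, 3])
    (Leaf [2, 2, 3, 3]))) (Node (Node (Leaf [2, 2, 3]) (Leaf [2, 2, 2, 3])) (Node (Leaf [2, 2, 3, 3]) (Leaf [2, 2,
    3, 3, 4])))) (Node (Node (Node (Leaf [2, 3, 4]) (Leaf [2, 2, 3, 4])) (Node (Leaf [2, 2, 3, 4]) (Leaf [2, 2, 3,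
    3, 4]))) (Node (Node (Leaf [2, 3, 4, 5]) (Leaf [2, 2, 3, 4, 5])) (Node (Leaf [2, 3, 4, 5, 6]) (Leaf [2, 3, 4,
    5, 6, 7]))))))) (Node (Node (Node (Node (Node (Node (Leaf [2]) (Leaf [2, 2])) (Node (Leaf [2, 2]) (Leaf [2, 2,
    3]))) (Node (Node (Leaf [2, 2]) (Leaf [2, 2, 2])) (Node (Leaf [2, 2, 3]) (Leaf [2, 2, 3, 4])))) (Node (Node
    (Node (Leaf [2, 2]) (Leaf [2, 2, 2])) (Node (Leaf [2, 2, 2]) (Leaf [2, 2, 2, 3]))) (Node (Node (Leaf [2, 2,
    3]) (Leaf [2, 2, 2, 3])) (Node (Leaf [2, 2, 3, 4]) (Leaf [2, 2, 3, 4, 5]))))) (Node (Node (Node (Node (Leaf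
    [2, 3]) (Leaf [2, 2, 3])) (Node (Leaf [2, 2, 3]) (Leaf [2, 2, 3, 3]))) (Node (Node (Leaf [2, 2, 3]) (Leaf [2,
    2, 2, 3])) (Node (Leaf [2, 2, 3, 3]) (Leaf [2, 2, 3, 3, 4])))) (Node (Node (Node (Leaf [2, 3, 4]) (Leaf [2, 2,
    3, 4])) (Node (Leaf [2, 2, 3, 4]) (Leaf [2, 2, 3, 3, 4]))) (Node (Node (Leaf [2, 3, 4, 5]) (Leaf [2, 2, 3, 4,
    5])) (Node (Leaf [2, 3, 4, 5, 6]) (Leaf [2, 3, 4, 5, 6, 7])))))) (Node (Node (Node (Node (Node (Leaf [2, 2])
    (Leaf [2, 2, 2])) (Node (Leaf [2, 2, 2]) (Leaf [2, 2, 2, 3]))) (Node (Node (Leaf [2, 2, 2]) (Leaf [2, 2, 2,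
    2])) (Node (Leaf [2, 2, 2, 3]) (Leaf [2, 2, 2, 3, 4])))) (Node (Node (Node (Leaf [2, 2, 2]) (Leaf [2, 2, 2,
    2])) (Node (Leaf [2, 2, 2, 2]) (Leaf [2, 2, 2, 2, 3]))) (Node (Node (Leaf [2, 2, 2, 3]) (Leaf [2, 2, 2, 2,
    3])) (Node (Leaf [2, 2, 2, 3, 4]) (Leaf [2, 2, 2, 3, 4, 5]))))) (Node (Node (Node (Node (Leaf [2, 3, 4]) (Leaf
    [2, 2, 3, 4])) (Node (Leaf [2, 2, 3, 4]) (Leaf [2, 2, 3, 3, 4]))) (Node (Node (Leaf [2, 2, 3, 4]) (Leaf [2, 2,
    2, 3, 4])) (Node (Leaf [2, 2, 3, 3, 4]) (Leaf [2, 2, 3, 3, 4, 4])))) (Node (Node (Node (Leaf [2, 4, 4, 6])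
    (Leaf [2, 2, 4, 4, 6])) (Node (Leaf [2, 2, 4, 4, 6]) (Leaf [2, 2, 3, 4, 4, 6]))) (Node (Node (Leaf [2, 4, 5,
    6, 8]) (Leaf [2, 2, 4, 5, 6, 8])) (Node (Leaf [2, 4, 6, 6, 8, 10]) (Leaf [2, 4, 6, 7, 8, 10, 12])))))))) (Node
    (Node (Node (Node (Node (Node (Node (Leaf [2]) (Leaf [2, 2])) (Node (Leaf [2, 2]) (Leaf [2, 2, 3]))) (Node
    (Node (Leaf [2, 2]) (Leaf [2, 2, 2])) (Node (Leaf [2, 2, 3]) (Leaf [2, 2, 3, 4])))) (Node (Node (Node (Leaf
    [2, 2]) (Leaf [2, 2, 2])) (Node (Leaf [2, 2, 2]) (Leaf [2, 2, 2, 3]))) (Node (Node (Leaf [2, 2, 3]) (Leaf [2,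
    2, 2, 3])) (Node (Leaf [2, 2, 3, 4]) (Leaf [2, 2, 3, 4, 5]))))) (Node (Node (Node (Node (Leaf [2, 2]) (Leaf
    [2, 2, 2])) (Node (Leaf [2, 2, 2]) (Leaf [2, 2, 2, 3]))) (Node (Node (Leaf [2, 2, 2]) (Leaf [2, 2, 2, 2]))
    (Node (Leaf [2, 2, 2, 3]) (Leaf [2, 2, 2, 3, 4])))) (Node (Node (Node (Leaf [2, 2, 3]) (Leaf [2, 2, 2, 3]))
    (Node (Leaf [2, 2, 2, 3]) (Leaf [2, 2, 2, 3, 3]))) (Node (Node (Leaf [2, 2, 3, 4]) (Leaf [2, 2, 2, 3, 4]))
    (Node (Leaf [2, 2, 3, 4, 5]) (Leaf [2, 2, 3, 4, 5, 6])))))) (Node (Node (Node (Node (Node (Leaf [2, 3]) (Leaf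
    [2, 2, 3])) (Node (Leaf [2, 2, 3]) (Leaf [2, 2, 3, 3]))) (Node (Node (Leaf [2, 2, 3]) (Leaf [2, 2, 2, 3]))
    (Node (Leaf [2, 2, 3, 3]) (Leaf [2, 2, 3, 3, 4])))) (Node (Node (Node (Leaf [2, 2, 3]) (Leaf [2, 2, 2, 3]))
    (Node (Leaf [2, 2, 2, 3]) (Leaf [2, 2, 2, 3, 3]))) (Node (Node (Leaf [2, 2, 3, 3]) (Leaf [2, 2, 2, 3, 3]))
    (Node (Leaf [2, 2, 3, 3, 4]) (Leaf [2, 2, 3, 3, 4, 5]))))) (Node (Node (Node (Node (Leaf [2, 3, 4]) (Leaf [2,
    2, 3, 4])) (Node (Leaf [2, 2, 3, 4]) (Leaf [2, 2, 3, 3, 4]))) (Node (Node (Leaf [2, 2, 3, 4]) (Leaf [2, 2, 2,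
    3, 4])) (Node (Leaf [2, 2, 3, 3, 4]) (Leaf [2, 2, 3, 3, 4, 4])))) (Node (Node (Node (Leaf [2, 3, 4, 5]) (Leaf
    [2, 2, 3, 4, 5])) (Node (Leaf [2, 2, 3, 4, 5]) (Leaf [2, 2, 3, 3, 4, 5]))) (Node (Node (Leaf [2, 3, 4, 5, 6])
    (Leaf [2, 2, 3, 4, 5, 6])) (Node (Leaf [2, 3, 4, 5, 6, 7]) (Leaf [2, 3, 4, 5, 6, 7, 8]))))))) (Node (Node
    (Node (Node (Node (Node (Leaf [2, 2]) (Leaf [2, 2, 2])) (Node (Leaf [2, 2, 2]) (Leaf [2, 2, 2, 3]))) (Node
    (Node (Leaf [2, 2, 2]) (Leaf [2, 2, 2, 2])) (Node (Leaf [2, 2, 2, 3]) (Leaf [2, 2, 2, 3, 4])))) (Node (Node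
    (Node (Leaf [2, 2, 2]) (Leaf [2, 2, 2, 2])) (Node (Leaf [2, 2, 2, 2]) (Leaf [2, 2, 2, 2, 3]))) (Node (Node
    (Leaf [2, 2, 2, 3]) (Leaf [2, 2, 2, 2, 3])) (Node (Leaf [2, 2, 2, 3, 4]) (Leaf [2, 2, 2, 3, 4, 5]))))) (Node
    (Node (Node (Node (Leaf [2, 2, 3]) (Leaf [2, 2, 2, 3])) (Node (Leaf [2, 2, 2, 3]) (Leaf [2, 2, 2, 3, 3])))
    (Node (Node (Leaf [2, 2, 2, 3]) (Leaf [2, 2, 2, 2, 3])) (Node (Leaf [2, 2, 2, 3, 3]) (Leaf [2, 2, 2, 3, 3,
    4])))) (Node (Node (Node (Leaf [2, 2, 3, 4]) (Leaf [2, 2, 2, 3, 4])) (Node (Leaf [2, 2, 2, 3, 4]) (Leaf [2, 2,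
    2, 3, 3, 4]))) (Node (Node (Leaf [2, 2, 3, 4, 5]) (Leaf [2, 2, 2, 3, 4, 5])) (Node (Leaf [2, 2, 3, 4, 5, 6])
    (Leaf [2, 2, 3, 4, 5, 6, 7])))))) (Node (Node (Node (Node (Node (Leaf [2, 2, 3]) (Leaf [2, 2, 2, 3])) (Node
    (Leaf [2, 2, 2, 3]) (Leaf [2, 2, 2, 3, 3]))) (Node (Node (Leaf [2, 2, 2, 3]) (Leaf [2, 2, 2, 2, 3])) (Node
    (Leaf [2, 2, 2, 3, 3]) (Leaf [2, 2, 2, 3, 3, 4])))) (Node (Node (Node (Leaf [2, 2, 2, 3]) (Leaf [2, 2, 2, 2,
    3])) (Node (Leaf [2, 2, 2, 2, 3]) (Leaf [2, 2, 2, 2, 3, 3]))) (Node (Node (Leaf [2, 2, 2, 3, 3]) (Leaf [2, 2,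
    2, 2, 3, 3])) (Node (Leaf [2, 2, 2, 3, 3, 4]) (Leaf [2, 2, 2, 3, 3, 4, 5]))))) (Node (Node (Node (Node (Leaf
    [2, 3, 4, 5]) (Leaf [2, 2, 3, 4, 5])) (Node (Leaf [2, 2, 3, 4, 5]) (Leaf [2, 2, 3, 3, 4, 5]))) (Node (Node
    (Leaf [2, 2, 3, 4, 5]) (Leaf [2, 2, 2, 3, 4, 5])) (Node (Leaf [2, 2, 3, 3, 4, 5]) (Leaf [2, 2, 3, 3, 4, 4,
    5])))) (Node (Node (Node (Leaf [2, 4, 5, 6, 8]) (Leaf [2, 2, 4, 5, 6, 8])) (Node (Leaf [2, 2, 4, 5, 6, 8])
    (Leaf [2, 2, 3, 4, 5, 6, 8]))) (Node (Node (Leaf [2, 5, 6, 8, 9, 12]) (Leaf [2, 2, 5, 6, 8, 9, 12])) (Node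
    (Leaf [2, 6, 8, 10, 12, 14, 18]) (Leaf [2, 8, 12, 14, 18, 20, 24, 30]))))))))"

definition degree_tree_H4 :: "nat list tree" where
  "degree_tree_H4 =
    Node (Node (Node (Node (Leaf []) (Leaf [2])) (Node (Leaf [2]) (Leaf [2, 3]))) (Node (Node (Leaf [2]) (Leaf [2,
    2])) (Node (Leaf [2, 3]) (Leaf [2, 3, 4])))) (Node (Node (Node (Leaf [2]) (Leaf [2, 2])) (Node (Leaf [2, 2])
    (Leaf [2, 2, 3]))) (Node (Node (Leaf [2, 5]) (Leaf [2, 2, 5])) (Node (Leaf [2, 6, 10]) (Leaf [2, 12, 20,
    30]))))"

definition degree_tree_F4 :: "nat list tree" where
  "degree_tree_F4 =
    Node (Node (Node (Node (Leaf []) (Leaf [2])) (Node (Leaf [2]) (Leaf [2, 3]))) (Node (Node (Leaf [2]) (Leaf [2,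
    2])) (Node (Leaf [2, 4]) (Leaf [2, 4, 6])))) (Node (Node (Node (Leaf [2]) (Leaf [2, 2])) (Node (Leaf [2, 2])
    (Leaf [2, 2, 3]))) (Node (Node (Leaf [2, 3]) (Leaf [2, 2, 3])) (Node (Leaf [2, 4, 6]) (Leaf [2, 6, 8, 12]))))"

fun degree_tree :: "exceptional_type \<Rightarrow> nat list tree" where
  "degree_tree E8 = degree_tree_E8"
| "degree_tree E7 = prune degree_tree_E8"
| "degree_tree E6 = prune (prune degree_tree_E8)"
| "degree_tree F4 = degree_tree_F4"
| "degree_tree H4 = degree_tree_H4"
| "degree_tree H3 = prune degree_tree_H4"

section \<open>Enumeration of orbits of fundamental weights\<close>

definition lrefl :: "gold list \<Rightarrow> nat \<Rightarrow> gold list \<Rightarrow> gold list" where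
  "lrefl row i v = map2 (\<lambda>c x. if c = (0, 0) then x else gsub x (gmul c (v ! i))) row v"

definition next_level :: "(nat \<times> gold list) list \<Rightarrow> gold list list \<Rightarrow> gold list list" where
  "next_level rows L = remdups (concat (map (\<lambda>v. map (\<lambda>(i, row). lrefl row i v)
      (filter (\<lambda>(i, row). gpos (v ! i)) rows)) L))"

text \<open>Integers are evaluated in binary, natural numbers in unary.\<close>

primrec int_length :: "'a list \<Rightarrow> int" where
  "int_length [] = 0"
| "int_length (x # xs) = int_length xs + 1"

text \<open>\<open>f\<close> is fuel. The value 60 used in the check suffices: the longest
  enumeration, E8 modulo E7, has top length 120 - 63 = 57 (the difference of the numbers of positive
  roots) and hence 58 levels.\<close>

fun level_sizes :: "(nat \<times> gold list) list \<Rightarrow> nat \<Rightarrow> gold list list \<Rightarrow> int list" where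
  "level_sizes rows 0 L = []"
| "level_sizes rows (Suc f) L =
     (if L = [] then [] else int_length L # level_sizes rows f (next_level rows L))"

definition parabolic_rows :: "exceptional_type \<Rightarrow> bool list \<Rightarrow> (nat \<times> gold list) list" where
  "parabolic_rows T bs = map (\<lambda>i. (i, cartan_row T i)) (filter (\<lambda>i. bs ! i) [0..<type_rank T])"

definition fundamental_weight :: "nat \<Rightarrow> nat \<Rightarrow> gold list" where
  "fundamental_weight n a = map (\<lambda>j. if j = a then (1, 0) else (0, 0)) [0..<n]"

definition mult_one_minus :: "nat \<Rightarrow> int list \<Rightarrow> int list" where
  "mult_one_minus m p = map2 (-) (p @ replicate m 0) (replicate m 0 @ p)"

text \<open>The quotient of the Poincare polynomials of a parabolic subgroup and of the parabolic subgroup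
  without the last generator is read off the orbit of a fundamental weight; the common factors of
  the two products of degrees are cancelled first to keep the numbers small.\<close>

definition poincare_check :: "exceptional_type \<Rightarrow> nat list tree \<Rightarrow> bool list \<Rightarrow> bool" where
  "poincare_check T t bs =
     (let ks = filter (\<lambda>i. bs ! i) [0..<type_rank T]; D = look t bs in
      if ks = [] then D = []
      else
        let a = last ks; E = look t (bs[a := False]);
            xs = level_sizes (parabolic_rows T bs) 60 [fundamental_weight (type_rank T) a] in
        length xs < 60 \<and> length D = Suc (length E) \<and>
        fold mult_one_minus (1 # fold remove1 D E) xs = fold mult_one_minus (fold remove1 E D) [1])"

definition poincare_checks :: "exceptional_type \<Rightarrow> bool" where
  "poincare_checks T = (let t = degree_tree T in list_all (poincare_check T t) (cube (type_rank T)))"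

definition vec_of :: "gold list \<Rightarrow> nat \<Rightarrow> real" where
  "vec_of v = (\<lambda>j. if j < length v then gval (v ! j) else 0)"

lemma vec_of_inject: "length v = length w \<Longrightarrow> vec_of v = vec_of w \<Longrightarrow> v = w"
proof (rule nth_equalityI)
  fix j assume "length v = length w" "vec_of v = vec_of w" "j < length v"
  then have "gval (v ! j) = gval (w ! j)" by (auto simp: vec_of_def dest: fun_cong[of _ _ j])
  then show "v ! j = w ! j" by (simp add: gval_inject)
qed

lemma vec_of_lrefl:
  assumes "length v = type_rank T" "i < type_rank T"
  shows "vec_of (lrefl (cartan_row T i) i v) = simple_reflection (cartan T) i (vec_of v)"
proof
  fix j
  have "gval (if c = (0, 0) then y else gsub y (gmul c z)) = gval y - gval c * gval z" for c y z
    by (simp add: gval_gsub gval_gmul)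
  then show "vec_of (lrefl (cartan_row T i) i v) j = simple_reflection (cartan T) i (vec_of v) j"
    using assms by (simp add: vec_of_def lrefl_def simple_reflection_def cartan_def cartan_row_def)
qed

lemma length_lrefl: "length v = type_rank T \<Longrightarrow> length (lrefl (cartan_row T i) i v) = type_rank T"
  by (simp add: lrefl_def cartan_row_def)

definition idx :: "bool list \<Rightarrow> nat set" where
  "idx bs = {i. i < length bs \<and> bs ! i}"

lemma next_level:
  assumes "length bs = type_rank T" "\<forall>v\<in>set L. length v = type_rank T"
    "vec_of ` set L = orbit_level (cartan T) (idx bs) x k"
  shows "vec_of ` set (next_level (parabolic_rows T bs) L) = orbit_level (cartan T) (idx bs) x (Suc k)"
    and "\<forall>v\<in>set (next_level (parabolic_rows T bs) L). length v = type_rank T"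
proof -
  have set: "set (next_level (parabolic_rows T bs) L) =
      {lrefl (cartan_row T i) i v | i v. i \<in> idx bs \<and> v \<in> set L \<and> gpos (v ! i)}"
    using assms(1) by (auto simp: next_level_def parabolic_rows_def idx_def image_iff; blast)
  show "\<forall>v\<in>set (next_level (parabolic_rows T bs) L). length v = type_rank T"
    using assms(2) by (auto simp: set length_lrefl)
  have pos: "gpos (v ! i) \<longleftrightarrow> vec_of v i > 0" if "v \<in> set L" "i \<in> idx bs" for v i
    using that assms(1,2) by (simp add: vec_of_def idx_def gpos_iff)
  have "vec_of ` set (next_level (parabolic_rows T bs) L) =
      {simple_reflection (cartan T) i (vec_of v) | i v. i \<in> idx bs \<and> v \<in> set L \<and> vec_of v i > 0}"
    (is "?A = ?B")
  proof (intro equalityI subsetI)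
    fix y assume "y \<in> ?A"
    then obtain i v where v: "i \<in> idx bs" "v \<in> set L" "gpos (v ! i)" "y = vec_of (lrefl (cartan_row T i) i v)"
      unfolding set by blast
    then have "y = simple_reflection (cartan T) i (vec_of v)"
      using assms(1,2) by (simp add: vec_of_lrefl idx_def)
    then show "y \<in> ?B" using v pos by blast
  next
    fix y assume "y \<in> ?B"
    then obtain i v where v: "i \<in> idx bs" "v \<in> set L" "vec_of v i > 0" "y = simple_reflection (cartan T) i (vec_of v)"
      by blast
    then have "y = vec_of (lrefl (cartan_row T i) i v)"
      using assms(1,2) by (simp add: vec_of_lrefl idx_def)
    then show "y \<in> ?A" unfolding set using v pos by blast
  qed
  also have "\<dots> = {simple_reflection (cartan T) i y | i y. i \<in> idx bs \<and> y \<in> vec_of ` set L \<and> y i > 0}" by blast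
  finally show "vec_of ` set (next_level (parabolic_rows T bs) L) = orbit_level (cartan T) (idx bs) x (Suc k)"
    by (simp add: assms(3))
qed

lemma int_length: "int_length xs = int (length xs)"
  by (induction xs) simp_all

text \<open>A result shorter than the fuel means that the enumeration stopped at an empty level, so
  the sizes describe the whole orbit.\<close>

lemma level_sizes:
  assumes "length bs = type_rank T" "\<forall>v\<in>set L. length v = type_rank T" "distinct L"
    "vec_of ` set L = orbit_level (cartan T) (idx bs) x k"
    "length (level_sizes (parabolic_rows T bs) f L) < f"
  shows "level_sizes (parabolic_rows T bs) f L =
       map (\<lambda>j. int (card (orbit_level (cartan T) (idx bs) x (k + j)))) [0..<length (level_sizes (parabolic_rows T bs) f L)] \<and>
     orbit_level (cartan T) (idx bs) x (k + length (level_sizes (parabolic_rows T bs) f L)) = {}"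
  using assms(2-)
proof (induction f arbitrary: L k)
  case (Suc f)
  show ?case
  proof (cases "L = []")
    case True
    then show ?thesis using Suc.prems by simp
  next
    case False
    let ?L = "next_level (parabolic_rows T bs) L" and ?s = "level_sizes (parabolic_rows T bs) f (next_level (parabolic_rows T bs) L)"
    have "distinct ?L" by (simp add: next_level_def)
    then have IH: "?s = map (\<lambda>j. int (card (orbit_level (cartan T) (idx bs) x (Suc k + j)))) [0..<length ?s] \<and>
        orbit_level (cartan T) (idx bs) x (Suc k + length ?s) = {}"
      using next_level[OF assms(1) Suc.prems(1,3)] Suc.prems False by (intro Suc.IH) simp_all
    have "inj_on vec_of (set L)" using vec_of_inject Suc.prems(1) by (intro inj_onI) simp
    then have "int (card (orbit_level (cartan T) (idx bs) x k)) = int_length L"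
      using Suc.prems by (simp add: card_image distinct_card int_length flip: Suc.prems(3))
    moreover have "[0..<Suc l] = 0 # map Suc [0..<l]" for l
      by (simp only: map_Suc_upt upt_conv_Cons zero_less_Suc)
    ultimately have "level_sizes (parabolic_rows T bs) (Suc f) L =
       map (\<lambda>j. int (card (orbit_level (cartan T) (idx bs) x (k + j)))) [0..<Suc (length ?s)]"
      using False IH by (simp add: comp_def del: orbit_level.simps upt_Suc)
    then show ?thesis using False IH by (simp del: orbit_level.simps upt_Suc)
  qed
qed simp

section \<open>Orbit counts as quotients of products of q-numbers\<close>

definition ipoly :: "int list \<Rightarrow> rat poly" where
  "ipoly xs = Poly (map of_int xs)"

lemma coeff_ipoly: "poly.coeff (ipoly xs) i = (if i < length xs then of_int (xs ! i) else 0)"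
  by (simp add: ipoly_def nth_default_def)

lemma ipoly_mult_one_minus: "ipoly (mult_one_minus m p) = ipoly p * (1 - Polynomial.monom 1 m)"
proof (rule poly_eqI)
  fix i
  have "poly.coeff (ipoly p * (1 - Polynomial.monom 1 m)) i =
      poly.coeff (ipoly p) i - poly.coeff (Polynomial.monom 1 m * ipoly p) i"
    by (simp add: algebra_simps)
  also have "\<dots> = poly.coeff (ipoly p) i - (if i < m then 0 else poly.coeff (ipoly p) (i - m))"
    by (simp add: coeff_monom_mult)
  also have "\<dots> = poly.coeff (ipoly (mult_one_minus m p)) i"
    by (auto simp: coeff_ipoly mult_one_minus_def nth_append)
  finally show "poly.coeff (ipoly (mult_one_minus m p)) i = poly.coeff (ipoly p * (1 - Polynomial.monom 1 m)) i" ..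
qed

lemma ipoly_fold_mult_one_minus:
  "ipoly (fold mult_one_minus ms p) = ipoly p * (\<Prod>m\<leftarrow>ms. 1 - Polynomial.monom 1 m)"
  by (induction ms arbitrary: p) (simp_all add: ipoly_mult_one_minus algebra_simps)

lemma mset_fold_remove1: "mset (fold remove1 ys xs) = mset xs - mset ys"
  by (induction ys arbitrary: xs) simp_all

definition qnum :: "nat \<Rightarrow> rat poly" where
  "qnum m = (\<Sum>i<m. Polynomial.monom 1 i)"

lemma qnum: "qnum m * (1 - Polynomial.monom 1 1) = 1 - Polynomial.monom 1 m"
proof (induction m)
  case (Suc m)
  have "qnum (Suc m) * (1 - Polynomial.monom 1 1) =
      qnum m * (1 - Polynomial.monom 1 1) + Polynomial.monom 1 m * (1 - Polynomial.monom 1 1)"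
    by (simp add: qnum_def algebra_simps)
  also have "\<dots> = 1 - Polynomial.monom 1 (Suc m)"
    unfolding Suc by (simp add: algebra_simps mult_monom)
  finally show ?case .
qed (simp add: qnum_def)

lemma one_minus_X_nonzero: "(1 - Polynomial.monom 1 1 :: rat poly) \<noteq> 0"
proof
  assume "(1 - Polynomial.monom 1 1 :: rat poly) = 0"
  then have "poly.coeff (1 - Polynomial.monom 1 1 :: rat poly) 0 = 0" by simp
  then show False by simp
qed

lemma prod_qnum:
  "(\<Prod>m\<leftarrow>ms. qnum m) * (1 - Polynomial.monom 1 1) ^ length ms = (\<Prod>m\<leftarrow>ms. 1 - Polynomial.monom 1 m)"
proof (induction ms)
  case (Cons m ms)
  have "(\<Prod>m\<leftarrow>m # ms. qnum m) * (1 - Polynomial.monom 1 1) ^ length (m # ms) =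
     (qnum m * (1 - Polynomial.monom 1 1)) * ((\<Prod>m\<leftarrow>ms. qnum m) * (1 - Polynomial.monom 1 1) ^ length ms)"
    by (simp add: algebra_simps)
  then show ?case unfolding qnum Cons by simp
qed simp

text \<open>Each q-number is \<open>1 - q^m\<close> over \<open>1 - q\<close>. As \<open>D\<close>
  has one degree more than \<open>E\<close>, clearing denominators leaves one factor
  \<open>1 - q\<close>, the entry \<open>1\<close> put in front. The check compares the multiset
  differences; the common part is multiplied back here.\<close>

lemma qnum_quotient:
  assumes "fold mult_one_minus (1 # fold remove1 D E) xs = fold mult_one_minus (fold remove1 E D) [1]"
    "length D = Suc (length E)"
  shows "ipoly xs * (\<Prod>m\<leftarrow>E. qnum m) = (\<Prod>m\<leftarrow>D. qnum m)"
proof -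
  let ?X = "1 - Polynomial.monom 1 1 :: rat poly"
  let ?f = "\<lambda>m. 1 - Polynomial.monom 1 m :: rat poly"
  have split: "(\<Prod>m\<leftarrow>A. ?f m) = (\<Prod>m\<leftarrow>fold remove1 B A. ?f m) * (\<Prod>m\<in>#mset A \<inter># mset B. ?f m)" for A B
  proof -
    have list: "(\<Prod>m\<leftarrow>C. ?f m) = (\<Prod>m\<in>#mset C. ?f m)" for C
      by (simp add: prod_mset_prod_list flip: mset_map)
    have "mset A = mset (fold remove1 B A) + (mset A \<inter># mset B)"
      unfolding mset_fold_remove1 by (rule multiset_eqI) simp
    then have "(\<Prod>m\<in>#mset A. ?f m) = (\<Prod>m\<in>#mset (fold remove1 B A) + (mset A \<inter># mset B). ?f m)"
      by (rule arg_cong)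
    then show ?thesis unfolding list by simp
  qed
  have "ipoly xs * (?X * (\<Prod>m\<leftarrow>fold remove1 D E. ?f m)) = (\<Prod>m\<leftarrow>fold remove1 E D. ?f m)"
    using arg_cong[OF assms(1), of ipoly] unfolding ipoly_fold_mult_one_minus
    by (simp add: ipoly_def one_pCons)
  then have "ipoly xs * (?X * (\<Prod>m\<leftarrow>fold remove1 D E. ?f m)) * (\<Prod>m\<in>#mset D \<inter># mset E. ?f m) =
      (\<Prod>m\<leftarrow>fold remove1 E D. ?f m) * (\<Prod>m\<in>#mset D \<inter># mset E. ?f m)"
    by (simp only:)
  moreover have "mset E \<inter># mset D = mset D \<inter># mset E"
    by (rule multiset_eqI) (simp add: min.commute)
  ultimately have "ipoly xs * ?X * (\<Prod>m\<leftarrow>E. ?f m) = (\<Prod>m\<leftarrow>D. ?f m)"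
    unfolding split[of E D] split[of D E] by (simp only: mult_ac)
  then have "(ipoly xs * (\<Prod>m\<leftarrow>E. qnum m)) * ?X ^ length D = (\<Prod>m\<leftarrow>D. qnum m) * ?X ^ length D"
    unfolding prod_qnum[symmetric] by (simp add: assms(2) algebra_simps)
  then show ?thesis using one_minus_X_nonzero by simp
qed

context exceptional
begin

interpretation group W using cox by (simp add: coxeter_system_def)

lemma idx_subset: "length bs = n \<Longrightarrow> idx bs \<subseteq> {..<n}"
  by (auto simp: idx_def)

text \<open>Induction on the number of generators: the last one, \<open>a\<close>, is removed, and
  the quotient of the two Poincare polynomials is the orbit count that the check has compared with
  the table.\<close>

theorem poincare_parabolic:
  assumes "poincare_checks T" "length bs = n"
  shows "finite (G (idx bs))"
    and "poincare_poly W S (s ` idx bs) = (\<Prod>m\<leftarrow>look (degree_tree T) bs. qnum m)"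
proof -
  have check: "poincare_check T (degree_tree T) cs" if "length cs = n" for cs
    using assms(1) that by (auto simp: poincare_checks_def list_all_iff set_cube Let_def)
  have "finite (G (idx bs)) \<and>
     (\<Sum>w\<in>G (idx bs). Polynomial.monom 1 (len {..<n} w)) = (\<Prod>m\<leftarrow>look (degree_tree T) bs. qnum m)"
    using assms(2)
  proof (induction "card (idx bs)" arbitrary: bs rule: less_induct)
    case less
    define ks where "ks = filter (\<lambda>i. bs ! i) [0..<n]"
    have set_ks: "set ks = idx bs" using less.prems by (auto simp: ks_def idx_def)
    show ?case
    proof (cases "ks = []")
      case True
      then have I: "idx bs = {}" using set_ks by simp
      have "look (degree_tree T) bs = []"
        using check[OF less.prems] True by (simp add: poincare_check_def ks_def Let_def)
      moreover have "G {} = {\<one>}" by (simp add: G_def)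
      ultimately show ?thesis by (simp add: I)
    next
      case False
      define a where "a = last ks"
      define cs where "cs = bs[a := False]"
      define xs where "xs = level_sizes (parabolic_rows T bs) 60 [fundamental_weight n a]"
      have a: "a < n" "bs ! a" "a \<in> idx bs"
        using last_in_set[OF False] set_ks less.prems by (auto simp: a_def idx_def)
      have cs: "length cs = n" "idx cs = idx bs - {a}"
        using less.prems a by (auto simp: cs_def idx_def nth_list_update)
      have c: "length xs < 60" "length (look (degree_tree T) bs) = Suc (length (look (degree_tree T) cs))"
        "fold mult_one_minus (1 # fold remove1 (look (degree_tree T) bs) (look (degree_tree T) cs)) xs =
         fold mult_one_minus (fold remove1 (look (degree_tree T) cs) (look (degree_tree T) bs)) [1]"
        using check[OF less.prems] False
        by (simp_all add: poincare_check_def Let_def ks_def[symmetric] a_def[symmetric] cs_def[symmetric] xs_def[symmetric] del: fold_simps)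
      \<comment> \<open>The fundamental weight of \<open>a\<close> vanishes on all other simple
        roots, so its stabilizer is generated by the remaining reflections.\<close>
      define x :: "nat \<Rightarrow> real" where "x = vec_of (fundamental_weight n a)"
      have x: "x j = (if j = a then 1 else 0)" for j
        using a by (simp add: x_def vec_of_def fundamental_weight_def)
      have J: "idx cs = {i \<in> idx bs. x i = 0}" by (auto simp: cs x)
      have "xs = map (\<lambda>j. int (card (orbit_level (cartan T) (idx bs) x (0 + j)))) [0..<length xs] \<and>
          orbit_level (cartan T) (idx bs) x (0 + length xs) = {}"
        unfolding xs_def
        by (rule level_sizes) (use less.prems c(1) in \<open>simp_all add: x_def fundamental_weight_def xs_def\<close>)
      then have lv: "xs = map (\<lambda>j. int (card (orbit_level (cartan T) (idx bs) x j))) [0..<length xs]"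
        "orbit_level (cartan T) (idx bs) x (length xs) = {}" by simp_all
      have nth: "xs ! j = int (card (orbit_level (cartan T) (idx bs) x j))" if "j < length xs" for j
        using arg_cong[OF lv(1), of "\<lambda>ys. ys ! j"] that by simp
      have ip: "ipoly xs = (\<Sum>k<length xs. Polynomial.monom (of_nat (card (orbit_level (cartan T) (idx bs) x k))) k)"
        by (rule poly_eqI) (auto simp: coeff_ipoly coeff_sum nth)
      have IH: "finite (G (idx cs)) \<and>
         (\<Sum>w\<in>G (idx cs). Polynomial.monom 1 (len {..<n} w)) = (\<Prod>m\<leftarrow>look (degree_tree T) cs. qnum m)"
      proof (rule less.hyps)
        show "card (idx cs) < card (idx bs)"
          unfolding cs(2) using a finite_subset[OF idx_subset[OF less.prems]] by (intro card_Diff1_less) auto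
      qed (rule cs)
      have dom: "dominant (idx bs) x" by (simp add: dominant_def x)
      note step = poincare_step[OF idx_subset[OF less.prems] dom J lv(2)]
      show ?thesis
        using step IH qnum_quotient[OF c(3,2)] by (simp add: ip)
    qed
  qed
  then show "finite (G (idx bs))" "poincare_poly W S (s ` idx bs) = (\<Prod>m\<leftarrow>look (degree_tree T) bs. qnum m)"
    using poincare_poly_eq[OF idx_subset[OF assms(2)]] by simp_all
qed

end

lemma poincare_checks_H3: "poincare_checks H3" by code_simp
lemma poincare_checks_F4: "poincare_checks F4" by code_simp
lemma poincare_checks_H4: "poincare_checks H4" by code_simp
lemma poincare_checks_E6: "poincare_checks E6" by code_simp
lemma poincare_checks_E7: "poincare_checks E7" by code_simp
lemma poincare_checks_E8: "poincare_checks E8" by code_simp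

section \<open>Cyclotomic polynomials\<close>

abbreviation X_pow_minus_1 :: "nat \<Rightarrow> rat poly" where
  "X_pow_minus_1 n \<equiv> Polynomial.monom 1 n - 1"

text \<open>Separability: a common factor divides the polynomial and its derivative, hence both
  \<open>X^n - 1\<close> and \<open>X^n\<close>.\<close>

lemma coprime_factors_X_pow_minus_1:
  assumes "u * v = X_pow_minus_1 n" "n \<ge> 1"
  shows "coprime u v"
proof (rule coprimeI)
  fix r assume r: "r dvd u" "r dvd v"
  have "pderiv (u * v) = u * pderiv v + v * pderiv u" by (simp add: pderiv_mult)
  then have "r dvd pderiv (u * v)" using r by (simp add: dvd_add dvd_mult2)
  then have "r dvd Polynomial.monom (of_nat n) (n - 1)" by (simp add: assms(1) pderiv_diff pderiv_monom)
  then have "r dvd Polynomial.monom (1 / of_nat n) 1 * Polynomial.monom (of_nat n) (n - 1)" by (rule dvd_mult)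
  also have "\<dots> = Polynomial.monom 1 n" using assms(2) by (simp add: mult_monom)
  finally have "r dvd Polynomial.monom 1 n" .
  moreover have "r dvd X_pow_minus_1 n" using r assms(1) by (metis dvd_mult2)
  ultimately have "r dvd Polynomial.monom 1 n - X_pow_minus_1 n" by (rule dvd_diff)
  then show "is_unit r" by simp
qed

lemma X_pow_minus_1_dvd:
  assumes "d dvd n"
  shows "X_pow_minus_1 d dvd X_pow_minus_1 n"
proof -
  obtain k where k: "n = d * k" using assms by blast
  have "Polynomial.monom 1 n - 1 = (Polynomial.monom 1 d :: rat poly) ^ k - 1"
    by (simp add: k monom_power)
  also have "\<dots> = (Polynomial.monom 1 d - 1) * (\<Sum>i<k. Polynomial.monom 1 d ^ i)"
    by (rule power_diff_1_eq)
  finally show ?thesis by simp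
qed

lemma dvd_X_pow_minus_1_gcd:
  assumes "r dvd X_pow_minus_1 a" "r dvd X_pow_minus_1 b"
  shows "r dvd X_pow_minus_1 (gcd a b)"
  using assms
proof (induction a b rule: gcd_nat_induct)
  case (step m n)
  have "r dvd X_pow_minus_1 (n * (m div n))" 
    by (rule dvd_trans[OF step.prems(2) X_pow_minus_1_dvd]) simp
  then have "r dvd Polynomial.monom 1 (m mod n) * X_pow_minus_1 (n * (m div n))" by (rule dvd_mult)
  then have "r dvd X_pow_minus_1 m - Polynomial.monom 1 (m mod n) * X_pow_minus_1 (n * (m div n))"
    by (rule dvd_diff[OF step.prems(1)])
  also have "\<dots> = X_pow_minus_1 (m mod n)"
    by (simp add: algebra_simps mult_monom)
  finally have "r dvd X_pow_minus_1 (m mod n)" .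
  from step.IH[OF step.prems(2) this] show ?case
    by (simp only: gcd_red_nat[of m n])
qed simp

lemma prod_coprime_dvd:
  fixes f :: "'b \<Rightarrow> 'a::semiring_gcd"
  assumes "finite A" "\<And>a. a \<in> A \<Longrightarrow> f a dvd x" "\<And>a b. a \<in> A \<Longrightarrow> b \<in> A \<Longrightarrow> a \<noteq> b \<Longrightarrow> coprime (f a) (f b)"
  shows "prod f A dvd x"
  using assms
proof (induction A)
  case (insert a A)
  have "coprime (f a) (prod f A)" using insert by (intro prod_coprime_right) auto
  then show ?case using insert by (simp add: divides_mult)
qed simp

text \<open>The two claims need each other: the division defining \<open>cyclotomic n\<close> is
  exact because the earlier factors are pairwise coprime, and coprimality to the earlier ones uses
  that exactness.\<close>

lemma cyclotomic_aux:
  "n \<ge> 1 \<Longrightarrow> (\<Prod>d\<in>{d\<in>{1..n}. d dvd n}. cyclotomic d) = X_pow_minus_1 n \<and>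
     (\<forall>d\<in>{1..<n}. coprime (cyclotomic n) (cyclotomic d))"
proof (induction n rule: less_induct)
  case (less n)
  define P where "P = (\<Prod>d\<in>{d\<in>{1..<n}. d dvd n}. cyclotomic d)"
  have IH: "(\<Prod>d\<in>{d\<in>{1..m}. d dvd m}. cyclotomic d) = X_pow_minus_1 m" if "m \<ge> 1" "m < n" for m
    using less.IH[of m] that by blast
  have dvd: "cyclotomic d dvd X_pow_minus_1 d" if "d \<ge> 1" "d < n" for d
  proof -
    have "cyclotomic d dvd (\<Prod>d\<in>{e\<in>{1..d}. e dvd d}. cyclotomic d)"
      using that by (intro dvd_prodI) auto
    then show ?thesis using IH that by simp
  qed
  have "P dvd X_pow_minus_1 n"
    unfolding P_def
  proof (rule prod_coprime_dvd)
    fix a assume "a \<in> {d\<in>{1..<n}. d dvd n}"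
    then show "cyclotomic a dvd X_pow_minus_1 n" using dvd[of a] X_pow_minus_1_dvd[of a n] dvd_trans by auto
  next
    fix a b assume "a \<in> {d\<in>{1..<n}. d dvd n}" "b \<in> {d\<in>{1..<n}. d dvd n}" "a \<noteq> b"
    then show "coprime (cyclotomic a) (cyclotomic b)"
      using less.IH[of a] less.IH[of b] by (cases "a < b") (auto simp: coprime_commute)
  qed simp
  then have nP: "cyclotomic n * P = X_pow_minus_1 n"
    by (subst cyclotomic.simps) (simp add: P_def)
  have "{d\<in>{1..n}. d dvd n} = insert n {d\<in>{1..<n}. d dvd n}" using less.prems by auto
  then have prod: "(\<Prod>d\<in>{d\<in>{1..n}. d dvd n}. cyclotomic d) = X_pow_minus_1 n"
    using nP by (simp add: P_def)
  have "coprime (cyclotomic n) (cyclotomic d)" if d: "d \<in> {1..<n}" for d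
  proof (rule coprimeI)
    fix r assume r: "r dvd cyclotomic n" "r dvd cyclotomic d"
    \<comment> \<open>\<open>d\<close> need not divide \<open>n\<close>, but a common factor divides
      \<open>X^g - 1\<close>, a divisor of the product \<open>P\<close> of the proper factors; and
      \<open>P\<close> is coprime to \<open>cyclotomic n\<close>.\<close>
    define g where "g = gcd n d"
    have g: "g \<ge> 1" "g < n" "g dvd n" using d by (auto simp: g_def Suc_le_eq intro: le_less_trans[OF gcd_le2_nat])
    have "r dvd X_pow_minus_1 n" using r(1) nP by (metis dvd_mult2)
    moreover have "r dvd X_pow_minus_1 d" using r(2) dvd[of d] d dvd_trans by auto
    ultimately have "r dvd X_pow_minus_1 g" unfolding g_def by (rule dvd_X_pow_minus_1_gcd)
    moreover have "X_pow_minus_1 g dvd P"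
    proof -
      have "(\<Prod>d\<in>{d\<in>{1..g}. d dvd g}. cyclotomic d) dvd P"
        unfolding P_def by (rule prod_dvd_prod_subset) (use g in \<open>auto intro: dvd_trans\<close>)
      then show ?thesis using IH g by simp
    qed
    ultimately have "r dvd P" by (rule dvd_trans)
    then show "is_unit r"
      using r(1) coprime_factors_X_pow_minus_1[OF nP] less.prems coprime_common_divisor by blast
  qed
  then show ?case using prod by blast
qed

lemma prod_cyclotomic: "n \<ge> 1 \<Longrightarrow> (\<Prod>d\<in>{d\<in>{1..n}. d dvd n}. cyclotomic d) = X_pow_minus_1 n"
  using cyclotomic_aux by blast

lemma coprime_cyclotomic: "d \<ge> 1 \<Longrightarrow> e \<ge> 1 \<Longrightarrow> d \<noteq> e \<Longrightarrow> coprime (cyclotomic d) (cyclotomic e)"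
  using cyclotomic_aux[of d] cyclotomic_aux[of e] by (cases "d < e") (auto simp: coprime_commute)

lemma X_pow_minus_1_nonzero: "n \<ge> 1 \<Longrightarrow> X_pow_minus_1 n \<noteq> 0"
proof
  assume "n \<ge> 1" "X_pow_minus_1 n = 0"
  then have "poly.coeff (X_pow_minus_1 n) n = 0" by simp
  then show False using \<open>n \<ge> 1\<close> by simp
qed

lemma cyclotomic_nonzero: "n \<ge> 1 \<Longrightarrow> cyclotomic n \<noteq> 0"
proof
  assume n: "n \<ge> 1" "cyclotomic n = 0"
  then have "(\<Prod>d\<in>{d\<in>{1..n}. d dvd n}. cyclotomic d) = 0" by (intro prod_zero) auto
  then show False using prod_cyclotomic X_pow_minus_1_nonzero n by metis
qed

lemma qnum_eq_prod_cyclotomic: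
  assumes "m \<ge> 1"
  shows "qnum m = (\<Prod>d\<in>{d\<in>{2..m}. d dvd m}. cyclotomic d)"
proof -
  have "{d\<in>{1..1::nat}. d dvd 1} = {1}" by auto
  then have 1: "cyclotomic 1 = X_pow_minus_1 1" using prod_cyclotomic[of 1] by simp
  have "{d\<in>{1..m}. d dvd m} = insert 1 {d\<in>{2..m}. d dvd m}" using assms by auto
  then have "X_pow_minus_1 m = X_pow_minus_1 1 * (\<Prod>d\<in>{d\<in>{2..m}. d dvd m}. cyclotomic d)"
    using prod_cyclotomic[OF assms] 1 by simp
  moreover have "X_pow_minus_1 m = X_pow_minus_1 1 * qnum m"
    using qnum[of m] by (simp add: algebra_simps)
  ultimately have "X_pow_minus_1 1 * qnum m = X_pow_minus_1 1 * (\<Prod>d\<in>{d\<in>{2..m}. d dvd m}. cyclotomic d)"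
    by simp
  then show ?thesis using X_pow_minus_1_nonzero[of 1] by simp
qed

lemma prod_qnum_eq_prod_cyclotomic:
  assumes "finite D" "\<And>m d. m \<in> set ms \<Longrightarrow> d \<ge> 2 \<Longrightarrow> d dvd m \<Longrightarrow> d \<in> D" "\<And>m. m \<in> set ms \<Longrightarrow> m \<ge> 1"
    "\<And>d. d \<in> D \<Longrightarrow> d \<ge> 2"
  shows "(\<Prod>m\<leftarrow>ms. qnum m) = (\<Prod>d\<in>D. cyclotomic d ^ length (filter (\<lambda>m. d dvd m) ms))"
  using assms(2,3)
proof (induction ms)
  case (Cons m ms)
  have "{d\<in>{2..m}. d dvd m} = {d \<in> D. d dvd m}"
    using Cons.prems[of m] assms(4) by (auto dest: dvd_imp_le)
  then have "qnum m = (\<Prod>d\<in>{d \<in> D. d dvd m}. cyclotomic d)"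
    using qnum_eq_prod_cyclotomic[of m] Cons.prems by simp
  also have "\<dots> = (\<Prod>d\<in>D. if d dvd m then cyclotomic d else 1)"
    by (rule prod.inter_filter) (rule assms(1))
  finally have m: "qnum m = (\<Prod>d\<in>D. if d dvd m then cyclotomic d else 1)" .
  have IH: "(\<Prod>m\<leftarrow>ms. qnum m) = (\<Prod>d\<in>D. cyclotomic d ^ length (filter (\<lambda>m. d dvd m) ms))"
    by (rule Cons.IH) (use Cons.prems in auto)
  have "(\<Prod>m\<leftarrow>m # ms. qnum m) =
      (\<Prod>d\<in>D. (if d dvd m then cyclotomic d else 1) * cyclotomic d ^ length (filter (\<lambda>m. d dvd m) ms))"
    unfolding list.map prod_list.Cons m IH by (rule prod.distrib[symmetric])
  also have "\<dots> = (\<Prod>d\<in>D. cyclotomic d ^ length (filter (\<lambda>x. d dvd x) (m # ms)))"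
    by (rule prod.cong) auto
  finally show ?case .
qed simp

section \<open>Laurent polynomials\<close>

lemma laurent_of_poly_altdef:
  assumes "Polynomial.degree p \<le> N"
  shows "laurent_of_poly p = (\<Sum>i\<le>N. Poly_Mapping.single (int i) (poly.coeff p i))"
  unfolding laurent_of_poly_def
  by (rule sum.mono_neutral_left) (use assms in \<open>auto simp: coeff_eq_0\<close>)

lemma laurent_of_poly_add: "laurent_of_poly (p + q) = laurent_of_poly p + laurent_of_poly q"
proof -
  define N where "N = max (Polynomial.degree p) (Polynomial.degree q)"
  have "Polynomial.degree (p + q) \<le> N" "Polynomial.degree p \<le> N" "Polynomial.degree q \<le> N"
    by (auto simp: N_def degree_add_le_max)
  then show ?thesis
    by (simp add: laurent_of_poly_altdef[of _ N] single_add sum.distrib)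
qed

lemma laurent_of_poly_0 [simp]: "laurent_of_poly 0 = 0"
  by (simp add: laurent_of_poly_def)

lemma laurent_of_poly_1 [simp]: "laurent_of_poly 1 = 1"
  by (simp add: laurent_of_poly_def)

lemma laurent_of_poly_pCons:
  "laurent_of_poly (pCons a p) = Poly_Mapping.single 0 a + Poly_Mapping.single 1 1 * laurent_of_poly p"
proof -
  have "laurent_of_poly (pCons a p) =
      (\<Sum>i\<le>Suc (Polynomial.degree p). Poly_Mapping.single (int i) (poly.coeff (pCons a p) i))"
    by (rule laurent_of_poly_altdef) (rule degree_pCons_le)
  also have "\<dots> = Poly_Mapping.single 0 a +
      (\<Sum>i\<le>Polynomial.degree p. Poly_Mapping.single (1 + int i) (poly.coeff p i))"
    by (simp add: sum.atMost_Suc_shift del: sum.atMost_Suc)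
  also have "(\<Sum>i\<le>Polynomial.degree p. Poly_Mapping.single (1 + int i) (poly.coeff p i)) =
      Poly_Mapping.single 1 1 * laurent_of_poly p"
    by (simp add: laurent_of_poly_def sum_distrib_left mult_single)
  finally show ?thesis .
qed

lemma laurent_of_poly_smult: "laurent_of_poly (Polynomial.smult a p) = Poly_Mapping.single 0 a * laurent_of_poly p"
proof -
  have "laurent_of_poly (Polynomial.smult a p) =
      (\<Sum>i\<le>Polynomial.degree p. Poly_Mapping.single (int i) (poly.coeff (Polynomial.smult a p) i))"
    by (rule laurent_of_poly_altdef) (rule degree_smult_le)
  then show ?thesis by (simp add: laurent_of_poly_def sum_distrib_left mult_single)
qed

lemma laurent_of_poly_mult: "laurent_of_poly (p * q) = laurent_of_poly p * laurent_of_poly q"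
  by (induction p) (simp_all add: laurent_of_poly_add laurent_of_poly_smult laurent_of_poly_pCons algebra_simps)

lemma laurent_of_poly_power: "laurent_of_poly (p ^ k) = laurent_of_poly p ^ k"
  by (induction k) (simp_all add: laurent_of_poly_mult)

lemma laurent_of_poly_prod: "laurent_of_poly (\<Prod>i\<in>A. f i) = (\<Prod>i\<in>A. laurent_of_poly (f i))"
  by (induction A rule: infinite_finite_induct) (simp_all add: laurent_of_poly_mult)

lemma lookup_laurent_of_poly: "Poly_Mapping.lookup (laurent_of_poly p) (int i) = poly.coeff p i"
  by (simp add: laurent_of_poly_def lookup_sum lookup_single when_def coeff_eq_0 cong: if_cong)

lemma laurent_of_poly_eq_0_iff: "laurent_of_poly p = 0 \<longleftrightarrow> p = 0"
proof
  assume "laurent_of_poly p = 0"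
  then have "poly.coeff p i = 0" for i using lookup_laurent_of_poly[of p i] by simp
  then show "p = 0" by (simp add: poly_eq_iff)
qed simp

text \<open>Coprime polynomials over the rationals satisfy a Bezout identity, which the embedding
  into Laurent polynomials preserves.\<close>

lemma comaximal_cyclotomic:
  assumes "d \<ge> 1" "e \<ge> 1" "d \<noteq> e"
  shows "comaximal (laurent_of_poly (cyclotomic d)) (laurent_of_poly (cyclotomic e))"
proof -
  obtain u v where "u * cyclotomic d + v * cyclotomic e = gcd (cyclotomic d) (cyclotomic e)"
    by (metis bezout_coefficients_fst_snd)
  then have "u * cyclotomic d + v * cyclotomic e = 1" using coprime_cyclotomic[OF assms] by simp
  then have "laurent_of_poly (u * cyclotomic d + v * cyclotomic e) = 1" by simp
  then show ?thesis by (auto simp: comaximal_def laurent_of_poly_add laurent_of_poly_mult)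
qed

section \<open>Acyclic matchings for the exceptional types\<close>

text \<open>A certificate for \<open>d\<close> consists of an order of the vertices and of the bars of the resulting
  greedy matching: the degree \<open>k\<close>, the coefficients of a cocycle (the first cell is the lower cell
  of the bar), and those of a chain whose boundary is a cycle generating the summand
  $R/(\varphi_d)$ of the homology in degree \<open>k\<close>. Cells are given by their vertices in Bourbaki's
  numbering.\<close>

type_synonym sparse_chain = "(nat list \<times> int) list"

type_synonym certificate = "nat \<times> nat list \<times> (nat \<times> sparse_chain \<times> sparse_chain) list"

definition simple_bar :: "nat list \<Rightarrow> nat list \<Rightarrow> nat \<times> sparse_chain \<times> sparse_chain" where
  "simple_bar a b = (length a, [(a, 1)], [(b, 1)])"

text \<open>An empty list means that the matching has no weight jump, so \<phi>_d contributes
  nothing. The chains that are not single cells are forced. In F4, d = 2, the edge {3,4} weighs no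
  more than its ends, so the cocycle must agree on them. In F4, d = 3, the facet {1,2} of type A2 is
  too heavy and cancels between the two cells of the filling. In E8, d = 4, the filling is the
  boundary of the triangle {1,3,4} joined with {6,7,8}, so that all facets containing this A3
  cancel.\<close>

fun certificates :: "exceptional_type \<Rightarrow> certificate list" where
  "certificates H3 = [
    (2, [1, 2, 3], [simple_bar [] [1], simple_bar [1, 3] [1, 2, 3]]),
    (3, [1, 2, 3], []),
    (5, [1, 3, 2], []),
    (6, [1, 2, 3], [simple_bar [2, 3] [1, 2, 3]]),
    (10, [1, 2, 3], [simple_bar [2, 3] [1, 2, 3]])]"
| "certificates H4 = [
    (2, [4, 3, 2, 1], [simple_bar [] [4], simple_bar [1, 2, 3] [1, 2, 3, 4]]),
    (3, [1, 4, 2, 3], [simple_bar [2, 3, 4] [1, 2, 3, 4]]),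
    (4, [1, 4, 2, 3], [simple_bar [2, 3, 4] [1, 2, 3, 4]]),
    (5, [1, 4, 2, 3], [simple_bar [1, 2, 3] [1, 2, 3, 4]]),
    (6, [1, 4, 2, 3], [simple_bar [1, 2, 3] [1, 2, 3, 4]]),
    (10, [1, 4, 2, 3], [simple_bar [1, 2, 3] [1, 2, 3, 4]]),
    (12, [1, 4, 2, 3], [simple_bar [2, 3, 4] [1, 2, 3, 4]]),
    (15, [1, 4, 2, 3], [simple_bar [2, 3, 4] [1, 2, 3, 4]]),
    (20, [1, 4, 2, 3], [simple_bar [2, 3, 4] [1, 2, 3, 4]]),
    (30, [1, 4, 2, 3], [simple_bar [2, 3, 4] [1, 2, 3, 4]])]"
| "certificates F4 = [
    (2, [1, 3, 2, 4], [simple_bar [] [1], (1, [([3], 1), ([4], 1)], [([2, 3], 1)]), simple_bar [2, 3] [1, 2, 3], simple_bar [2, 3, 4] [1, 2, 3, 4]]),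
    (3, [1, 3, 2, 4], [(2, [([2, 4], 1)], [([1, 2, 4], 1), ([1, 2, 3], -1)]), simple_bar [2, 3, 4] [1, 2, 3, 4]]),
    (4, [1, 3, 2, 4], [simple_bar [2, 3, 4] [1, 2, 3, 4]]),
    (6, [1, 3, 2, 4], [simple_bar [2, 3] [1, 2, 3], simple_bar [2, 3, 4] [1, 2, 3, 4]]),
    (8, [1, 3, 2, 4], [simple_bar [2, 3, 4] [1, 2, 3, 4]]),
    (12, [1, 3, 2, 4], [simple_bar [2, 3, 4] [1, 2, 3, 4]])]"
| "certificates E6 = [
    (2, [1, 3, 4, 2, 5, 6], [simple_bar [] [1]]),
    (3, [1, 2, 5, 6, 3, 4], [simple_bar [1, 3, 4, 5, 6] [1, 2, 3, 4, 5, 6]]),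
    (4, [1, 2, 5, 6, 3, 4], []),
    (5, [1, 6, 2, 3, 4, 5], []),
    (6, [1, 2, 5, 6, 3, 4], [simple_bar [3, 4, 5, 6] [1, 3, 4, 5, 6], simple_bar [2, 3, 4, 5, 6] [1, 2, 3, 4, 5, 6]]),
    (8, [1, 2, 5, 6, 3, 4], [simple_bar [2, 3, 4, 5] [1, 2, 3, 4, 5]]),
    (9, [1, 2, 5, 6, 3, 4], [simple_bar [2, 3, 4, 5, 6] [1, 2, 3, 4, 5, 6]]),
    (12, [1, 2, 5, 6, 3, 4], [simple_bar [2, 3, 4, 5, 6] [1, 2, 3, 4, 5, 6]])]"
| "certificates E7 = [
    (2, [1, 3, 4, 2, 5, 6, 7], [simple_bar [] [1], simple_bar [2, 3, 4, 5, 6, 7] [1, 2, 3, 4, 5, 6, 7]]),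
    (3, [7, 1, 2, 6, 3, 4, 5], []),
    (4, [7, 1, 2, 6, 3, 4, 5], []),
    (5, [7, 1, 2, 6, 3, 4, 5], []),
    (6, [7, 1, 2, 6, 3, 4, 5], [simple_bar [3, 4, 5, 6] [3, 4, 5, 6, 7], simple_bar [2, 3, 4, 5, 6] [2, 3, 4, 5, 6, 7], simple_bar [1, 2, 3, 4, 5, 6] [1, 2, 3, 4, 5, 6, 7]]),
    (7, [1, 2, 3, 4, 5, 6, 7], []),
    (8, [7, 1, 2, 6, 3, 4, 5], []),
    (9, [7, 1, 2, 6, 3, 4, 5], []),
    (10, [7, 1, 2, 6, 3, 4, 5], []),
    (12, [7, 1, 2, 6, 3, 4, 5], []),
    (14, [7, 1, 2, 6, 3, 4, 5], [simple_bar [1, 2, 3, 4, 5, 6] [1, 2, 3, 4, 5, 6, 7]]),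
    (18, [7, 1, 2, 6, 3, 4, 5], [simple_bar [1, 2, 3, 4, 5, 6] [1, 2, 3, 4, 5, 6, 7]])]"
| "certificates E8 = [
    (2, [8, 7, 6, 5, 4, 3, 2, 1], [simple_bar [] [8], simple_bar [1, 2, 3, 4, 5, 6, 7] [1, 2, 3, 4, 5, 6, 7, 8]]),
    (3, [8, 1, 2, 4, 6, 3, 5, 7], [simple_bar [1, 2, 3, 4, 5, 6, 7] [1, 2, 3, 4, 5, 6, 7, 8]]),
    (4, [1, 2, 5, 6, 3, 4, 7, 8], [(4, [([3, 4, 7, 8], 1)], [([3, 4, 6, 7, 8], 1), ([1, 4, 6, 7, 8], -1), ([1, 3, 6, 7, 8], 1)]), simple_bar [2, 3, 4, 5, 6, 7, 8] [1, 2, 3, 4, 5, 6, 7, 8]]),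
    (5, [8, 1, 2, 4, 6, 3, 5, 7], [simple_bar [1, 2, 3, 4, 5, 6, 7] [1, 2, 3, 4, 5, 6, 7, 8]]),
    (6, [8, 1, 2, 4, 6, 3, 5, 7], [simple_bar [1, 2, 3, 4, 5, 6, 7] [1, 2, 3, 4, 5, 6, 7, 8]]),
    (7, [8, 1, 2, 4, 6, 3, 5, 7], []),
    (8, [8, 1, 2, 4, 6, 3, 5, 7], [simple_bar [1, 3, 4, 5, 6, 7] [1, 3, 4, 5, 6, 7, 8], simple_bar [1, 2, 3, 4, 5, 6, 7] [1, 2, 3, 4, 5, 6, 7, 8]]),
    (9, [8, 1, 2, 4, 6, 3, 5, 7], []),
    (10, [8, 1, 2, 4, 6, 3, 5, 7], [simple_bar [1, 2, 3, 4, 5, 6, 7] [1, 2, 3, 4, 5, 6, 7, 8]]),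
    (12, [8, 1, 2, 4, 6, 3, 5, 7], [simple_bar [2, 3, 4, 5, 6, 7] [2, 3, 4, 5, 6, 7, 8], simple_bar [1, 2, 3, 4, 5, 6, 7] [1, 2, 3, 4, 5, 6, 7, 8]]),
    (14, [8, 1, 2, 4, 6, 3, 5, 7], []),
    (15, [8, 1, 2, 4, 6, 3, 5, 7], [simple_bar [1, 2, 3, 4, 5, 6, 7] [1, 2, 3, 4, 5, 6, 7, 8]]),
    (18, [8, 1, 2, 4, 6, 3, 5, 7], []),
    (20, [8, 1, 2, 4, 6, 3, 5, 7], [simple_bar [1, 2, 3, 4, 5, 6, 7] [1, 2, 3, 4, 5, 6, 7, 8]]),
    (24, [8, 1, 2, 4, 6, 3, 5, 7], [simple_bar [1, 2, 3, 4, 5, 6, 7] [1, 2, 3, 4, 5, 6, 7, 8]]),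
    (30, [8, 1, 2, 4, 6, 3, 5, 7], [simple_bar [1, 2, 3, 4, 5, 6, 7] [1, 2, 3, 4, 5, 6, 7, 8]])]"

text \<open>Greedy matching: for each vertex \<open>j\<close> in turn, all unmatched pairs of cells that differ in \<open>j\<close>
  and whose weights differ by \<open>e\<close> are matched, first with \<open>e = 0\<close>, then with \<open>e = 1\<close>.\<close>

fun match_subtrees ::
  "nat \<Rightarrow> nat \<Rightarrow> (nat \<times> nat option) tree \<Rightarrow> (nat \<times> nat option) tree \<Rightarrow>
     (nat \<times> nat option) tree \<times> (nat \<times> nat option) tree" where
  "match_subtrees e j (Leaf (v, None)) (Leaf (w, None)) =
     (if w = v + e then (Leaf (v, Some j), Leaf (w, Some j)) else (Leaf (v, None), Leaf (w, None)))"
| "match_subtrees e j (Node a b) (Node c d) =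
     (case match_subtrees e j a c of (a', c') \<Rightarrow>
      case match_subtrees e j b d of (b', d') \<Rightarrow> (Node a' b', Node c' d'))"
| "match_subtrees e j x y = (x, y)"

text \<open>The third argument counts the levels still to descend to vertex \<open>j\<close>; there
  the two subtrees are the cells without and with \<open>j\<close>.\<close>

fun match_vertex ::
  "nat \<Rightarrow> nat \<Rightarrow> nat \<Rightarrow> (nat \<times> nat option) tree \<Rightarrow> (nat \<times> nat option) tree" where
  "match_vertex e j 0 (Node l r) = (case match_subtrees e j l r of (l', r') \<Rightarrow> Node l' r')"
| "match_vertex e j (Suc i) (Node l r) = Node (match_vertex e j i l) (match_vertex e j i r)"
| "match_vertex e j i (Leaf x) = Leaf x"

definition matching_tree :: "nat list \<Rightarrow> nat tree \<Rightarrow> (nat \<times> nat option) tree" where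
  "matching_tree p vt =
     fold (\<lambda>j. match_vertex 1 j j) p (fold (\<lambda>j. match_vertex 0 j j) p (map_tree (\<lambda>v. (v, None)) vt))"

text \<open>No degree exceeds 30. The multiples of \<open>d\<close> are listed once, so that each
  leaf costs only membership tests.\<close>

definition weight_tree :: "nat list tree \<Rightarrow> nat \<Rightarrow> nat tree" where
  "weight_tree dt d =
     (let ms = filter (\<lambda>m. d dvd m) [1..<31] in map_tree (\<lambda>ds. length (filter (\<lambda>m. m \<in> set ms) ds)) dt)"

fun tree_le :: "nat tree \<Rightarrow> nat tree \<Rightarrow> bool" where
  "tree_le (Leaf v) (Leaf w) = (v \<le> w)"
| "tree_le (Node a b) (Node c d) = (tree_le a c \<and> tree_le b d)"
| "tree_le s t = False"

fun tree_mono :: "nat tree \<Rightarrow> bool" where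
  "tree_mono (Leaf v) = True"
| "tree_mono (Node l r) = (tree_le l r \<and> tree_mono l \<and> tree_mono r)"

text \<open>The checks use conditionals where implications would do because the simplifier evaluates
  only the relevant branch of a conditional.\<close>

definition lower :: "(nat \<times> nat option) tree \<Rightarrow> bool list \<Rightarrow> bool" where
  "lower t c = (case snd (look t c) of None \<Rightarrow> False | Some j \<Rightarrow> \<not> c ! j)"

definition cell :: "nat \<Rightarrow> nat list \<Rightarrow> bool list" where
  "cell n vs = map (\<lambda>i. Suc i \<in> set vs) [0..<n]"

definition cells_of :: "nat \<Rightarrow> sparse_chain \<Rightarrow> (bool list \<times> int) list" where
  "cells_of n xs = map (\<lambda>(vs, z). (cell n vs, z)) xs"

definition chain_of :: "(bool list \<times> int) list \<Rightarrow> bool list \<Rightarrow> int" where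
  "chain_of xs c = (\<Sum>(b, z)\<leftarrow>xs. if b = c then z else 0)"

definition cell_check ::
  "nat \<Rightarrow> nat list \<Rightarrow> nat tree \<Rightarrow> (nat \<times> nat option) tree \<Rightarrow> (nat \<times> bool list) list \<Rightarrow> bool list \<Rightarrow> bool" where
  "cell_check n p vt t as c =
     (case look t c of
        (v, None) \<Rightarrow> False
      | (v, Some j) \<Rightarrow>
          j < n \<and> v = look vt c \<and> snd (look t (c[j := \<not> c ! j])) = Some j \<and>
          (if c ! j then True
           else
             (let u = c[j := True]; v' = look vt u in
              j \<in> set p \<and> (if v' = v then True else v' = Suc v \<and> (cnt c, c) \<in> set as) \<and>
              list_all (\<lambda>i. if c ! i then \<not> lower t (u[i := False]) else True) (takeWhile (\<lambda>i. i \<noteq> j) p))))"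

text \<open>\<open>l\<close> is the weight of the bar cell. The cochain has to be closed only on
  faces of weight at most \<open>l\<close>, and the boundary of the filling has to avoid all heavier
  cells. The pairing must be 1 or -1 in order to stay a unit in every ring.\<close>

definition bar_check ::
  "nat \<Rightarrow> nat tree \<Rightarrow> (nat \<times> nat option) tree \<Rightarrow> nat \<times> sparse_chain \<times> sparse_chain \<Rightarrow> bool" where
  "bar_check n vt t b =
     (case b of (k, xs0, ys0) \<Rightarrow>
      let xs = cells_of n xs0; ys = cells_of n ys0; a = fst (hd xs); l = look vt a in
      xs \<noteq> [] \<and> chain_of xs a = 1 \<and>
      list_all (\<lambda>(c, z). lower t c \<and> look vt c = l) xs \<and>
      list_all (\<lambda>(c, z). cnt c = Suc k) ys \<and>
      list_all (\<lambda>r. let m = cnt r in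
          if m = Suc k then (if look vt r \<le> l then cobd (chain_of xs) r = 0 else True)
          else if m = k then (if l < look vt r then bd (chain_of ys) r = 0 else True)
          else True) (cube n) \<and>
      (let s = \<Sum>(c, z)\<leftarrow>xs. z * bd (chain_of ys) c in s = 1 \<or> s = - 1))"

definition certificate_check :: "nat \<Rightarrow> nat list tree \<Rightarrow> certificate \<Rightarrow> bool" where
  "certificate_check n dt cert =
     (case cert of (d, q, bs) \<Rightarrow>
      let p = map (\<lambda>i. i - 1) q; vt = weight_tree dt d; t = matching_tree p vt in
      distinct (map fst bs) \<and> tree_mono vt \<and>
      list_all (cell_check n p vt t (map (\<lambda>(k, xs, ys). (k, cell n (fst (hd xs)))) bs)) (cube n) \<and>
      list_all (bar_check n vt t) bs)"

fun leaves :: "'a tree \<Rightarrow> 'a list" where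
  "leaves (Leaf a) = [a]"
| "leaves (Node l r) = leaves l @ leaves r"

text \<open>The certified \<open>d\<close> contain every tabulated degree together with all its
  divisors from 2 on, so that no cyclotomic factor of a Poincare polynomial is overlooked.\<close>

definition certificates_check :: "exceptional_type \<Rightarrow> bool" where
  "certificates_check T =
     (let dt = degree_tree T; cs = certificates T; ds = map fst cs in
      ds \<noteq> [] \<and> distinct ds \<and> list_all (\<lambda>d. 2 \<le> d) ds \<and>
      list_all (\<lambda>m. m < 31 \<and> list_all (\<lambda>d. if d dvd m then d \<in> set ds else True) [2..<31]) ds \<and>
      list_all (list_all (\<lambda>m. m \<in> set ds)) (leaves dt) \<and>
      list_all (certificate_check (type_rank T) dt) cs)"

lemma certificates_check_H3: "certificates_check H3" by code_simp
lemma certificates_check_F4: "certificates_check F4" by code_simp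
lemma certificates_check_H4: "certificates_check H4" by code_simp
lemma certificates_check_E6: "certificates_check E6" by code_simp
lemma certificates_check_E7: "certificates_check E7" by code_simp
lemma certificates_check_E8: "certificates_check E8" by code_simp

section \<open>Soundness of the checks\<close>

lemma look_map_tree: "look (map_tree f t) c = f (look t c)"
  by (induction t c rule: look.induct) auto

lemma look_mem_leaves: "look t c \<in> set (leaves t)"
  by (induction t c rule: look.induct) auto

text \<open>The cell read as a binary numeral whose most significant digit belongs to the first
  vertex of the order.\<close>

fun lex_rank :: "nat list \<Rightarrow> bool list \<Rightarrow> nat" where
  "lex_rank [] c = 0"
| "lex_rank (i # p) c = (if c ! i then 2 ^ length p else 0) + lex_rank p c"

lemma lex_rank_less: "lex_rank p c < 2 ^ length p"
  by (induction p) auto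

text \<open>Inserting \<open>j\<close> gains a digit that outweighs all later ones, and the removed
  \<open>i\<close> is not earlier than \<open>j\<close>.\<close>

lemma lex_rank_swap:
  assumes "j \<in> set p" "i \<notin> set (takeWhile (\<lambda>i. i \<noteq> j) p)" "i \<noteq> j" "\<not> c ! j" "j < length c"
  shows "lex_rank p c < lex_rank p (c[j := True, i := False])"
  using assms(1,2)
proof (induction p)
  case (Cons h p)
  show ?case
  proof (cases "h = j")
    case True
    then show ?thesis using assms lex_rank_less[of p c] by (simp add: trans_less_add1)
  next
    case False
    then have "i \<noteq> h" using Cons.prems by auto
    then show ?thesis using Cons False by (simp add: nth_list_update)
  qed
qed simp

lemma bd_of_int: "bd (\<lambda>c. of_int (x c)) c = of_int (bd x c)"
  by (induction c arbitrary: x) simp_all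

lemma cobd_of_int: "cobd (\<lambda>c. of_int (x c)) c = of_int (cobd x c)"
  by (induction c arbitrary: x) simp_all

lemma chain_of_nonzero: "chain_of xs c \<noteq> 0 \<Longrightarrow> \<exists>z. (c, z) \<in> set xs"
  by (induction xs) (auto simp: chain_of_def split: if_splits)

lemma sum_chain_of:
  assumes "\<And>c z. (c, z) \<in> set xs \<Longrightarrow> length c = n"
  shows "(\<Sum>c | length c = n. chain_of xs c * g c) = (\<Sum>(c, z)\<leftarrow>xs. z * g c)"
  using assms
proof (induction xs)
  case (Cons x xs)
  obtain b z where x: "x = (b, z)" by (cases x)
  have "(\<Sum>c | length c = n. (if b = c then z else 0) * g c) = (\<Sum>c | length c = n. if b = c then z * g c else 0)"
    by (intro sum.cong) auto
  also have "\<dots> = z * g b" using Cons.prems[of b z] by (simp add: x finite_cube)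
  finally have 1: "(\<Sum>c | length c = n. (if b = c then z else 0) * g c) = z * g b" .
  have 2: "(\<Sum>c | length c = n. chain_of xs c * g c) = (\<Sum>(c, z)\<leftarrow>xs. z * g c)"
    by (rule Cons.IH) (use Cons.prems in auto)
  show ?case using 1 2 by (simp add: x chain_of_def distrib_right sum.distrib)
qed (simp add: chain_of_def)

lemma length_cells_of: "(c, z) \<in> set (cells_of n xs) \<Longrightarrow> length c = n"
  by (auto simp: cells_of_def cell_def)

lemma hd_cells_of: "xs \<noteq> [] \<Longrightarrow> fst (hd (cells_of n xs)) = cell n (fst (hd xs))"
  by (cases xs) (auto simp: cells_of_def)

lemma tree_le_look: "tree_le s t \<Longrightarrow> look s c \<le> look t c"
proof (induction s t arbitrary: c rule: tree_le.induct)
  case (2 a b a' b')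
  then show ?case by (cases c) auto
qed auto

lemma tree_mono_look: "tree_mono t \<Longrightarrow> i < length c \<Longrightarrow> c ! i \<Longrightarrow> look t (c[i := False]) \<le> look t c"
proof (induction t arbitrary: c i)
  case (Node l r)
  then obtain b bs where c: "c = b # bs" by (cases c) auto
  show ?case
  proof (cases i)
    case 0
    then show ?thesis using Node.prems c tree_le_look[of l r bs] by simp
  next
    case (Suc j)
    then show ?thesis using Node.IH Node.prems c by (cases b) simp_all
  qed
qed simp

locale certified =
  fixes T :: exceptional_type
  assumes check: "certificates_check T"
begin

abbreviation (input) N where "N \<equiv> type_rank T"

definition D :: "nat set" where "D = fst ` set (certificates T)"

definition order_of :: "nat \<Rightarrow> nat list" where
  "order_of d = map (\<lambda>i. i - 1) (fst (the (map_of (certificates T) d)))"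

definition bars_of :: "nat \<Rightarrow> (nat \<times> sparse_chain \<times> sparse_chain) list" where
  "bars_of d = snd (the (map_of (certificates T) d))"

definition wt :: "nat \<Rightarrow> bool list \<Rightarrow> nat" where
  "wt d = look (weight_tree (degree_tree T) d)"

definition mtree :: "nat \<Rightarrow> (nat \<times> nat option) tree" where
  "mtree d = matching_tree (order_of d) (weight_tree (degree_tree T) d)"

definition mate :: "nat \<Rightarrow> bool list \<Rightarrow> nat option" where
  "mate d c = snd (look (mtree d) c)"

definition rank :: "nat \<Rightarrow> bool list \<Rightarrow> nat" where
  "rank d = lex_rank (order_of d)"

definition bar_degrees :: "nat \<Rightarrow> nat set" where
  "bar_degrees k = {d \<in> D. k \<in> fst ` set (bars_of d)}"

definition cocycle_cells :: "nat \<Rightarrow> nat \<Rightarrow> (bool list \<times> int) list" where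
  "cocycle_cells k d = cells_of N (fst (the (map_of (bars_of d) k)))"

definition filling_cells :: "nat \<Rightarrow> nat \<Rightarrow> (bool list \<times> int) list" where
  "filling_cells k d = cells_of N (snd (the (map_of (bars_of d) k)))"

definition bar_cell :: "nat \<Rightarrow> nat \<Rightarrow> bool list" where
  "bar_cell k d = fst (hd (cocycle_cells k d))"

lemma check_parts:
  "map fst (certificates T) \<noteq> []" "distinct (map fst (certificates T))"
  "list_all (\<lambda>d. 2 \<le> d) (map fst (certificates T))"
  "list_all (\<lambda>m. m < 31 \<and> list_all (\<lambda>d. if d dvd m then d \<in> set (map fst (certificates T)) else True) [2..<31])
     (map fst (certificates T))"
  "list_all (list_all (\<lambda>m. m \<in> set (map fst (certificates T)))) (leaves (degree_tree T))"
  "list_all (certificate_check N (degree_tree T)) (certificates T)"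
  using check unfolding certificates_check_def Let_def by blast+

lemma D: "finite D" "D \<noteq> {}" "\<And>d. d \<in> D \<Longrightarrow> d \<ge> 2"
  using check_parts(1,3) by (auto simp: D_def list_all_iff)

lemma degrees:
  assumes "m \<in> set (look (degree_tree T) c)"
  shows "1 \<le> m" "m < 31" "\<And>d. 2 \<le> d \<Longrightarrow> d dvd m \<Longrightarrow> d \<in> D"
proof -
  have m: "m \<in> D"
    using assms look_mem_leaves[of "degree_tree T" c] check_parts(5) unfolding list_all_iff D_def set_map by blast
  then have "m < 31 \<and> (\<forall>d\<in>{2..<31}. d dvd m \<longrightarrow> d \<in> D)"
    using check_parts(4) unfolding list_all_iff set_upt D_def set_map by presburger
  moreover have "1 \<le> m" using D(3)[OF m] by simp
  ultimately have *: "1 \<le> m" "m < 31" and **: "\<forall>d\<in>{2..<31}. d dvd m \<longrightarrow> d \<in> D" by blast+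
  show "1 \<le> m" "m < 31" by (rule *)+
  fix d assume d: "2 \<le> d" "d dvd m"
  then have "d \<le> m" using *(1) by (intro dvd_imp_le) simp_all
  then show "d \<in> D" using ** *(2) d by simp
qed

lemma wt_eq: "wt d c = length (filter (\<lambda>m. d dvd m) (look (degree_tree T) c))"
proof -
  have "filter (\<lambda>m. m \<in> set (filter (\<lambda>m. d dvd m) [1..<31])) (look (degree_tree T) c) =
      filter (\<lambda>m. d dvd m) (look (degree_tree T) c)"
  proof (rule filter_cong)
    fix m assume "m \<in> set (look (degree_tree T) c)"
    then have "1 \<le> m" "m < 31" by (rule degrees)+
    then show "(m \<in> set (filter (\<lambda>m. d dvd m) [1..<31])) = (d dvd m)"
      unfolding set_filter set_upt by simp
  qed simp
  then show ?thesis by (simp only: wt_def weight_tree_def Let_def look_map_tree)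
qed

lemma certificate:
  assumes "d \<in> D"
  shows "tree_mono (weight_tree (degree_tree T) d)" "distinct (map fst (bars_of d))"
    "\<And>c. length c = N \<Longrightarrow> cell_check N (order_of d) (weight_tree (degree_tree T) d) (mtree d)
       (map (\<lambda>(k, xs, ys). (k, cell N (fst (hd xs)))) (bars_of d)) c"
    "\<And>b. b \<in> set (bars_of d) \<Longrightarrow> bar_check N (weight_tree (degree_tree T) d) (mtree d) b"
proof -
  have dist: "distinct (map fst (certificates T))"
    by (rule check_parts)
  from assms obtain cert where cert: "(d, cert) \<in> set (certificates T)" by (auto simp: D_def)
  then have "map_of (certificates T) d = Some cert" using dist by simp
  then have "fst (the (map_of (certificates T) d)) = fst cert" "snd (the (map_of (certificates T) d)) = snd cert"
    by simp_all
  moreover have "certificate_check N (degree_tree T) (d, cert)"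
    using check_parts(6) cert by (auto simp: list_all_iff)
  ultimately have *: "tree_mono (weight_tree (degree_tree T) d) \<and> distinct (map fst (bars_of d)) \<and>
     list_all (cell_check N (order_of d) (weight_tree (degree_tree T) d) (mtree d)
       (map (\<lambda>(k, xs, ys). (k, cell N (fst (hd xs)))) (bars_of d))) (cube N) \<and>
     list_all (bar_check N (weight_tree (degree_tree T) d) (mtree d)) (bars_of d)"
    by (cases cert) (simp add: certificate_check_def Let_def order_of_def bars_of_def mtree_def)
  show "tree_mono (weight_tree (degree_tree T) d)" "distinct (map fst (bars_of d))" using * by blast+
  show "cell_check N (order_of d) (weight_tree (degree_tree T) d) (mtree d)
       (map (\<lambda>(k, xs, ys). (k, cell N (fst (hd xs)))) (bars_of d)) c" if "length c = N" for c
    using * that by (auto simp: list_all_iff set_cube)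
  show "bar_check N (weight_tree (degree_tree T) d) (mtree d) b" if "b \<in> set (bars_of d)" for b
    using * that by (auto simp: list_all_iff)
qed

lemma cell_checkD:
  assumes "d \<in> D" "length c = N"
  obtains j where "j < N" "mate d c = Some j" "mate d (c[j := \<not> c ! j]) = Some j"
    "\<not> c ! j \<Longrightarrow> j \<in> set (order_of d)"
    "\<not> c ! j \<Longrightarrow> wt d (c[j := True]) = wt d c \<or> wt d (c[j := True]) = Suc (wt d c) \<and>
      (cnt c, c) \<in> (\<lambda>(k, xs, ys). (k, cell N (fst (hd xs)))) ` set (bars_of d)"
    "\<And>i. \<not> c ! j \<Longrightarrow> i \<in> set (takeWhile (\<lambda>i. i \<noteq> j) (order_of d)) \<Longrightarrow> c ! i \<Longrightarrow>
      \<not> lower (mtree d) (c[j := True, i := False])"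
proof -
  note * = certificate(3)[OF assms]
  obtain v o' where l: "look (mtree d) c = (v, o')" by (cases "look (mtree d) c")
  with * obtain j where j: "o' = Some j" by (cases o') (simp_all add: cell_check_def)
  show ?thesis
    by (rule that[of j]) (use * l j in \<open>auto simp: cell_check_def Let_def list_all_iff mate_def wt_def split: if_splits\<close>)
qed

text \<open>Monotonicity is read off the tree. Acyclicity holds because a step reaching another
  lower cell can only trade \<open>j\<close> for a vertex later in the order.\<close>

lemma matching: "d \<in> D \<Longrightarrow> matching N (wt d) (mate d) (rank d)"
proof
  assume d: "d \<in> D"
  show "wt d (r[j := False]) \<le> wt d r" if "length r = N" "j < N" "r ! j" for r j
    using tree_mono_look[OF certificate(1)[OF d]] that by (simp add: wt_def)
  show "\<exists>j<N. mate d c = Some j \<and> mate d (c[j := \<not> c ! j]) = Some j" if "length c = N" for c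
    using cell_checkD[OF d that] by metis
  show "wt d (c[j := True]) \<le> Suc (wt d c)" if c: "length c = N" "mate d c = Some j" "\<not> c ! j" for c j
  proof -
    obtain j' where "mate d c = Some j'"
      "\<not> c ! j' \<Longrightarrow> wt d (c[j' := True]) = wt d c \<or> wt d (c[j' := True]) = Suc (wt d c) \<and>
      (cnt c, c) \<in> (\<lambda>(k, xs, ys). (k, cell N (fst (hd xs)))) ` set (bars_of d)"
      using cell_checkD[OF d c(1)] by metis
    then show ?thesis using c by auto
  qed
  show "rank d c < rank d (c[j := True, i := False])"
    if c: "length c = N" "mate d c = Some j" "\<not> c ! j" "i < N" "c ! i"
      "mate d (c[j := True, i := False]) = Some l" "\<not> c[j := True, i := False] ! l" for c j i l
  proof -
    obtain j' where j': "j' < N" "mate d c = Some j'" "\<not> c ! j' \<Longrightarrow> j' \<in> set (order_of d)"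
      "\<And>i. \<not> c ! j' \<Longrightarrow> i \<in> set (takeWhile (\<lambda>i. i \<noteq> j') (order_of d)) \<Longrightarrow> c ! i \<Longrightarrow>
        \<not> lower (mtree d) (c[j' := True, i := False])"
      using cell_checkD[OF d c(1)] by metis
    have "lower (mtree d) (c[j := True, i := False])"
      using c(6,7) by (simp add: lower_def mate_def)
    then have "i \<notin> set (takeWhile (\<lambda>i. i \<noteq> j) (order_of d))" using j' c by auto
    moreover have "i \<noteq> j" using c by auto
    ultimately show ?thesis
      unfolding rank_def using j' c by (intro lex_rank_swap) auto
  qed
qed

lemma bar_degreesD:
  assumes "d \<in> bar_degrees k"
  shows "d \<in> D"
    "chain_of (cocycle_cells k d) (bar_cell k d) = 1" "length (bar_cell k d) = N"
    "\<And>c. chain_of (cocycle_cells k d) c \<noteq> 0 \<Longrightarrow> length c = N \<and> lower (mtree d) c \<and> wt d c = wt d (bar_cell k d)"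
    "\<And>c. chain_of (filling_cells k d) c \<noteq> 0 \<Longrightarrow> length c = N \<and> cnt c = Suc k"
    "\<And>r. length r = N \<Longrightarrow> cnt r = Suc k \<Longrightarrow> wt d r \<le> wt d (bar_cell k d) \<Longrightarrow>
       cobd (chain_of (cocycle_cells k d)) r = 0"
    "\<And>r. length r = N \<Longrightarrow> cnt r = k \<Longrightarrow> wt d (bar_cell k d) < wt d r \<Longrightarrow>
       bd (chain_of (filling_cells k d)) r = 0"
    "(\<Sum>c | length c = N. chain_of (cocycle_cells k d) c * bd (chain_of (filling_cells k d)) c) dvd 1"
proof -
  show d: "d \<in> D" using assms by (simp add: bar_degrees_def)
  from assms obtain xs ys where b: "(k, xs, ys) \<in> set (bars_of d)" by (auto simp: bar_degrees_def)
  then have "map_of (bars_of d) k = Some (xs, ys)" using certificate(2)[OF d] by simp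
  then have e: "cocycle_cells k d = cells_of N xs" "filling_cells k d = cells_of N ys"
    by (simp_all add: cocycle_cells_def filling_cells_def)
  have "bar_check N (weight_tree (degree_tree T) d) (mtree d) (k, xs, ys)"
    using certificate(4)[OF d] b by blast
  then have *: "cocycle_cells k d \<noteq> []" "chain_of (cocycle_cells k d) (bar_cell k d) = 1"
    "list_all (\<lambda>(c, z). lower (mtree d) c \<and> wt d c = wt d (bar_cell k d)) (cocycle_cells k d)"
    "list_all (\<lambda>(c, z). cnt c = Suc k) (filling_cells k d)"
    "list_all (\<lambda>r. if cnt r = Suc k then (if wt d r \<le> wt d (bar_cell k d) then cobd (chain_of (cocycle_cells k d)) r = 0 else True)
       else if cnt r = k then (if wt d (bar_cell k d) < wt d r then bd (chain_of (filling_cells k d)) r = 0 else True)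
       else True) (cube N)"
    "(\<Sum>(c, z)\<leftarrow>cocycle_cells k d. z * bd (chain_of (filling_cells k d)) c) = 1 \<or>
     (\<Sum>(c, z)\<leftarrow>cocycle_cells k d. z * bd (chain_of (filling_cells k d)) c) = - 1"
    unfolding bar_check_def prod.case Let_def e[symmetric] bar_cell_def[symmetric] wt_def[symmetric] by blast+
  show "chain_of (cocycle_cells k d) (bar_cell k d) = 1" by (rule *(2))
  show nz: "length c = N \<and> lower (mtree d) c \<and> wt d c = wt d (bar_cell k d)"
    if "chain_of (cocycle_cells k d) c \<noteq> 0" for c
    using chain_of_nonzero[OF that] *(3) by (auto simp: list_all_iff e dest: length_cells_of)
  show "length (bar_cell k d) = N" using nz[of "bar_cell k d"] *(2) by simp
  show "length c = N \<and> cnt c = Suc k" if "chain_of (filling_cells k d) c \<noteq> 0" for c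
    using chain_of_nonzero[OF that] *(4) by (auto simp: list_all_iff e dest: length_cells_of)
  show "cobd (chain_of (cocycle_cells k d)) r = 0"
    if "length r = N" "cnt r = Suc k" "wt d r \<le> wt d (bar_cell k d)" for r
    using that *(5) by (auto simp: list_all_iff set_cube)
  show "bd (chain_of (filling_cells k d)) r = 0"
    if "length r = N" "cnt r = k" "wt d (bar_cell k d) < wt d r" for r
    using that *(5) by (auto simp: list_all_iff set_cube)
  have "(\<Sum>c | length c = N. chain_of (cocycle_cells k d) c * bd (chain_of (filling_cells k d)) c) =
     (\<Sum>(c, z)\<leftarrow>cocycle_cells k d. z * bd (chain_of (filling_cells k d)) c)"
    by (rule sum_chain_of) (auto simp: e dest: length_cells_of)
  then show "(\<Sum>c | length c = N. chain_of (cocycle_cells k d) c * bd (chain_of (filling_cells k d)) c) dvd 1"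
    using *(6) by auto
qed

text \<open>The certificates are integral, and boundary, coboundary and pairing commute with
  \<open>of_int\<close>; the pairings are units already over the integers.\<close>

lemma weighted_simplex:
  fixes \<phi> :: "nat \<Rightarrow> 'r::idom"
  assumes "\<And>d. d \<in> D \<Longrightarrow> \<phi> d \<noteq> 0"
    "\<And>d e. d \<in> D \<Longrightarrow> e \<in> D \<Longrightarrow> d \<noteq> e \<Longrightarrow> comaximal (\<phi> d) (\<phi> e)"
    "\<And>c. length c = N \<Longrightarrow> \<exists>u. u dvd 1 \<and> w c = u * (\<Prod>d\<in>D. \<phi> d ^ wt d c)"
  shows "weighted_simplex N D \<phi> wt w mate rank k (bar_degrees k) (bar_cell k)
     (\<lambda>d c. of_int (chain_of (cocycle_cells k d) c)) (\<lambda>d c. of_int (chain_of (filling_cells k d) c))"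
proof (rule weighted_simplex.intro)
  fix d b assume d: "d \<in> D" "matching.bar N (wt d) (mate d) b" "cnt b = k"
  interpret matching N "wt d" "mate d" "rank d" "\<phi> d" by (rule matching[OF d(1)])
  have b: "low b" "wt d (partner b) \<noteq> wt d b" using d(2) by (simp_all add: bar_def)
  from b(1) obtain j where j: "mate d b = Some j" "\<not> b ! j" "length b = N" "partner b = b[j := True]"
    by (rule lowD)
  obtain j' where "mate d b = Some j'"
      "\<not> b ! j' \<Longrightarrow> wt d (b[j' := True]) = wt d b \<or> wt d (b[j' := True]) = Suc (wt d b) \<and>
      (cnt b, b) \<in> (\<lambda>(k, xs, ys). (k, cell N (fst (hd xs)))) ` set (bars_of d)"
    using cell_checkD[OF d(1) j(3)] by metis
  then have "(cnt b, b) \<in> (\<lambda>(k, xs, ys). (k, cell N (fst (hd xs)))) ` set (bars_of d)"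
    using j b by auto
  then obtain xs ys where e: "(k, xs, ys) \<in> set (bars_of d)" "b = cell N (fst (hd xs))" using d(3) by auto
  then have E: "d \<in> bar_degrees k" using d by (force simp: bar_degrees_def)
  have "map_of (bars_of d) k = Some (xs, ys)" using e certificate(2)[OF d(1)] by simp
  moreover have "xs \<noteq> []" using certificate(4)[OF d(1) e(1)] by (auto simp: bar_check_def Let_def cells_of_def)
  ultimately have "b = bar_cell k d" using e by (simp add: bar_cell_def cocycle_cells_def hd_cells_of)
  then show "d \<in> bar_degrees k \<and> b = bar_cell k d" using E by blast
next
  fix d c assume d: "d \<in> bar_degrees k" "of_int (chain_of (cocycle_cells k d) c) \<noteq> (0 :: 'r)"
  then have "chain_of (cocycle_cells k d) c \<noteq> 0" by auto
  then have c: "length c = N" "lower (mtree d) c" "wt d c = wt d (bar_cell k d)"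
    using bar_degreesD(4)[OF d(1)] by blast+
  interpret matching N "wt d" "mate d" "rank d" "\<phi> d" by (rule matching[OF bar_degreesD(1)[OF d(1)]])
  have "low c" using c by (auto simp: low_def lower_def mate_def split: option.splits)
  then show "matching.low N (mate d) c \<and> wt d c = wt d (bar_cell k d)" using c by blast
next
  fix d c assume d: "d \<in> bar_degrees k" "bd (\<lambda>c. of_int (chain_of (filling_cells k d) c)) c \<noteq> (0 :: 'r)"
  then have nz: "bd (chain_of (filling_cells k d)) c \<noteq> 0" by (auto simp: bd_of_int)
  have "graded N (Suc k) (chain_of (filling_cells k d))"
    using bar_degreesD(5)[OF d(1)] by (simp add: graded_def)
  then have "length c = N" "cnt c = k" using nz graded_bd unfolding graded_def by blast+
  then show "wt d c \<le> wt d (bar_cell k d)" using bar_degreesD(7)[OF d(1)] nz by (metis not_less)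
next
  fix d assume d: "d \<in> bar_degrees k"
  let ?s = "\<Sum>c | length c = N. chain_of (cocycle_cells k d) c * bd (chain_of (filling_cells k d)) c"
  have "(\<Sum>c | length c = N. of_int (chain_of (cocycle_cells k d) c) *
      bd (\<lambda>c. of_int (chain_of (filling_cells k d) c)) c) = (of_int ?s :: 'r)"
    by (simp add: bd_of_int)
  moreover obtain z where "1 = ?s * z" using bar_degreesD(8)[OF d] by (rule dvdE)
  from arg_cong[OF this, of "of_int :: int \<Rightarrow> 'r"] have "1 = (of_int ?s :: 'r) * of_int z"
    by (simp only: of_int_1 of_int_mult)
  then have "(of_int ?s :: 'r) dvd 1" by (rule dvdI)
  ultimately show "(\<Sum>c | length c = N. of_int (chain_of (cocycle_cells k d) c) *
      bd (\<lambda>c. of_int (chain_of (filling_cells k d) c)) c) dvd (1 :: 'r)"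
    by (simp only:)
next
  show "graded N (Suc k) (\<lambda>c. of_int (chain_of (filling_cells k d) c) :: 'r)" if "d \<in> bar_degrees k" for d
    using bar_degreesD(5)[OF that] by (force simp: graded_def)
  show "cobd (\<lambda>c. of_int (chain_of (cocycle_cells k d) c)) r = (0 :: 'r)"
    if "d \<in> bar_degrees k" "length r = N" "cnt r = Suc k" "wt d r \<le> wt d (bar_cell k d)" for d r
    using bar_degreesD(6)[OF that] by (simp add: cobd_of_int)
  show "bar_degrees k \<subseteq> D" by (auto simp: bar_degrees_def)
  show "of_int (chain_of (cocycle_cells k d) (bar_cell k d)) = (1 :: 'r) \<and> length (bar_cell k d) = N"
    if "d \<in> bar_degrees k" for d
    using bar_degreesD(2,3)[OF that] by simp
qed (fact D(1) D(2) assms(1) assms(2) assms(3) matching)+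

end

section \<open>Quotient modules of the chain modules\<close>

lemma laurent_ring_simps [simp]:
  "carrier laurent_ring = UNIV" "zero laurent_ring = 0" "add laurent_ring = (+)" "monoid.mult laurent_ring = (*)"
  by (simp_all add: ring_of_type_algebra_def)

definition residue_class :: "laurent \<Rightarrow> laurent \<Rightarrow> laurent set" where
  "residue_class p t = {s. p dvd s - t}"

lemma residue_class_eq_iff: "residue_class p s = residue_class p t \<longleftrightarrow> p dvd s - t"
proof
  assume "residue_class p s = residue_class p t"
  moreover have "s \<in> residue_class p s" by (simp add: residue_class_def)
  ultimately show "p dvd s - t" by (simp add: residue_class_def)
next
  assume st: "p dvd s - t"
  have "p dvd x - s \<longleftrightarrow> p dvd x - t" for x
    using dvd_add[OF _ st, of "x - s"] dvd_diff[OF _ st, of "x - t"] by auto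
  then show "residue_class p s = residue_class p t" by (simp add: residue_class_def)
qed

lemma principal_ideal_laurent: "PIdl\<^bsub>laurent_ring\<^esub> p = {h. p dvd h}"
  by (auto simp: cgenideal_def dvd_def mult.commute)

lemma coset_regular_module:
  "a_r_coset (regular_module laurent_ring) {h. p dvd h} t = residue_class p t"
proof -
  have "s \<in> a_r_coset (regular_module laurent_ring) {h. p dvd h} t \<longleftrightarrow> p dvd s - t" for s
    by (auto simp: a_r_coset_def r_coset_def regular_module_def intro!: exI[of _ "s - t"])
  then show ?thesis by (auto simp: residue_class_def)
qed

abbreviation cyclo :: "nat \<Rightarrow> laurent" where
  "cyclo d \<equiv> laurent_of_poly (cyclotomic d)"

lemma carrier_cyclotomic_module: "carrier (cyclotomic_module d) = range (residue_class (cyclo d))"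
proof -
  have "carrier (cyclotomic_module d) = (\<Union>a. {a_r_coset (regular_module laurent_ring) {h. cyclo d dvd h} a})"
    by (simp add: cyclotomic_module_def quotient_module_def A_RCOSETS_def RCOSETS_def a_r_coset_def
        regular_module_def principal_ideal_laurent)
  then show ?thesis by (auto simp: coset_regular_module)
qed

lemma add_cyclotomic_module:
  "residue_class (cyclo d) s \<oplus>\<^bsub>cyclotomic_module d\<^esub> residue_class (cyclo d) t = residue_class (cyclo d) (s + t)"
proof -
  have "residue_class (cyclo d) s \<oplus>\<^bsub>cyclotomic_module d\<^esub> residue_class (cyclo d) t =
      (\<Union>a\<in>residue_class (cyclo d) s. \<Union>b\<in>residue_class (cyclo d) t. {a + b})"
    by (simp add: cyclotomic_module_def quotient_module_def set_add_def set_mult_def regular_module_def)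
  also have "\<dots> = residue_class (cyclo d) (s + t)"
  proof (intro equalityI subsetI)
    fix x assume "x \<in> (\<Union>a\<in>residue_class (cyclo d) s. \<Union>b\<in>residue_class (cyclo d) t. {a + b})"
    then obtain a b where "cyclo d dvd a - s" "cyclo d dvd b - t" "x = a + b" by (auto simp: residue_class_def)
    then show "x \<in> residue_class (cyclo d) (s + t)"
      using dvd_add[of "cyclo d" "a - s" "b - t"] by (simp add: residue_class_def add_diff_add)
  next
    fix x assume "x \<in> residue_class (cyclo d) (s + t)"
    then have "x - t \<in> residue_class (cyclo d) s" "t \<in> residue_class (cyclo d) t"
      by (simp_all add: residue_class_def diff_diff_eq add.commute)
    moreover have "x = (x - t) + t" by simp
    ultimately show "x \<in> (\<Union>a\<in>residue_class (cyclo d) s. \<Union>b\<in>residue_class (cyclo d) t. {a + b})"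
      by (metis UN_I singletonI)
  qed
  finally show ?thesis .
qed

lemma smult_cyclotomic_module:
  "a \<odot>\<^bsub>cyclotomic_module d\<^esub> residue_class (cyclo d) t = residue_class (cyclo d) (a * t)"
proof -
  have smult_reg: "x \<odot>\<^bsub>regular_module laurent_ring\<^esub> y = x * y" for x y :: laurent
    by (simp add: regular_module_def)
  have "a \<odot>\<^bsub>cyclotomic_module d\<^esub> residue_class (cyclo d) t =
      (\<Union>x\<in>residue_class (cyclo d) t. residue_class (cyclo d) (a * x))"
    by (simp add: cyclotomic_module_def quotient_module_def principal_ideal_laurent coset_regular_module smult_reg)
  also have "residue_class (cyclo d) (a * x) = residue_class (cyclo d) (a * t)" if "x \<in> residue_class (cyclo d) t" for x
  proof -
    have "cyclo d dvd a * (x - t)" using that by (simp add: residue_class_def)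
    then show ?thesis by (simp add: residue_class_eq_iff right_diff_distrib)
  qed
  then have "(\<Union>x\<in>residue_class (cyclo d) t. residue_class (cyclo d) (a * x)) =
      (\<Union>x\<in>residue_class (cyclo d) t. residue_class (cyclo d) (a * t))" by simp
  also have "\<dots> = residue_class (cyclo d) (a * t)"
  proof -
    have "t \<in> residue_class (cyclo d) t" by (simp add: residue_class_def)
    then show ?thesis by blast
  qed
  finally show ?thesis .
qed

text \<open>The first isomorphism theorem with the kernel condition phrased as: the cosets of
  \<open>N\<close> are the fibres of \<open>g\<close>. The isomorphism sends a coset to its constant
  \<open>g\<close>-value.\<close>

lemma quotient_isoI:
  assumes add: "\<And>x y. x \<in> carrier M \<Longrightarrow> y \<in> carrier M \<Longrightarrow> x \<oplus>\<^bsub>M\<^esub> y \<in> carrier M \<and> g (x \<oplus>\<^bsub>M\<^esub> y) = g x \<oplus>\<^bsub>P\<^esub> g y"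
    and smult: "\<And>a x. a \<in> carrier R \<Longrightarrow> x \<in> carrier M \<Longrightarrow> a \<odot>\<^bsub>M\<^esub> x \<in> carrier M \<and> g (a \<odot>\<^bsub>M\<^esub> x) = a \<odot>\<^bsub>P\<^esub> g x"
    and coset: "\<And>x. x \<in> carrier M \<Longrightarrow> a_r_coset M N x = {y \<in> carrier M. g y = g x}"
    and surj: "g ` carrier M = carrier P"
  shows "module_isomorphic R (quotient_module M N) P"
proof -
  define f where "f A = the_elem (g ` A)" for A
  define fib where "fib x = {y \<in> carrier M. g y = g x}" for x
  have carrier: "carrier (quotient_module M N) = fib ` carrier M"
  proof -
    have "carrier (quotient_module M N) = (\<lambda>x. a_r_coset M N x) ` carrier M"
      by (auto simp: quotient_module_def A_RCOSETS_def RCOSETS_def a_r_coset_def)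
    then show ?thesis using coset by (auto simp: fib_def)
  qed
  have f_const: "f A = z" if "A \<noteq> {}" "\<And>y. y \<in> A \<Longrightarrow> g y = z" for A z
  proof -
    have "g ` A = {z}" using that by auto
    then show ?thesis by (simp add: f_def)
  qed
  have f_fib: "f (fib x) = g x" if "x \<in> carrier M" for x
    by (rule f_const) (use that in \<open>auto simp: fib_def\<close>)
  show ?thesis
    unfolding module_isomorphic_def
  proof (intro exI[of _ f] conjI ballI)
    show "bij_betw f (carrier (quotient_module M N)) (carrier P)"
      unfolding bij_betw_def
    proof
      show "inj_on f (carrier (quotient_module M N))"
      proof (rule inj_onI)
        fix A B assume AB: "A \<in> carrier (quotient_module M N)" "B \<in> carrier (quotient_module M N)" "f A = f B"
        then obtain x y where "x \<in> carrier M" "y \<in> carrier M" "A = fib x" "B = fib y" unfolding carrier by blast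
        then show "A = B" using AB(3) f_fib by (simp add: fib_def)
      qed
      show "f ` carrier (quotient_module M N) = carrier P"
        unfolding carrier surj[symmetric] image_image using f_fib by (intro image_cong) auto
    qed
  next
    fix A B assume "A \<in> carrier (quotient_module M N)" "B \<in> carrier (quotient_module M N)"
    then obtain x y where xy: "x \<in> carrier M" "y \<in> carrier M" "A = fib x" "B = fib y" unfolding carrier by blast
    have AB: "A \<oplus>\<^bsub>quotient_module M N\<^esub> B = (\<Union>a\<in>fib x. \<Union>b\<in>fib y. {a \<oplus>\<^bsub>M\<^esub> b})"
      by (simp add: quotient_module_def set_add_def set_mult_def xy)
    have "f (A \<oplus>\<^bsub>quotient_module M N\<^esub> B) = g x \<oplus>\<^bsub>P\<^esub> g y"
      unfolding AB
    proof (rule f_const)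
      have "x \<in> fib x" "y \<in> fib y" using xy by (simp_all add: fib_def)
      then show "(\<Union>a\<in>fib x. \<Union>b\<in>fib y. {a \<oplus>\<^bsub>M\<^esub> b}) \<noteq> {}" by blast
      fix z assume "z \<in> (\<Union>a\<in>fib x. \<Union>b\<in>fib y. {a \<oplus>\<^bsub>M\<^esub> b})"
      then obtain a b where "a \<in> fib x" "b \<in> fib y" "z = a \<oplus>\<^bsub>M\<^esub> b" by blast
      then show "g z = g x \<oplus>\<^bsub>P\<^esub> g y" using add[of a b] by (simp add: fib_def)
    qed
    then show "f (A \<oplus>\<^bsub>quotient_module M N\<^esub> B) = f A \<oplus>\<^bsub>P\<^esub> f B" using xy f_fib by simp
  next
    fix a A assume a: "a \<in> carrier R" and "A \<in> carrier (quotient_module M N)"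
    then obtain x where x: "x \<in> carrier M" "A = fib x" unfolding carrier by blast
    have aA: "a \<odot>\<^bsub>quotient_module M N\<^esub> A = (\<Union>y\<in>fib x. a_r_coset M N (a \<odot>\<^bsub>M\<^esub> y))"
      by (simp add: quotient_module_def x)
    have "f (a \<odot>\<^bsub>quotient_module M N\<^esub> A) = a \<odot>\<^bsub>P\<^esub> g x"
      unfolding aA
    proof (rule f_const)
      have "x \<in> fib x" using x by (simp add: fib_def)
      moreover have "a \<odot>\<^bsub>M\<^esub> x \<in> a_r_coset M N (a \<odot>\<^bsub>M\<^esub> x)" using smult[OF a x(1)] coset by blast
      ultimately show "(\<Union>y\<in>fib x. a_r_coset M N (a \<odot>\<^bsub>M\<^esub> y)) \<noteq> {}" by blast
      fix z assume "z \<in> (\<Union>y\<in>fib x. a_r_coset M N (a \<odot>\<^bsub>M\<^esub> y))"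
      then obtain y where y: "y \<in> fib x" "z \<in> a_r_coset M N (a \<odot>\<^bsub>M\<^esub> y)" by blast
      then show "g z = a \<odot>\<^bsub>P\<^esub> g x" using smult[OF a, of y] coset[of "a \<odot>\<^bsub>M\<^esub> y"] by (auto simp: fib_def)
    qed
    then show "f (a \<odot>\<^bsub>quotient_module M N\<^esub> A) = a \<odot>\<^bsub>P\<^esub> f A" using x f_fib by simp
  qed
qed

lemma chain_module_simps:
  "carrier (chain_module W S k) = cells W S k \<rightarrow>\<^sub>E UNIV"
  "zero (chain_module W S k) = (\<lambda>\<sigma>\<in>cells W S k. 0)"
  "add (chain_module W S k) = (\<lambda>x y. \<lambda>\<sigma>\<in>cells W S k. x \<sigma> + y \<sigma>)"
  "module.smult (chain_module W S k) = (\<lambda>a x. \<lambda>\<sigma>\<in>cells W S k. a * x \<sigma>)"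
  by (simp_all add: chain_module_def direct_sum_module_def regular_module_def restrict_def)

text \<open>To be applied with cycles \<open>Z\<close>, boundaries \<open>N\<close> and the homology
  functionals \<open>F\<close>: the residues of all \<open>F d\<close> form the map onto the direct
  sum, and \<open>N\<close> is its kernel.\<close>

lemma quotient_iso_cyclotomic_sum:
  fixes W :: "('a, 'b) monoid_scheme" and S :: "'a set" and k :: nat
    and Z N :: "('a set \<Rightarrow> laurent) set" and F :: "nat \<Rightarrow> ('a set \<Rightarrow> laurent) \<Rightarrow> laurent"
  defines "C \<equiv> cells W S k"
  assumes Z: "Z \<subseteq> extensional C"
    and Z_add: "\<And>x y. x \<in> Z \<Longrightarrow> y \<in> Z \<Longrightarrow> (\<lambda>\<sigma>\<in>C. x \<sigma> + y \<sigma>) \<in> Z"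
    and Z_smult: "\<And>a x. x \<in> Z \<Longrightarrow> (\<lambda>\<sigma>\<in>C. a * x \<sigma>) \<in> Z"
    and F_add: "\<And>d x y. d \<in> set ds \<Longrightarrow> x \<in> Z \<Longrightarrow> y \<in> Z \<Longrightarrow> F d (\<lambda>\<sigma>\<in>C. x \<sigma> + y \<sigma>) = F d x + F d y"
    and F_smult: "\<And>d a x. d \<in> set ds \<Longrightarrow> x \<in> Z \<Longrightarrow> F d (\<lambda>\<sigma>\<in>C. a * x \<sigma>) = a * F d x"
    and N: "N = {x \<in> Z. \<forall>d\<in>set ds. cyclo d dvd F d x}"
    and surj: "\<And>t. \<exists>x\<in>Z. \<forall>d\<in>set ds. cyclo d dvd F d x - t d"
    and ds: "distinct ds"
  shows "quotient_module ((chain_module W S k)\<lparr>carrier := Z\<rparr>) N \<cong>\<^sub>R cyclotomic_sum ds"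
proof -
  define I where "I = {..<length ds}"
  define g where "g x = (\<lambda>i\<in>I. residue_class (cyclo (ds ! i)) (F (ds ! i) x))" for x
  have dsI: "ds ! i \<in> set ds" if "i \<in> I" for i using that by (simp add: I_def)
  have g_eq: "g x = g y \<longleftrightarrow> (\<forall>d\<in>set ds. cyclo d dvd F d x - F d y)" for x y
  proof
    assume "g x = g y"
    then have "residue_class (cyclo (ds ! i)) (F (ds ! i) x) = residue_class (cyclo (ds ! i)) (F (ds ! i) y)"
      if "i \<in> I" for i using that by (auto simp: g_def dest: fun_cong[of _ _ i])
    then show "\<forall>d\<in>set ds. cyclo d dvd F d x - F d y"
      by (auto simp: residue_class_eq_iff in_set_conv_nth I_def)
  next
    assume "\<forall>d\<in>set ds. cyclo d dvd F d x - F d y"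
    then show "g x = g y" unfolding g_def using dsI by (intro restrict_ext) (simp add: residue_class_eq_iff)
  qed
  let ?M = "(chain_module W S k)\<lparr>carrier := Z\<rparr>"
  have sum_add: "u \<oplus>\<^bsub>cyclotomic_sum ds\<^esub> v = (\<lambda>i\<in>I. u i \<oplus>\<^bsub>cyclotomic_module (ds ! i)\<^esub> v i)"
    and sum_smult: "a \<odot>\<^bsub>cyclotomic_sum ds\<^esub> v = (\<lambda>i\<in>I. a \<odot>\<^bsub>cyclotomic_module (ds ! i)\<^esub> v i)"
    and sum_carrier: "carrier (cyclotomic_sum ds) = (\<Pi>\<^sub>E i\<in>I. carrier (cyclotomic_module (ds ! i)))" for a u v
    by (simp_all add: cyclotomic_sum_def direct_sum_module_def I_def)
  have M_add: "x \<oplus>\<^bsub>?M\<^esub> y = (\<lambda>\<sigma>\<in>C. x \<sigma> + y \<sigma>)" and M_smult: "a \<odot>\<^bsub>?M\<^esub> x = (\<lambda>\<sigma>\<in>C. a * x \<sigma>)" for a x y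
    by (simp_all add: chain_module_simps C_def)
  have 1: "x \<oplus>\<^bsub>?M\<^esub> y \<in> carrier ?M \<and> g (x \<oplus>\<^bsub>?M\<^esub> y) = g x \<oplus>\<^bsub>cyclotomic_sum ds\<^esub> g y"
    if "x \<in> carrier ?M" "y \<in> carrier ?M" for x y
  proof -
    have xy: "x \<in> Z" "y \<in> Z" using that by simp_all
    have "g (\<lambda>\<sigma>\<in>C. x \<sigma> + y \<sigma>) = g x \<oplus>\<^bsub>cyclotomic_sum ds\<^esub> g y"
      unfolding sum_add unfolding g_def
      by (rule restrict_ext) (simp add: F_add[OF dsI xy] add_cyclotomic_module)
    then show ?thesis using Z_add[OF xy] unfolding M_add by simp
  qed
  have 2: "a \<odot>\<^bsub>?M\<^esub> x \<in> carrier ?M \<and> g (a \<odot>\<^bsub>?M\<^esub> x) = a \<odot>\<^bsub>cyclotomic_sum ds\<^esub> g x"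
    if "x \<in> carrier ?M" for a x
  proof -
    have x: "x \<in> Z" using that by simp
    have "g (\<lambda>\<sigma>\<in>C. a * x \<sigma>) = a \<odot>\<^bsub>cyclotomic_sum ds\<^esub> g x"
      unfolding sum_smult unfolding g_def
      by (rule restrict_ext) (simp add: F_smult[OF dsI x] smult_cyclotomic_module)
    then show ?thesis using Z_smult[OF x] unfolding M_smult by simp
  qed
  have 3: "a_r_coset ?M N x = {y \<in> carrier ?M. g y = g x}" if "x \<in> carrier ?M" for x
  proof -
    have x: "x \<in> Z" using that by simp
    have "a_r_coset ?M N x = (\<lambda>b. \<lambda>\<sigma>\<in>C. b \<sigma> + x \<sigma>) ` N"
      by (auto simp: a_r_coset_def r_coset_def chain_module_simps C_def)
    also have "\<dots> = {y \<in> Z. g y = g x}"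
    proof (intro equalityI subsetI)
      fix y assume "y \<in> (\<lambda>b. \<lambda>\<sigma>\<in>C. b \<sigma> + x \<sigma>) ` N"
      then obtain b where b: "b \<in> Z" "\<And>d. d \<in> set ds \<Longrightarrow> cyclo d dvd F d b" "y = (\<lambda>\<sigma>\<in>C. b \<sigma> + x \<sigma>)"
        unfolding N by blast
      then show "y \<in> {y \<in> Z. g y = g x}" using Z_add[OF b(1) x] F_add[OF _ b(1) x] by (simp add: g_eq)
    next
      fix y assume "y \<in> {y \<in> Z. g y = g x}"
      then have y: "y \<in> Z" "\<And>d. d \<in> set ds \<Longrightarrow> cyclo d dvd F d y - F d x" by (auto simp: g_eq)
      \<comment> \<open>Negation is obtained as scalar multiplication by -1, so that closure under
        the two module operations suffices.\<close>
      define m where "m = (\<lambda>\<sigma>\<in>C. (- 1) * x \<sigma>)"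
      define b where "b = (\<lambda>\<sigma>\<in>C. y \<sigma> + m \<sigma>)"
      have m: "m \<in> Z" unfolding m_def by (rule Z_smult[OF x])
      have b: "b \<in> Z" unfolding b_def by (rule Z_add[OF y(1) m])
      have "F d b = F d y - F d x" if "d \<in> set ds" for d
      proof -
        have "F d b = F d y + F d m" unfolding b_def by (rule F_add[OF that y(1) m])
        also have "F d m = (- 1) * F d x" unfolding m_def by (rule F_smult[OF that x])
        finally show ?thesis by simp
      qed
      then have "b \<in> N" using b y(2) by (simp add: N)
      moreover have "y = (\<lambda>\<sigma>\<in>C. b \<sigma> + x \<sigma>)"
      proof
        fix \<sigma> show "y \<sigma> = (\<lambda>\<sigma>\<in>C. b \<sigma> + x \<sigma>) \<sigma>"
          using y(1) Z by (cases "\<sigma> \<in> C") (auto simp: b_def m_def extensional_def)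
      qed
      ultimately show "y \<in> (\<lambda>b. \<lambda>\<sigma>\<in>C. b \<sigma> + x \<sigma>) ` N" by blast
    qed
    finally show ?thesis by simp
  qed
  have 4: "g ` carrier ?M = carrier (cyclotomic_sum ds)"
  proof (intro equalityI subsetI)
    fix h assume "h \<in> g ` carrier ?M"
    then show "h \<in> carrier (cyclotomic_sum ds)"
      unfolding sum_carrier by (auto simp: g_def carrier_cyclotomic_module)
  next
    fix h assume h: "h \<in> carrier (cyclotomic_sum ds)"
    then have "\<exists>t. h i = residue_class (cyclo (ds ! i)) t" if "i \<in> I" for i
      using that unfolding sum_carrier carrier_cyclotomic_module by (auto simp: PiE_iff)
    then obtain t where t: "\<And>i. i \<in> I \<Longrightarrow> h i = residue_class (cyclo (ds ! i)) (t i)" by metis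
    \<comment> \<open>Reindexing from positions to degrees; well defined because the list is
      distinct.\<close>
    define u where "u d = t (the_inv_into I (\<lambda>i. ds ! i) d)" for d
    have u: "u (ds ! i) = t i" if "i \<in> I" for i
      using that ds by (simp add: u_def the_inv_into_f_f I_def inj_on_nth)
    obtain x where x: "x \<in> Z" "\<And>d. d \<in> set ds \<Longrightarrow> cyclo d dvd F d x - u d" using surj[of u] by blast
    have "g x = h"
    proof
      fix i show "g x i = h i"
      proof (cases "i \<in> I")
        case True
        then have "residue_class (cyclo (ds ! i)) (F (ds ! i) x) = residue_class (cyclo (ds ! i)) (t i)"
          using x(2)[OF dsI[OF True]] u by (simp add: residue_class_eq_iff)
        then show ?thesis using True t by (simp add: g_def)
      next
        case False
        then show ?thesis using h unfolding sum_carrier by (auto simp: g_def PiE_iff extensional_def)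
      qed
    qed
    then show "h \<in> g ` carrier ?M" using x by force
  qed
  show ?thesis by (rule quotient_isoI[where g = g]) (erule (1) 1, erule 2, erule 3, rule 4)
qed

section \<open>The complex of an exceptional Coxeter system\<close>

lemma finite_idx [simp]: "finite (idx c)"
  by (simp add: idx_def)

lemma card_idx: "card (idx c) = cnt c"
  unfolding cnt_def idx_def count_list_eq_length_filter length_filter_conv_card
  by (rule arg_cong[of _ _ card]) auto

lemma idx_up: "j < length c \<Longrightarrow> idx (c[j := True]) = insert j (idx c)"
  by (auto simp: idx_def nth_list_update)

lemma idx_inject: "length c = length c' \<Longrightarrow> idx c = idx c' \<Longrightarrow> c = c'"
proof (rule nth_equalityI)
  fix i assume "length c = length c'" "idx c = idx c'" "i < length c"
  then show "c ! i = c' ! i" by (auto simp: idx_def set_eq_iff)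
qed

lemma minus_one_power_card:
  "finite A \<Longrightarrow> (- 1 :: 'a::comm_ring_1) ^ card {i \<in> A. P i} = (\<Prod>i\<in>A. if P i then - 1 else 1)"
proof -
  assume "finite A"
  then have "(\<Prod>i\<in>A. if P i then - 1 else 1 :: 'a) = (\<Prod>i\<in>{i \<in> A. P i}. - 1)"
    by (rule prod.inter_filter[symmetric])
  then show ?thesis by simp
qed

lemma sg_eq: "j < length c \<Longrightarrow> (sg c j :: 'a::comm_ring_1) = (\<Prod>i\<in>idx c. if i < j then - 1 else 1)"
proof -
  assume j: "j < length c"
  have "idx (take j c) = {i \<in> idx c. i < j}" using j by (auto simp: idx_def)
  then have "cnt (take j c) = card {i \<in> idx c. i < j}" using card_idx[of "take j c"] by simp
  then show ?thesis by (simp add: sg_def minus_one_power_card)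
qed

locale exceptional_complex = exceptional W S T s + certified T
  for W :: "('a, 'b) monoid_scheme" (structure) and S T s +
  fixes r :: "('a \<times> 'a) set"
  assumes r: "linear_order_on S r"
    and poincare: "poincare_checks T"
begin

section \<open>Subsets of generators as bit lists\<close>

definition dec :: "bool list \<Rightarrow> 'a set" where "dec c = s ` idx c"

definition enc :: "'a set \<Rightarrow> bool list" where "enc \<sigma> = map (\<lambda>i. s i \<in> \<sigma>) [0..<N]"

lemma inj_s: "inj_on s {..<N}" and S_eq: "S = s ` {..<N}"
  using bij by (simp_all add: bij_betw_def)

lemma s_inject: "i < N \<Longrightarrow> j < N \<Longrightarrow> s i = s j \<longleftrightarrow> i = j"
  using inj_s by (auto simp: inj_on_def)

lemma length_enc [simp]: "length (enc \<sigma>) = N"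
  by (simp add: enc_def)

lemma dec_enc: "\<sigma> \<subseteq> S \<Longrightarrow> dec (enc \<sigma>) = \<sigma>"
  by (auto simp: dec_def enc_def idx_def S_eq)

lemma enc_dec: "length c = N \<Longrightarrow> enc (dec c) = c"
  by (rule nth_equalityI) (auto simp: enc_def dec_def idx_def s_inject image_iff)

lemma dec_subset: "length c = N \<Longrightarrow> dec c \<subseteq> S"
  using idx_subset by (auto simp: dec_def S_eq)

lemma card_dec: "length c = N \<Longrightarrow> card (dec c) = cnt c"
  unfolding dec_def card_idx[symmetric]
  by (rule card_image) (rule inj_on_subset[OF inj_s idx_subset])

lemma finite_generate: "length c = N \<Longrightarrow> finite (generate W (dec c))"
  unfolding dec_def using poincare_parabolic(1)[OF poincare] generate_eq[OF idx_subset] by simp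

lemma cells_eq: "cells W S k = dec ` {c. length c = N \<and> cnt c = k}"
proof (intro equalityI subsetI)
  fix \<sigma> assume "\<sigma> \<in> cells W S k"
  then have "\<sigma> \<subseteq> S" "card \<sigma> = k" by (auto simp: cells_def)
  then have "\<sigma> = dec (enc \<sigma>)" "cnt (enc \<sigma>) = k" using dec_enc card_dec[of "enc \<sigma>"] by auto
  then show "\<sigma> \<in> dec ` {c. length c = N \<and> cnt c = k}" by force
next
  fix \<sigma> assume "\<sigma> \<in> dec ` {c. length c = N \<and> cnt c = k}"
  then show "\<sigma> \<in> cells W S k" using dec_subset card_dec finite_generate by (auto simp: cells_def)
qed

lemma dec_in_cells: "length c = N \<Longrightarrow> dec c \<in> cells W S k \<longleftrightarrow> cnt c = k"
  using card_dec[of c] dec_subset[of c] finite_generate[of c] by (auto simp: cells_def)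

lemma cofaces:
  assumes "length c = N" "cnt c = k"
  shows "{\<sigma> \<in> cells W S (Suc k). dec c \<subset> \<sigma>} = (\<lambda>j. dec (c[j := True])) ` {j. j < length c \<and> \<not> c ! j}"
proof (intro equalityI subsetI)
  fix \<sigma> assume "\<sigma> \<in> {\<sigma> \<in> cells W S (Suc k). dec c \<subset> \<sigma>}"
  then obtain c' where c': "length c' = N" "cnt c' = Suc k" "\<sigma> = dec c'" "dec c \<subset> dec c'"
    by (auto simp: cells_eq)
  have sub: "idx c \<subseteq> idx c'"
  proof
    fix i assume i: "i \<in> idx c"
    then have "s i \<in> s ` idx c'" using c'(4) unfolding dec_def by blast
    then obtain i' where "i' \<in> idx c'" "s i = s i'" by blast
    moreover have "i < N" "i' < N" using i calculation(1) assms(1) c'(1) by (auto simp: idx_def)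
    ultimately show "i \<in> idx c'" using s_inject by metis
  qed
  have "card (idx c' - idx c) = 1"
    using sub c'(2) assms(2) by (simp add: card_Diff_subset card_idx)
  then obtain j where j: "idx c' - idx c = {j}" by (rule card_1_singletonE)
  then have "idx c' = insert j (idx c)" using sub by blast
  moreover have jc: "j < N" "\<not> c ! j" using j c'(1) assms(1) by (auto simp: idx_def set_eq_iff)
  ultimately have "c' = c[j := True]" using assms(1) c'(1) by (intro idx_inject) (simp_all add: idx_up)
  then show "\<sigma> \<in> (\<lambda>j. dec (c[j := True])) ` {j. j < length c \<and> \<not> c ! j}" using jc c' assms(1) by auto
next
  fix \<sigma> assume "\<sigma> \<in> (\<lambda>j. dec (c[j := True])) ` {j. j < length c \<and> \<not> c ! j}"
  then obtain j where j: "j < length c" "\<not> c ! j" "\<sigma> = dec (c[j := True])" by auto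
  have "card (dec c) < card (dec (c[j := True]))"
    using card_dec[of c] card_dec[of "c[j := True]"] cnt_up[OF j(1,2)] assms by simp
  then have "dec c \<subset> dec (c[j := True])"
    using idx_up[OF j(1)] by (auto simp: dec_def)
  then show "\<sigma> \<in> {\<sigma> \<in> cells W S (Suc k). dec c \<subset> \<sigma>}"
    using dec_in_cells[of "c[j := True]" "Suc k"] cnt_up[OF j(1,2)] assms j by simp
qed

lemma inj_cofaces: "length c = N \<Longrightarrow> inj_on (\<lambda>j. dec (c[j := True])) {j. j < length c \<and> \<not> c ! j}"
proof (rule inj_onI)
  fix i j assume c: "length c = N" and i: "i \<in> {j. j < length c \<and> \<not> c ! j}" and j: "j \<in> {j. j < length c \<and> \<not> c ! j}"
    and eq: "dec (c[i := True]) = dec (c[j := True])"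
  have "c[i := True] = c[j := True]" using arg_cong[OF eq, of enc] c by (simp add: enc_dec)
  then have "idx (c[i := True]) = idx (c[j := True])" by (rule arg_cong)
  then have "insert i (idx c) = insert j (idx c)" using i j by (simp add: idx_up)
  moreover have "i \<notin> idx c" using i by (simp add: idx_def)
  ultimately show "i = j" by blast
qed

text \<open>The signs that transform the incidence numbers for \<open>r\<close> into those for the order of the
  vertices in Bourbaki's numbering.\<close>

definition inversion :: "nat \<Rightarrow> nat \<Rightarrow> laurent" where
  "inversion i j = (if (s j, s i) \<in> r then - 1 else 1)"

definition orientation :: "bool list \<Rightarrow> laurent" where
  "orientation c = (\<Prod>(i, j)\<in>{(i, j). i \<in> idx c \<and> j \<in> idx c \<and> i < j}. inversion i j)"

lemma finite_pairs: "finite {(i, j). i \<in> idx c \<and> j \<in> idx c \<and> i < j}"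
  by (rule finite_subset[of _ "idx c \<times> idx c"]) auto

lemma orientation_up:
  assumes "j < length c" "\<not> c ! j"
  shows "orientation (c[j := True]) =
    orientation c * (\<Prod>i\<in>idx c. if i < j then inversion i j else inversion j i)"
proof -
  let ?P = "\<lambda>c. {(i, j). i \<in> idx c \<and> j \<in> idx c \<and> i < j}"
  define f where "f i = (if i < j then (i, j) else (j, i))" for i
  have j: "j \<notin> idx c" using assms by (simp add: idx_def)
  have un: "?P (c[j := True]) = ?P c \<union> f ` idx c"
  proof (intro equalityI subsetI)
    fix x assume "x \<in> ?P (c[j := True])"
    then obtain a b where x: "x = (a, b)" "a \<in> insert j (idx c)" "b \<in> insert j (idx c)" "a < b"
      using idx_up[OF assms(1)] by auto
    consider "a = j" | "b = j" | "a \<noteq> j" "b \<noteq> j" by blast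
    then show "x \<in> ?P c \<union> f ` idx c"
    proof cases
      case 1
      then have "b \<in> idx c" "x = f b" using x by (auto simp: f_def)
      then show ?thesis by blast
    next
      case 2
      then have "a \<in> idx c" "x = f a" using x by (auto simp: f_def)
      then show ?thesis by blast
    next
      case 3 then show ?thesis using x by auto
    qed
  next
    fix x assume "x \<in> ?P c \<union> f ` idx c"
    then show "x \<in> ?P (c[j := True])"
      using idx_up[OF assms(1)] j by (auto simp: f_def nat_neq_iff split: if_splits) (metis nat_neq_iff)
  qed
  have disj: "?P c \<inter> f ` idx c = {}" using j by (auto simp: f_def split: if_splits)
  have inj: "inj_on f (idx c)" using j by (auto simp: f_def inj_on_def split: if_splits)
  have "orientation (c[j := True]) = (\<Prod>(i, j)\<in>?P c. inversion i j) * (\<Prod>(i, j)\<in>f ` idx c. inversion i j)"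
    unfolding orientation_def un by (rule prod.union_disjoint) (use finite_pairs disj in auto)
  also have "(\<Prod>(i, j)\<in>f ` idx c. inversion i j) = (\<Prod>i\<in>idx c. if i < j then inversion i j else inversion j i)"
    unfolding prod.reindex[OF inj] by (rule prod.cong) (auto simp: f_def)
  finally show ?thesis by (simp only: orientation_def)
qed

lemma orientation_square: "orientation c * orientation c = 1"
proof -
  have "orientation c * orientation c = (\<Prod>(i, j)\<in>{(i, j). i \<in> idx c \<and> j \<in> idx c \<and> i < j}. inversion i j * inversion i j)"
    unfolding orientation_def prod.distrib[symmetric] by (rule prod.cong) auto
  also have "\<dots> = 1" by (rule prod.neutral) (auto simp: inversion_def)
  finally show ?thesis .
qed

text \<open>Both signs are products over the vertices \<open>i\<close> of the smaller cell. For each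
  \<open>i\<close> the factors differ exactly when the two orders disagree on \<open>i\<close> and
  \<open>j\<close>, which is what \<open>orientation\<close> gains when \<open>j\<close> is
  added.\<close>

lemma incidence_eq:
  assumes "length c = N" "j < N" "\<not> c ! j"
  shows "incidence r (dec (c[j := True])) (dec c) * orientation c = sg c j * orientation (c[j := True])"
proof -
  have j: "j \<notin> idx c" using assms by (simp add: idx_def)
  have I: "i < N" "i \<noteq> j" if "i \<in> idx c" for i using that assms by (auto simp: idx_def)
  have "dec (c[j := True]) - dec c = {s j}"
    using idx_up[of j c] j I s_inject assms by (auto simp: dec_def)
  then have "incidence r (dec (c[j := True])) (dec c) = (- 1) ^ card {t \<in> s ` idx c. (t, s j) \<in> r}"
    by (simp add: incidence_def dec_def)
  also have "{t \<in> s ` idx c. (t, s j) \<in> r} = s ` {i \<in> idx c. (s i, s j) \<in> r}" by auto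
  also have "card \<dots> = card {i \<in> idx c. (s i, s j) \<in> r}"
    by (rule card_image, rule inj_on_subset[OF inj_s]) (use I in auto)
  also have "(- 1 :: laurent) ^ \<dots> = (\<Prod>i\<in>idx c. if (s i, s j) \<in> r then - 1 else 1)"
    by (rule minus_one_power_card) simp
  also have "\<dots> = (\<Prod>i\<in>idx c. (if i < j then - 1 else 1) * (if i < j then inversion i j else inversion j i))"
  proof (rule prod.cong)
    fix i assume i: "i \<in> idx c"
    have "s i \<in> S" "s j \<in> S" "s i \<noteq> s j" using I[OF i] assms s_S s_inject by auto
    then have "(s i, s j) \<in> r \<longleftrightarrow> (s j, s i) \<notin> r"
      using r by (auto simp: linear_order_on_def partial_order_on_def total_on_def antisym_def)
    then show "(if (s i, s j) \<in> r then - 1 else 1) =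
        (if i < j then - 1 else 1) * (if i < j then inversion i j else inversion j i)"
      by (auto simp: inversion_def)
  qed simp
  also have "\<dots> = sg c j * (\<Prod>i\<in>idx c. if i < j then inversion i j else inversion j i)"
    using assms by (simp add: prod.distrib sg_eq)
  finally show ?thesis using assms by (simp add: orientation_up mult_ac)
qed

definition pp :: "bool list \<Rightarrow> rat poly" where "pp c = poincare_poly W S (dec c)"

text \<open>The diagonal change of basis includes the reordering sign, so that the simplicial
  boundary appears in the fixed order of the vertices whatever \<open>r\<close> is.\<close>

definition weight :: "bool list \<Rightarrow> laurent" where "weight c = orientation c * laurent_of_poly (pp c)"

lemma pp_eq: "length c = N \<Longrightarrow> pp c = (\<Prod>d\<in>D. cyclotomic d ^ wt d c)"
  unfolding pp_def dec_def poincare_parabolic(2)[OF poincare] wt_eq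
  by (rule prod_qnum_eq_prod_cyclotomic) (use D degrees in auto)

lemma pp_dvd:
  assumes "length c = N" "j < N" "\<not> c ! j"
  shows "pp c dvd pp (c[j := True])"
proof -
  have "wt d c \<le> wt d (c[j := True])" if "d \<in> D" for d
  proof -
    \<comment> \<open>A placeholder for the prime: only the combinatorial monotonicity of
      \<open>wt d\<close> is wanted here.\<close>
    interpret matching N "wt d" "mate d" "rank d" "0 :: int" by (rule matching[OF that])
    have "c[j := True, j := False] = c" using assms list_update_id[of c j] by simp
    then show ?thesis using v_mono[of "c[j := True]" j] assms by simp
  qed
  then show ?thesis using assms by (simp add: pp_eq prod_dvd_prod le_imp_power_dvd)
qed

text \<open>The quotient of Poincare polynomials telescopes against the weight of the smaller cell,
  because the polynomial division is exact. This turns the given differential into the simplicial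
  one.\<close>

lemma boundary_coeff_weight:
  assumes "length c = N" "j < N" "\<not> c ! j"
  shows "boundary_coeff W S r (dec (c[j := True])) (dec c) * weight c = sg c j * weight (c[j := True])"
proof -
  have "boundary_coeff W S r (dec (c[j := True])) (dec c) * weight c =
      (incidence r (dec (c[j := True])) (dec c) * orientation c) * laurent_of_poly (pp (c[j := True]) div pp c * pp c)"
    unfolding boundary_coeff_def weight_def pp_def laurent_of_poly_mult by (simp only: mult_ac)
  also have "pp (c[j := True]) div pp c * pp c = pp (c[j := True])"
    using pp_dvd[OF assms] by simp
  finally show ?thesis unfolding incidence_eq[OF assms] weight_def by (simp only: mult_ac)
qed

lemma weight_factor:
  "length c = N \<Longrightarrow> \<exists>u. u dvd 1 \<and> weight c = u * (\<Prod>d\<in>D. cyclo d ^ wt d c)"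
  using orientation_square[of c]
  by (intro exI[of _ "orientation c"])
     (auto simp: weight_def pp_eq laurent_of_poly_prod laurent_of_poly_power intro: dvdI[of _ _ "orientation c"])

sublocale ws: weighted_simplex N D cyclo wt weight mate rank k "bar_degrees k" "bar_cell k"
  "\<lambda>d c. of_int (chain_of (cocycle_cells k d) c)" "\<lambda>d c. of_int (chain_of (filling_cells k d) c)" for k
proof (rule weighted_simplex)
  show "cyclo d \<noteq> 0" if "d \<in> D" for d
    using D(3)[OF that] cyclotomic_nonzero[of d] by (simp add: laurent_of_poly_eq_0_iff)
  show "comaximal (cyclo d) (cyclo e)" if "d \<in> D" "e \<in> D" "d \<noteq> e" for d e
    using D(3)[OF that(1)] D(3)[OF that(2)] that(3) by (intro comaximal_cyclotomic) auto
  show "\<exists>u. u dvd 1 \<and> weight c = u * (\<Prod>d\<in>D. cyclo d ^ wt d c)" if "length c = N" for c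
    using that by (rule weight_factor)
qed

section \<open>Cycles and boundaries as weighted simplicial chains\<close>

definition lift :: "nat \<Rightarrow> ('a set \<Rightarrow> laurent) \<Rightarrow> bool list \<Rightarrow> laurent" where
  "lift k x c = (if length c = N \<and> cnt c = k then x (dec c) else 0)"

lemma graded_lift: "graded N k (lift k x)"
  by (simp add: graded_def lift_def)

lemma lift_surj:
  assumes "graded N k u"
  obtains x where "x \<in> cells W S k \<rightarrow>\<^sub>E UNIV" "lift k x = u"
proof
  show "(\<lambda>\<sigma>\<in>cells W S k. u (enc \<sigma>)) \<in> cells W S k \<rightarrow>\<^sub>E UNIV" by simp
  show "lift k (\<lambda>\<sigma>\<in>cells W S k. u (enc \<sigma>)) = u"
  proof
    fix c show "lift k (\<lambda>\<sigma>\<in>cells W S k. u (enc \<sigma>)) c = u c"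
      using assms dec_in_cells[of c k] enc_dec[of c] unfolding graded_def lift_def by auto
  qed
qed

lemma lift_restrict: "lift k (\<lambda>\<sigma>\<in>cells W S k. f \<sigma>) = lift k f"
  using dec_in_cells by (auto simp: lift_def fun_eq_iff)

lemma weight_boundary:
  assumes "length c = N" "cnt c = k"
  shows "weight c * boundary W S r k x (dec c) = bd (\<lambda>b. weight b * lift (Suc k) x b) c"
proof -
  have "boundary W S r k x (dec c) =
      (\<Sum>\<sigma>\<in>{\<sigma> \<in> cells W S (Suc k). dec c \<subset> \<sigma>}. x \<sigma> * boundary_coeff W S r \<sigma> (dec c))"
    using dec_in_cells[OF assms(1), of k] assms(2) by (simp add: boundary_def)
  also have "\<dots> = (\<Sum>j | j < length c \<and> \<not> c ! j.
      x (dec (c[j := True])) * boundary_coeff W S r (dec (c[j := True])) (dec c))"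
    unfolding cofaces[OF assms] by (subst sum.reindex[OF inj_cofaces[OF assms(1)]]) simp
  finally have "weight c * boundary W S r k x (dec c) = (\<Sum>j | j < length c \<and> \<not> c ! j.
      x (dec (c[j := True])) * (boundary_coeff W S r (dec (c[j := True])) (dec c) * weight c))"
    by (simp add: sum_distrib_left mult_ac)
  also have "\<dots> = (\<Sum>j | j < length c \<and> \<not> c ! j. sg c j * (weight (c[j := True]) * lift (Suc k) x (c[j := True])))"
  proof (rule sum.cong)
    fix j assume "j \<in> {j. j < length c \<and> \<not> c ! j}"
    then have j: "j < N" "\<not> c ! j" "j < length c" using assms by auto
    have "lift (Suc k) x (c[j := True]) = x (dec (c[j := True]))"
      using assms cnt_up[OF j(3,2)] by (simp add: lift_def)
    then show "x (dec (c[j := True])) * (boundary_coeff W S r (dec (c[j := True])) (dec c) * weight c) =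
        sg c j * (weight (c[j := True]) * lift (Suc k) x (c[j := True]))"
      unfolding boundary_coeff_weight[OF assms(1) j(1,2)] by (simp only: mult_ac)
  qed simp
  finally show ?thesis by (simp only: bd_altdef)
qed

lemma cycles_iff:
  "x \<in> cycles W S r k \<longleftrightarrow> x \<in> cells W S k \<rightarrow>\<^sub>E UNIV \<and> (\<forall>c. bd (\<lambda>b. weight b * lift k x b) c = 0)"
proof (cases k)
  case 0
  \<comment> \<open>In degree 0 every chain is a cycle: the boundary only sees cells with at least
    one vertex, where \<open>lift 0 x\<close> vanishes.\<close>
  have "bd (\<lambda>b. weight b * lift 0 x b) c = 0" for c
    unfolding bd_altdef by (rule sum.neutral) (auto simp: lift_def cnt_up)
  then show ?thesis using 0 by (simp add: chain_module_simps)
next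
  case (Suc l)
  have "boundary W S r l x = (\<lambda>\<sigma>\<in>cells W S l. 0) \<longleftrightarrow> (\<forall>c. bd (\<lambda>b. weight b * lift (Suc l) x b) c = 0)"
  proof
    assume b: "boundary W S r l x = (\<lambda>\<sigma>\<in>cells W S l. 0)"
    show "\<forall>c. bd (\<lambda>b. weight b * lift (Suc l) x b) c = 0"
    proof
      fix c
      show "bd (\<lambda>b. weight b * lift (Suc l) x b) c = 0"
      proof (cases "length c = N \<and> cnt c = l")
        case True
        then show ?thesis using weight_boundary[of c l x] b dec_in_cells[of c l] by simp
      next
        case False
        then show ?thesis using graded_bd[OF graded_scale[OF graded_lift[of "Suc l" x], of weight]]
          unfolding graded_def by blast
      qed
    qed
  next
    assume b: "\<forall>c. bd (\<lambda>b. weight b * lift (Suc l) x b) c = 0"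
    have "boundary W S r l x \<sigma> = 0" if "\<sigma> \<in> cells W S l" for \<sigma>
    proof -
      obtain c where c: "length c = N" "cnt c = l" "\<sigma> = dec c" using \<open>\<sigma> \<in> cells W S l\<close> by (auto simp: cells_eq)
      then have "weight c * boundary W S r l x \<sigma> = 0" using weight_boundary[OF c(1,2), of x] b by simp
      then show ?thesis using ws.w_nonzero[OF c(1)] by simp
    qed
    then show "boundary W S r l x = (\<lambda>\<sigma>\<in>cells W S l. 0)"
      by (auto simp: boundary_def fun_eq_iff)
  qed
  then show ?thesis using Suc by (simp add: chain_module_simps)
qed

text \<open>Weights are nonzero and the ring is a domain, so an identity of weighted chains can be
  cancelled cell by cell.\<close>

lemma boundaries_iff:
  "x \<in> boundaries W S r k \<longleftrightarrow> x \<in> cells W S k \<rightarrow>\<^sub>E UNIV \<and>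
     (\<exists>u. graded N (Suc k) u \<and> (\<forall>c. weight c * lift k x c = bd (\<lambda>b. weight b * u b) c))"
proof
  assume "x \<in> boundaries W S r k"
  then obtain y where y: "x = boundary W S r k y" by (auto simp: boundaries_def)
  have "weight c * lift k x c = bd (\<lambda>b. weight b * lift (Suc k) y b) c" for c
  proof (cases "length c = N \<and> cnt c = k")
    case True then show ?thesis using weight_boundary[of c k y] by (simp add: y lift_def)
  next
    case False
    then have "bd (\<lambda>b. weight b * lift (Suc k) y b) c = 0"
      using graded_bd[OF graded_scale[OF graded_lift[of "Suc k" y], of weight]]
      unfolding graded_def by blast
    moreover have "lift k x c = 0" using False by (auto simp: lift_def)
    ultimately show ?thesis by simp
  qed
  moreover have "x \<in> cells W S k \<rightarrow>\<^sub>E UNIV" by (auto simp: y boundary_def)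
  ultimately show "x \<in> cells W S k \<rightarrow>\<^sub>E UNIV \<and>
     (\<exists>u. graded N (Suc k) u \<and> (\<forall>c. weight c * lift k x c = bd (\<lambda>b. weight b * u b) c))"
    using graded_lift by blast
next
  assume x: "x \<in> cells W S k \<rightarrow>\<^sub>E UNIV \<and>
     (\<exists>u. graded N (Suc k) u \<and> (\<forall>c. weight c * lift k x c = bd (\<lambda>b. weight b * u b) c))"
  then obtain u where u: "graded N (Suc k) u" "\<And>c. weight c * lift k x c = bd (\<lambda>b. weight b * u b) c" by blast
  obtain y where y: "y \<in> cells W S (Suc k) \<rightarrow>\<^sub>E UNIV" "lift (Suc k) y = u" using u(1) by (rule lift_surj)
  have "x \<sigma> = boundary W S r k y \<sigma>" for \<sigma>
  proof (cases "\<sigma> \<in> cells W S k")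
    case True
    then obtain c where c: "length c = N" "cnt c = k" "\<sigma> = dec c" by (auto simp: cells_eq)
    have "weight c * boundary W S r k y \<sigma> = weight c * x \<sigma>"
      using weight_boundary[OF c(1,2), of y] u(2)[of c] c by (simp add: y(2) lift_def)
    then show ?thesis using ws.w_nonzero[OF c(1)] by simp
  next
    case False then show ?thesis using x by (auto simp: boundary_def PiE_iff extensional_def)
  qed
  then have "x = boundary W S r k y" by blast
  then show "x \<in> boundaries W S r k" using y(1) by (auto simp: boundaries_def chain_module_simps)
qed

text \<open>Among the cycles, the boundaries are precisely the common kernel of the functionals
  modulo their \<phi>_d, and the functionals attain all residues.\<close>

theorem homology_iso:
  assumes ds: "distinct ds" "set ds = bar_degrees k"
  shows "homology W S r k \<cong>\<^sub>R cyclotomic_sum ds"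
proof -
  define F where "F d x = ws.functional k d (lift k x)" for d x
  let ?C = "cells W S k"
  let ?B = "\<lambda>x c. bd (\<lambda>b. weight b * lift k x b) c"
  have lift_add: "lift k (\<lambda>\<sigma>\<in>?C. x \<sigma> + y \<sigma>) = (\<lambda>c. lift k x c + lift k y c)" for x y
    unfolding lift_restrict by (auto simp: lift_def fun_eq_iff)
  have lift_smult: "lift k (\<lambda>\<sigma>\<in>?C. a * x \<sigma>) = (\<lambda>c. a * lift k x c)" for a x
    unfolding lift_restrict by (auto simp: lift_def fun_eq_iff)
  have B_add: "?B (\<lambda>\<sigma>\<in>?C. x \<sigma> + y \<sigma>) c = ?B x c + ?B y c" for x y c
    unfolding lift_add distrib_left by (rule bd_add)
  have B_smult: "?B (\<lambda>\<sigma>\<in>?C. a * x \<sigma>) c = a * ?B x c" for a x c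
    unfolding lift_smult mult.left_commute[of _ a] by (rule bd_scale)
  show ?thesis
    unfolding homology_def
  proof (rule quotient_iso_cyclotomic_sum[where F = F])
    show "cycles W S r k \<subseteq> extensional ?C" by (auto simp: cycles_iff PiE_iff)
    show "(\<lambda>\<sigma>\<in>?C. x \<sigma> + y \<sigma>) \<in> cycles W S r k" if "x \<in> cycles W S r k" "y \<in> cycles W S r k" for x y
      using that unfolding cycles_iff B_add by simp
    show "(\<lambda>\<sigma>\<in>?C. a * x \<sigma>) \<in> cycles W S r k" if "x \<in> cycles W S r k" for a x
      using that unfolding cycles_iff B_smult by simp
    show "F d (\<lambda>\<sigma>\<in>?C. x \<sigma> + y \<sigma>) = F d x + F d y" if "d \<in> set ds" for d x y
      unfolding F_def lift_add using that ds(2) by (intro ws.functional_add) simp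
    show "F d (\<lambda>\<sigma>\<in>?C. a * x \<sigma>) = a * F d x" if "d \<in> set ds" for d a x
      unfolding F_def lift_smult using that ds(2) by (intro ws.functional_scale) simp
    show "boundaries W S r k = {x \<in> cycles W S r k. \<forall>d\<in>set ds. cyclo d dvd F d x}"
    proof (intro equalityI subsetI)
      fix x assume x: "x \<in> boundaries W S r k"
      then obtain u where u: "graded N (Suc k) u" "\<And>c. weight c * lift k x c = bd (\<lambda>b. weight b * u b) c"
        unfolding boundaries_iff by blast
      have "(\<lambda>b. weight b * lift k x b) = bd (\<lambda>b. weight b * u b)" by (rule ext) (rule u(2))
      then have "x \<in> cycles W S r k" using x by (simp add: cycles_iff boundaries_iff bd_bd)
      moreover have "cyclo d dvd F d x" if "d \<in> set ds" for d
        unfolding F_def by (rule ws.functional_boundary[OF _ u(1)]) (use that ds(2) u(2) in auto)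
      ultimately show "x \<in> {x \<in> cycles W S r k. \<forall>d\<in>set ds. cyclo d dvd F d x}" by blast
    next
      fix x assume "x \<in> {x \<in> cycles W S r k. \<forall>d\<in>set ds. cyclo d dvd F d x}"
      then have x: "x \<in> cycles W S r k" "\<And>d. d \<in> bar_degrees k \<Longrightarrow> cyclo d dvd ws.functional k d (lift k x)"
        using ds(2) by (auto simp: F_def)
      have z: "\<And>c. ?B x c = 0" using x(1) by (simp add: cycles_iff)
      obtain u where "graded N (Suc k) u" "\<And>c. weight c * lift k x c = bd (\<lambda>b. weight b * u b) c"
        using ws.functional_kernel[OF graded_lift z x(2)] by blast
      then show "x \<in> boundaries W S r k" using x(1) unfolding boundaries_iff cycles_iff by blast
    qed
    show "\<exists>x\<in>cycles W S r k. \<forall>d\<in>set ds. cyclo d dvd F d x - t d" for t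
    proof -
      obtain u where u: "graded N k u" "\<And>c. bd (\<lambda>c. weight c * u c) c = 0"
        "\<And>d. d \<in> bar_degrees k \<Longrightarrow> cyclo d dvd ws.functional k d u - t d"
        by (rule ws.functional_surjective[where k = k and t = t], rule that)
      obtain x where x: "x \<in> ?C \<rightarrow>\<^sub>E UNIV" "lift k x = u" using u(1) by (rule lift_surj)
      have "x \<in> cycles W S r k" using x u(2) by (simp add: cycles_iff)
      moreover have "cyclo d dvd F d x - t d" if "d \<in> set ds" for d
        using u(3)[of d] that ds(2) by (simp add: F_def x(2))
      ultimately show ?thesis by blast
    qed
  qed (rule ds(1))
qed

end

text \<open>The degrees \<open>d\<close> whose certificate has a bar in homological degree
  \<open>k\<close>, in the order of the list, so that evaluation yields the lists of the statement
  literally.\<close>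

definition summands :: "exceptional_type \<Rightarrow> nat \<Rightarrow> nat list" where
  "summands T k = map fst (filter (\<lambda>(d, p, bs). k \<in> fst ` set bs) (certificates T))"

theorem homology_iso_summands:
  assumes "coxeter_system W S" "linear_order_on S r" "has_type W S T"
    "certificates_check T" "poincare_checks T"
  shows "homology W S r k \<cong>\<^sub>R cyclotomic_sum (summands T k)"
proof -
  obtain s where s: "exceptional W S T s" using assms(1,3) by (rule has_typeE)
  interpret exceptional_complex W S T s r
    using s assms by (auto simp: exceptional_complex_def exceptional_complex_axioms_def certified_def)
  have dist: "distinct (map fst (certificates T))" by (rule check_parts(2))
  have "set (summands T k) = bar_degrees k"
  proof -
    have "d \<in> set (summands T k) \<longleftrightarrow> d \<in> bar_degrees k" for d
    proof -
      have "d \<in> set (summands T k) \<longleftrightarrow> (\<exists>p bs. (d, p, bs) \<in> set (certificates T) \<and> k \<in> fst ` set bs)"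
        unfolding summands_def by force
      also have "\<dots> \<longleftrightarrow> d \<in> D \<and> k \<in> fst ` set (bars_of d)"
        using dist by (force simp: D_def bars_of_def)
      finally show ?thesis by (simp add: bar_degrees_def)
    qed
    then show ?thesis by blast
  qed
  moreover have "distinct (summands T k)" unfolding summands_def using dist by (rule distinct_map_filter)
  ultimately show ?thesis by (intro homology_iso)
qed

section \<open>The homology groups\<close>

lemma summands:
  "map (summands H3) [0, 1, 2] =
     [[2], [], [2, 6, 10]]"
  "map (summands H4) [0, 1, 2, 3] =
     [[2], [], [], [2, 3, 4, 5, 6, 10, 12, 15, 20, 30]]"
  "map (summands F4) [0, 1, 2, 3] =
     [[2], [2], [2, 3, 6], [2, 3, 4, 6, 8, 12]]"
  "map (summands E6) [0, 1, 2, 3, 4, 5] =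
     [[2], [], [], [], [6, 8], [3, 6, 9, 12]]"
  "map (summands E7) [0, 1, 2, 3, 4, 5, 6] =
     [[2], [], [], [], [6], [6], [2, 6, 14, 18]]"
  "map (summands E8) [0, 1, 2, 3, 4, 5, 6, 7] =
     [[2], [], [], [], [4], [], [8, 12], [2, 3, 4, 5, 6, 8, 10, 12, 15, 20, 24, 30]]"
  by code_simp+

theorem mainTheorem4:
  fixes W :: "('a, 'b) monoid_scheme" and S :: "'a set" and r :: "('a \<times> 'a) set"
  assumes "coxeter_system W S" and "linear_order_on S r"
  shows
    "(has_type W S H3 \<longrightarrow>
        homology W S r 0 \<cong>\<^sub>R cyclotomic_sum [2] \<and>
        homology W S r 1 \<cong>\<^sub>R cyclotomic_sum [] \<and>
        homology W S r 2 \<cong>\<^sub>R cyclotomic_sum [2, 6, 10]) \<and>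
     (has_type W S H4 \<longrightarrow>
        homology W S r 0 \<cong>\<^sub>R cyclotomic_sum [2] \<and>
        homology W S r 1 \<cong>\<^sub>R cyclotomic_sum [] \<and>
        homology W S r 2 \<cong>\<^sub>R cyclotomic_sum [] \<and>
        homology W S r 3 \<cong>\<^sub>R cyclotomic_sum [2, 3, 4, 5, 6, 10, 12, 15, 20, 30]) \<and>
     (has_type W S F4 \<longrightarrow>
        homology W S r 0 \<cong>\<^sub>R cyclotomic_sum [2] \<and>
        homology W S r 1 \<cong>\<^sub>R cyclotomic_sum [2] \<and>
        homology W S r 2 \<cong>\<^sub>R cyclotomic_sum [2, 3, 6] \<and>
        homology W S r 3 \<cong>\<^sub>R cyclotomic_sum [2, 3, 4, 6, 8, 12]) \<and>
     (has_type W S E6 \<longrightarrow>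
        homology W S r 0 \<cong>\<^sub>R cyclotomic_sum [2] \<and>
        homology W S r 1 \<cong>\<^sub>R cyclotomic_sum [] \<and>
        homology W S r 2 \<cong>\<^sub>R cyclotomic_sum [] \<and>
        homology W S r 3 \<cong>\<^sub>R cyclotomic_sum [] \<and>
        homology W S r 4 \<cong>\<^sub>R cyclotomic_sum [6, 8] \<and>
        homology W S r 5 \<cong>\<^sub>R cyclotomic_sum [3, 6, 9, 12]) \<and>
     (has_type W S E7 \<longrightarrow>
        homology W S r 0 \<cong>\<^sub>R cyclotomic_sum [2] \<and>
        homology W S r 1 \<cong>\<^sub>R cyclotomic_sum [] \<and>
        homology W S r 2 \<cong>\<^sub>R cyclotomic_sum [] \<and>
        homology W S r 3 \<cong>\<^sub>R cyclotomic_sum [] \<and>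
        homology W S r 4 \<cong>\<^sub>R cyclotomic_sum [6] \<and>
        homology W S r 5 \<cong>\<^sub>R cyclotomic_sum [6] \<and>
        homology W S r 6 \<cong>\<^sub>R cyclotomic_sum [2, 6, 14, 18]) \<and>
     (has_type W S E8 \<longrightarrow>
        homology W S r 0 \<cong>\<^sub>R cyclotomic_sum [2] \<and>
        homology W S r 1 \<cong>\<^sub>R cyclotomic_sum [] \<and>
        homology W S r 2 \<cong>\<^sub>R cyclotomic_sum [] \<and>
        homology W S r 3 \<cong>\<^sub>R cyclotomic_sum [] \<and>
        homology W S r 4 \<cong>\<^sub>R cyclotomic_sum [4] \<and>
        homology W S r 5 \<cong>\<^sub>R cyclotomic_sum [] \<and>
        homology W S r 6 \<cong>\<^sub>R cyclotomic_sum [8, 12] \<and>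
        homology W S r 7 \<cong>\<^sub>R cyclotomic_sum [2, 3, 4, 5, 6, 8, 10, 12, 15, 20, 24, 30])"
proof -
  note iso = homology_iso_summands[OF assms]
  have H3: "has_type W S H3 \<Longrightarrow> homology W S r k \<cong>\<^sub>R cyclotomic_sum (summands H3 k)" for k
    by (rule iso[OF _ certificates_check_H3 poincare_checks_H3])
  have H4: "has_type W S H4 \<Longrightarrow> homology W S r k \<cong>\<^sub>R cyclotomic_sum (summands H4 k)" for k
    by (rule iso[OF _ certificates_check_H4 poincare_checks_H4])
  have F4: "has_type W S F4 \<Longrightarrow> homology W S r k \<cong>\<^sub>R cyclotomic_sum (summands F4 k)" for k
    by (rule iso[OF _ certificates_check_F4 poincare_checks_F4])
  have E6: "has_type W S E6 \<Longrightarrow> homology W S r k \<cong>\<^sub>R cyclotomic_sum (summands E6 k)" for k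
    by (rule iso[OF _ certificates_check_E6 poincare_checks_E6])
  have E7: "has_type W S E7 \<Longrightarrow> homology W S r k \<cong>\<^sub>R cyclotomic_sum (summands E7 k)" for k
    by (rule iso[OF _ certificates_check_E7 poincare_checks_E7])
  have E8: "has_type W S E8 \<Longrightarrow> homology W S r k \<cong>\<^sub>R cyclotomic_sum (summands E8 k)" for k
    by (rule iso[OF _ certificates_check_E8 poincare_checks_E8])
  show ?thesis
    using summands H3[of 0] H3[of 1] H3[of 2] H4[of 0] H4[of 1] H4[of 2] H4[of 3] F4[of 0] F4[of 1]
      F4[of 2] F4[of 3] E6[of 0] E6[of 1] E6[of 2] E6[of 3] E6[of 4] E6[of 5] E7[of 0] E7[of 1]
      E7[of 2] E7[of 3] E7[of 4] E7[of 5] E7[of 6] E8[of 0] E8[of 1] E8[of 2] E8[of 3] E8[of 4]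
      E8[of 5] E8[of 6] E8[of 7]
    by simp
qed

end
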